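(* For all $\epsilon\in(0,1)$, all lead times $L\ge y(\epsilon)$, and all planning horizons $T\ge(1+3\epsilon^{-1})L$, $$\frac{\mathbb{E}\left[\sum_{t=L+1}^{T+L}C_t^{\pi_z}\right]}{\mathrm{OPT}(L,T)}\le 1+\epsilon .$$
   Context: **Model.** Constants: per-unit holding cost $h>0$, per-unit lost-demand penalty $c>0$, integer lead time $L$ and integer planning horizon $T$ with $T>L>0$. Demands $D_1,D_2,\dots$ are i.i.d. with the law $\mathcal{D}$ of a non-negative random variable $D$ which has finite third moment and is not deterministic. At the start of period $t$ there is on-hand inventory $I_t\ge 0$ and a pipeline vector $\mathbf{x}_t=(x_{1,t},\dots,x_{L,t})$ of orders placed but not yet received. In period $t$: first $x_{1,t}$ is added to inventory; then, before $D_t$ is seen, a non-negative order is placed; the pipeline is updated by $x_{i,t+1}=x_{i+1,t}$ for $1\le i\le L-1$ and $x_{L,t+1}=$ the new order; then $D_t$ is realized. Put $a^+=\max(a,0)$, $a^-=\max(-a,0)$, and $$I_{t+1}=(I_t+x_{1,t}-D_t)^+,\quad N_t=(I_t+x_{1,t}-D_t)^-,\quad C_t=hI_{t+1}+cN_t .$$ The system starts empty ($I_0=0$, $\mathbf{x}_0=\mathbf{0}$, so that also $I_1=0$, $\mathbf{x}_1=\mathbf{0}$); ordering decisions are made only in periods $1,\dots,T$ (orders in periods $T+1,\dots,T+L$ are $0$). An admissible policy is one whose order at time $t$ is a (possibly random) function only of $T,t,I_t,\mathbf{x}_t$ and $L,h,c,\mathcal{D}$ (in particular it does not depend on future demand realizations).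 $\Pi$ is the set of admissible policies, and a superscript $\pi$ denotes quantities under policy $\pi$. Define $$\mathrm{OPT}(L,T)=\inf_{\pi\in\Pi}\sum_{t=L+1}^{T+L}\mathbb{E}[C_t^\pi].$$ **Constant-order policies.** For $r\ge 0$, $I^r_\infty$ denotes a random variable distributed as $\sup_{k\ge 0}\left(kr-\sum_{i=1}^kD_i\right)$; for $r\ge\mathbb{E}[D]$ one has $\mathbb{E}[I^r_\infty]=+\infty$. For $r\in[0,\mathbb{E}[D))$, $\pi_r$ is the policy that orders the random amount $I^r_\infty+r$ (with $I^r_\infty$ drawn independently of the demands) in period $1$ and the constant $r$ in all subsequent periods in which orders are placed. Let $z=\operatorname{argmin}_{v\ge 0}\left(h\mathbb{E}[I^v_\infty]-cv\right)$ (the infimum of all minimizers if not unique); $z\in[0,\mathbb{E}[D))$. **Constants.** $\mathbb{E}^2[D]$ means $(\mathbb{E}[D])^2$. $\sigma$ is the standard deviation of $D$, $\zeta=\mathbb{E}\left[|D-\mathbb{E}[D]|^3\right]\sigma^{-3}$, $$Q=\inf\left\{s\ge 0:\ \mathbb{P}(D>s)\le\tfrac{h}{c+h}\right\},\qquad g=h\,\mathbb{E}[(Q-D)^+]+c\,\mathbb{E}[(D-Q)^+],$$ $$m=\left\lceil\left(26\left(3\zeta+c(h\sigma)^{-1}\mathbb{E}[D]+1\right)\right)^2\right\rceil,$$ $$y(\epsilon)=\max\left(2^{14}h\left(Q+2^{3/2}\mathbb{E}[D]\right)\left(\mathbb{E}^2[D]+\mathbb{E}[D^2]\right)^3\sigma^{-6}m^3g^{-1}\epsilon^{-1},\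 \left(12\,c\,g^{-1}\left((2ch^{-1})^{1/2}+3\right)\right)^2\epsilon^{-2}\right).$$ *)

theory Defs
  imports "HOL-Probability.Probability"
begin

section \<open>The lost-sales inventory system\<close>

text \<open>
  The state at the start of a period is the on-hand inventory together with the pipeline vector;
  the pipeline is an extensional function on \<open>{1..L}\<close>.
\<close>

type_synonym inv_state = "real \<times> (nat \<Rightarrow> real)"

definition state_space :: "nat \<Rightarrow> inv_state measure" where
  "state_space L = borel \<Otimes>\<^sub>M Pi\<^sub>M {1..L} (\<lambda>_. borel)"

definition empty_state :: "nat \<Rightarrow> inv_state" where
  "empty_state L = (0, \<lambda>i\<in>{1..L}. 0)"

definition next_state :: "nat \<Rightarrow> inv_state \<Rightarrow> real \<Rightarrow> real \<Rightarrow> inv_state" where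
  "next_state L s q d =
    (max (fst s + snd s 1 - d) 0, \<lambda>i\<in>{1..L}. if i = L then q else snd s (i + 1))"

text \<open>
  A randomized policy: in period \<open>t\<close> a seed with law \<open>seed_law \<pi> t\<close> is drawn, independently of all
  demands and of the other seeds, and the order is a function of the state and of this seed.
  The horizon, the lead time, the cost parameters and the demand law are fixed
  before the policy is chosen, so the policy may depend on them.
\<close>

record policy =
  seed_law :: "nat \<Rightarrow> real measure"
  order_fun :: "nat \<Rightarrow> inv_state \<Rightarrow> real \<Rightarrow> real"

definition admissible :: "nat \<Rightarrow> policy \<Rightarrow> bool" where
  "admissible L \<pi> \<longleftrightarrow>
    (\<forall>t. prob_space (seed_law \<pi> t) \<and> sets (seed_law \<pi> t) = sets borel \<and>
      (\<lambda>(s, u). order_fun \<pi> t s u) \<in> borel_measurable (state_space L \<Otimes>\<^sub>M borel) \<and>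
      (\<forall>s\<in>space (state_space L). AE u in seed_law \<pi> t. 0 \<le> order_fun \<pi> t s u))"

definition demand_paths :: "real measure \<Rightarrow> (nat \<Rightarrow> real) measure" where
  "demand_paths D = Pi\<^sub>M UNIV (\<lambda>_. D)"

definition sample_space :: "real measure \<Rightarrow> policy \<Rightarrow> ((nat \<Rightarrow> real) \<times> (nat \<Rightarrow> real)) measure" where
  "sample_space D \<pi> = demand_paths D \<Otimes>\<^sub>M Pi\<^sub>M UNIV (seed_law \<pi>)"

text \<open>
  A sample point \<open>\<omega>\<close> consists of the demand path and the path of seeds.
  Nothing happens in period 0; no orders are placed after period \<open>T\<close>.
\<close>

primrec state :: "nat \<Rightarrow> nat \<Rightarrow> policy \<Rightarrow> (nat \<Rightarrow> real) \<times> (nat \<Rightarrow> real) \<Rightarrow> nat \<Rightarrow> inv_state" where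
  "state L T \<pi> \<omega> 0 = empty_state L"
| "state L T \<pi> \<omega> (Suc t) =
    (if t = 0 then empty_state L
     else let s = state L T \<pi> \<omega> t;
              q = (if t \<le> T then order_fun \<pi> t s (snd \<omega> t) else 0)
          in next_state L s q (fst \<omega> t))"

definition period_cost ::
  "real \<Rightarrow> real \<Rightarrow> nat \<Rightarrow> nat \<Rightarrow> policy \<Rightarrow> (nat \<Rightarrow> real) \<times> (nat \<Rightarrow> real) \<Rightarrow> nat \<Rightarrow> real" where
  "period_cost h c L T \<pi> \<omega> t =
    (let (I, x) = state L T \<pi> \<omega> t;
         lost = max (- (I + x 1 - fst \<omega> t)) 0
     in h * fst (state L T \<pi> \<omega> (t + 1)) + c * lost)"

text \<open>
  Costs are non-negative, and an admissible policy may have infinite expected cost; so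
  expected costs are taken in \<^typ>\<open>ennreal\<close>.
\<close>

definition expected_total_cost ::
  "real measure \<Rightarrow> real \<Rightarrow> real \<Rightarrow> nat \<Rightarrow> nat \<Rightarrow> policy \<Rightarrow> ennreal" where
  "expected_total_cost D h c L T \<pi> =
    (\<integral>\<^sup>+ \<omega>. ennreal (\<Sum>t=L+1..T+L. period_cost h c L T \<pi> \<omega> t) \<partial>sample_space D \<pi>)"

definition OPT :: "real measure \<Rightarrow> real \<Rightarrow> real \<Rightarrow> nat \<Rightarrow> nat \<Rightarrow> ennreal" where
  "OPT D h c L T =
    (INF \<pi>\<in>{\<pi>. admissible L \<pi>}.
      \<Sum>t=L+1..T+L. \<integral>\<^sup>+ \<omega>. ennreal (period_cost h c L T \<pi> \<omega> t) \<partial>sample_space D \<pi>)"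

section \<open>Constant-order policies\<close>

text \<open>
  The term for \<open>k = 0\<close> is 0, so truncating the other terms at 0 does not change the supremum.
\<close>

definition I_inf :: "real \<Rightarrow> (nat \<Rightarrow> real) \<Rightarrow> ennreal" where
  "I_inf r d = (SUP k. ennreal (real k * r - (\<Sum>i=1..k. d i)))"

definition I_inf_mean :: "real measure \<Rightarrow> real \<Rightarrow> ennreal" where
  "I_inf_mean D r = (\<integral>\<^sup>+ d. I_inf r d \<partial>demand_paths D)"

text \<open>For \<open>r\<close> below the mean demand, \<open>I_inf r\<close> is almost surely finite.\<close>

definition I_inf_law :: "real measure \<Rightarrow> real \<Rightarrow> real measure" where
  "I_inf_law D r = distr (demand_paths D) borel (\<lambda>d. enn2real (I_inf r d))"

definition constant_order_policy :: "real measure \<Rightarrow> real \<Rightarrow> policy" where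
  "constant_order_policy D r =
    \<lparr> seed_law = (\<lambda>t. if t = 1 then I_inf_law D r else return borel 0),
      order_fun = (\<lambda>t s u. if t = 1 then u + r else r) \<rparr>"

definition constant_order_cost :: "real measure \<Rightarrow> real \<Rightarrow> real \<Rightarrow> real \<Rightarrow> ereal" where
  "constant_order_cost D h c v = ereal h * enn2ereal (I_inf_mean D v) - ereal (c * v)"

definition best_constant_order :: "real measure \<Rightarrow> real \<Rightarrow> real \<Rightarrow> real" where
  "best_constant_order D h c =
    Inf {v. 0 \<le> v \<and> (\<forall>w\<ge>0. constant_order_cost D h c v \<le> constant_order_cost D h c w)}"

section \<open>Constants\<close>

definition mean :: "real measure \<Rightarrow> real" where
  "mean D = (\<integral>x. x \<partial>D)"

definition std_dev :: "real measure \<Rightarrow> real" where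
  "std_dev D = sqrt (\<integral>x. (x - mean D)^2 \<partial>D)"

definition zeta :: "real measure \<Rightarrow> real" where
  "zeta D = (\<integral>x. \<bar>x - mean D\<bar>^3 \<partial>D) / std_dev D ^ 3"

definition newsvendor_quantile :: "real measure \<Rightarrow> real \<Rightarrow> real \<Rightarrow> real" where
  "newsvendor_quantile D h c = Inf {s. 0 \<le> s \<and> measure D {x. x > s} \<le> h / (c + h)}"

definition newsvendor_cost :: "real measure \<Rightarrow> real \<Rightarrow> real \<Rightarrow> real" where
  "newsvendor_cost D h c =
    (let Q = newsvendor_quantile D h c
     in h * (\<integral>x. max (Q - x) 0 \<partial>D) + c * (\<integral>x. max (x - Q) 0 \<partial>D))"

definition m_const :: "real measure \<Rightarrow> real \<Rightarrow> real \<Rightarrow> int" where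
  "m_const D h c = \<lceil>(26 * (3 * zeta D + c / (h * std_dev D) * mean D + 1))^2\<rceil>"

definition lead_time_bound :: "real measure \<Rightarrow> real \<Rightarrow> real \<Rightarrow> real \<Rightarrow> real" where
  "lead_time_bound D h c \<epsilon> =
    (let Q = newsvendor_quantile D h c;
         g = newsvendor_cost D h c;
         m = real_of_int (m_const D h c)
     in max (2^14 * h * (Q + 2 powr (3/2) * mean D) * ((mean D)^2 + (\<integral>x. x^2 \<partial>D))^3
              / std_dev D ^ 6 * m^3 / g / \<epsilon>)
            ((12 * c / g * (sqrt (2 * c / h) + 3))^2 / \<epsilon>^2))"

end

theory Submission
  imports Defs
begin

text \<open>
  Write \<open>M K r\<close> for the mean of the maximum of the first \<open>K\<close> steps of the walk with increments \<open>r - D\<close>; it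
  increases to the mean stationary inventory of the policy ordering \<open>r\<close>. An order placed now
  meets only demands that are still unknown when it is placed. Hence, averaging
  over time, the mean inventory of any policy is, up to a boundary term, at least
  \<open>M L r\<close>, where \<open>r\<close> is the average of its mean orders, and its cost per period is at least
  \<open>h M L r + c (\<mu> - r)\<close>. The best constant-order policy pays the minimum \<open>A\<close> of \<open>h M \<infinity> r + c (\<mu> - r)\<close>.
  If \<open>r\<close> is bounded away from the mean demand \<open>\<mu>\<close>, then \<open>M L r\<close> and \<open>M \<infinity> r\<close> differ by \<open>O(1/L)\<close>; if it is not,
  \<open>M L r\<close> alone makes the policy more expensive than never ordering.
\<close>

section \<open>The demand law\<close>

text \<open>Why only mean orders matter: stock dominates the net inflow over every trailing window,
  hence also over one of random length. If the length is chosen from the latest demands alone, it is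
  independent of the orders in the window, and expectations are linear in the orders. Choosing the
  length that is optimal for a constant order r turns this linear expression into M L r after
  averaging over time, without any convexity argument in the orders. The obstacle is the passage
  from M L to M \<infinity>: as r approaches \<mu> their difference is unbounded, and only third
  moments of the demand are finite. Hence the split at \<mu> - \<eta>, where \<eta> is a small
  multiple of \<sigma> / sqrt n and n is so large that fluctuations of size \<sigma> sqrt n alone
  make holding as dear as losing all demand. The error budget is A \<epsilon>/6 per period for the
  truncation at L and A \<epsilon>/3 per period for the boundary term A L, since the horizon
  condition gives L \<le> \<epsilon> T/3. The sum fits because 1/(1 + \<epsilon>) \<le> 1 -
  \<epsilon>/2.\<close>

lemma distr_pair_snd:
  assumes "prob_space M" "prob_space N"
  shows "distr (M \<Otimes>\<^sub>M N) N snd = N"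
proof (intro measure_eqI)
  interpret M: prob_space M by fact
  interpret N: prob_space N by fact
  fix A assume A: "A \<in> sets (distr (M \<Otimes>\<^sub>M N) N snd)"
  then have "emeasure (distr (M \<Otimes>\<^sub>M N) N snd) A = emeasure (M \<Otimes>\<^sub>M N) (space M \<times> A)"
    by (auto simp add: emeasure_distr space_pair_measure dest: sets.sets_into_space intro!: arg_cong2[where f=emeasure])
  with A show "emeasure (distr (M \<Otimes>\<^sub>M N) N snd) A = emeasure N A"
    by (simp add: N.emeasure_pair_measure_Times M.emeasure_space_1)
qed simp

text \<open>Independence expressed by a law-preserving map \<open>c\<close> that mixes a sample
  point with a fresh one: \<open>F\<close> does not notice the fresh point and \<open>G\<close> sees
  nothing else, so Fubini splits the product. It serves both for the steps of the walk and for
  orders against later demands.\<close>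

lemma integral_mult_resample:
  fixes F G :: "'a \<Rightarrow> real" and G' :: "'b \<Rightarrow> real"
  assumes M: "prob_space M" and N: "prob_space N"
    and c[measurable]: "c \<in> M \<Otimes>\<^sub>M N \<rightarrow>\<^sub>M M" and distr_c: "distr (M \<Otimes>\<^sub>M N) M c = M"
    and Fc: "\<And>x y. x \<in> space M \<Longrightarrow> y \<in> space N \<Longrightarrow> F (c (x, y)) = F x"
    and Gc: "\<And>x y. x \<in> space M \<Longrightarrow> y \<in> space N \<Longrightarrow> G (c (x, y)) = G' y"
    and F: "integrable M F" and G: "integrable M G" and G'[measurable]: "G' \<in> borel_measurable N"
  shows "integrable M (\<lambda>x. F x * G x)"
    and "(\<integral>x. F x * G x \<partial>M) = (\<integral>x. F x \<partial>M) * (\<integral>x. G x \<partial>M)"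
proof -
  interpret M: prob_space M by fact
  interpret N: prob_space N by fact
  interpret P: pair_prob_space M N ..
  have [measurable]: "F \<in> borel_measurable M" "G \<in> borel_measurable M"
    using F G by auto
  have eqI: "integrable M H \<longleftrightarrow> integrable (M \<Otimes>\<^sub>M N) (\<lambda>p. H (c p))"
    if "H \<in> borel_measurable M" for H :: "'a \<Rightarrow> real"
    using that integrable_distr_eq[OF c, of H] by (simp add: distr_c)
  have eqV: "(\<integral>x. H x \<partial>M) = (\<integral>p. H (c p) \<partial>(M \<Otimes>\<^sub>M N))"
    if "H \<in> borel_measurable M" for H :: "'a \<Rightarrow> real"
    using that integral_distr[OF c, of H] by (simp add: distr_c)
  have "integrable (M \<Otimes>\<^sub>M N) (\<lambda>p. G' (snd p))"
  proof -
    have "integrable (M \<Otimes>\<^sub>M N) (\<lambda>p. G (c p))"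
      using G eqI by simp
    moreover have "integrable (M \<Otimes>\<^sub>M N) (\<lambda>p. G (c p)) \<longleftrightarrow> integrable (M \<Otimes>\<^sub>M N) (\<lambda>p. G' (snd p))"
      by (intro Bochner_Integration.integrable_cong) (auto simp: space_pair_measure Gc)
    ultimately show ?thesis by simp
  qed
  moreover have dsnd: "distr (M \<Otimes>\<^sub>M N) N snd = N"
    using distr_pair_snd[OF M N] .
  ultimately have G'i: "integrable N G'"
    using integrable_distr_eq[of snd "M \<Otimes>\<^sub>M N" N G'] by simp
  have G'v: "(\<integral>y. G' y \<partial>N) = (\<integral>x. G x \<partial>M)"
  proof -
    have "(\<integral>y. G' y \<partial>N) = (\<integral>p. G' (snd p) \<partial>(M \<Otimes>\<^sub>M N))"
      using integral_distr[of snd "M \<Otimes>\<^sub>M N" N G'] by (simp add: dsnd)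
    also have "\<dots> = (\<integral>p. G (c p) \<partial>(M \<Otimes>\<^sub>M N))"
      by (intro Bochner_Integration.integral_cong) (auto simp: space_pair_measure Gc)
    finally show ?thesis using eqV by simp
  qed
  have prodi: "integrable (M \<Otimes>\<^sub>M N) (\<lambda>(x, y). F x * G' y)"
  proof (rule P.Fubini_integrable)
    show "integrable M (\<lambda>x. \<integral>y. norm (case (x, y) of (x, y) \<Rightarrow> F x * G' y) \<partial>N)"
      using F G'i by (auto simp: abs_mult)
    show "AE x in M. integrable N (\<lambda>y. case (x, y) of (x, y) \<Rightarrow> F x * G' y)"
      using G'i by auto
  qed measurable
  have cong: "F (c p) * G (c p) = (case p of (x, y) \<Rightarrow> F x * G' y)" if "p \<in> space (M \<Otimes>\<^sub>M N)" for p
    using that by (auto simp: space_pair_measure Fc Gc)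
  show "integrable M (\<lambda>x. F x * G x)"
    by (subst eqI, measurable, subst Bochner_Integration.integrable_cong[OF refl cong])
      (use prodi in auto)
  have "(\<integral>x. F x * G x \<partial>M) = (\<integral>p. (case p of (x, y) \<Rightarrow> F x * G' y) \<partial>(M \<Otimes>\<^sub>M N))"
    by (subst eqV, measurable, rule Bochner_Integration.integral_cong[OF refl cong])
  also have "\<dots> = (\<integral>x. (\<integral>y. F x * G' y \<partial>N) \<partial>M)"
    using P.integral_fst'[OF prodi] by simp
  also have "\<dots> = (\<integral>x. F x \<partial>M) * (\<integral>x. G x \<partial>M)"
    using F by (simp add: G'v)
  finally show "(\<integral>x. F x * G x \<partial>M) = (\<integral>x. F x \<partial>M) * (\<integral>x. G x \<partial>M)" .
qed

text \<open>These let the finite third moment dominate all lower moments.\<close>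

lemma abs_le_one_plus_cube: "\<bar>x :: real\<bar> \<le> 1 + \<bar>x\<bar>^3"
  and square_le_one_plus_cube: "x^2 \<le> 1 + \<bar>x\<bar>^3"
proof -
  have "\<bar>x\<bar> \<le> 1 + \<bar>x\<bar>^3 \<and> \<bar>x\<bar>^2 \<le> 1 + \<bar>x\<bar>^3"
  proof (cases "\<bar>x\<bar> \<le> 1")
    case True
    have "\<bar>x\<bar>^2 \<le> 1" using True by (intro power_le_one) auto
    moreover have "0 \<le> \<bar>x\<bar>^3" by simp
    ultimately show ?thesis using True by linarith
  next
    case False
    then show ?thesis using power_increasing[of 1 3 "\<bar>x\<bar>"] power_increasing[of 2 3 "\<bar>x\<bar>"] by simp
  qed
  then show "\<bar>x\<bar> \<le> 1 + \<bar>x\<bar>^3" "x^2 \<le> 1 + \<bar>x\<bar>^3" by auto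
qed

locale demand_law = prob_space D for D :: "real measure" +
  assumes sets_D [measurable_cong]: "sets D = sets borel"
    and nonneg_D: "AE x in D. 0 \<le> x"
    and integrable_cube: "integrable D (\<lambda>x. x^3)"
    and nondeterministic: "\<not> (\<exists>a. AE x in D. x = a)"
begin

lemma prob_D: "prob_space D"
  by (rule prob_space_axioms)

sublocale seq: sequence_space D ..

abbreviation "\<mu> \<equiv> mean D"
abbreviation "\<sigma> \<equiv> std_dev D"
abbreviation "paths \<equiv> demand_paths D"

lemma space_D [simp]: "space D = UNIV"
  using sets_eq_imp_space_eq[OF sets_D] by simp

lemma space_paths [simp]: "space paths = UNIV"
  by (simp add: demand_paths_def space_PiM)

lemma sets_paths [measurable_cong]: "sets paths = sets (Pi\<^sub>M UNIV (\<lambda>_. borel))"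
  unfolding demand_paths_def by (intro sets_PiM_cong) (auto simp: sets_D)

lemma prob_space_paths: "prob_space paths"
  unfolding demand_paths_def by (intro prob_space_PiM prob_D)

sublocale paths: prob_space paths
  by (rule prob_space_paths)

lemma distr_paths_component: "distr paths D (\<lambda>d. d i) = D"
  unfolding demand_paths_def by (intro distr_PiM_component) (auto intro: prob_D)

lemma measurable_paths_component [measurable]: "(\<lambda>d. d i) \<in> paths \<rightarrow>\<^sub>M D"
  unfolding demand_paths_def by measurable

lemma integrable_component_iff:
  fixes \<psi> :: "real \<Rightarrow> real"
  assumes "\<psi> \<in> borel_measurable borel"
  shows "integrable paths (\<lambda>d. \<psi> (d i)) \<longleftrightarrow> integrable D \<psi>"
  using assms integrable_distr_eq[of "\<lambda>d. d i" paths D \<psi>] by (simp add: distr_paths_component)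

lemma integral_component:
  fixes \<psi> :: "real \<Rightarrow> real"
  assumes "\<psi> \<in> borel_measurable borel"
  shows "(\<integral>d. \<psi> (d i) \<partial>paths) = (\<integral>x. \<psi> x \<partial>D)"
  using assms integral_distr[of "\<lambda>d. d i" paths D \<psi>] by (simp add: distr_paths_component)

lemma AE_paths_nonneg: "AE d in paths. \<forall>i. 0 \<le> d i"
proof -
  have "AE d in paths. 0 \<le> d i" for i
    unfolding demand_paths_def using nonneg_D
    by (intro AE_PiM_component) (auto intro: prob_D)
  then show ?thesis by (simp add: AE_all_countable)
qed

lemma comb_seq_measurable [measurable]:
  "(\<lambda>(d, d'). comb_seq n d d') \<in> paths \<Otimes>\<^sub>M paths \<rightarrow>\<^sub>M paths"
  unfolding demand_paths_def by (rule measurable_comb_seq)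

lemma distr_comb_seq: "distr (paths \<Otimes>\<^sub>M paths) paths (\<lambda>(d, d'). comb_seq n d d') = paths"
  unfolding demand_paths_def by (rule seq.PiM_comb_seq)

text \<open>\<open>comb_seq n d d'\<close> keeps the coordinates below \<open>n\<close> and
  continues with \<open>d'\<close>, so coordinate \<open>n\<close> becomes \<open>d' 0\<close>. The
  second premise thus says that \<open>F\<close> depends only on coordinates below
  \<open>n\<close>.\<close>

lemma integral_mult_component:
  fixes F :: "(nat \<Rightarrow> real) \<Rightarrow> real" and \<psi> :: "real \<Rightarrow> real"
  assumes F: "integrable paths F" and "\<And>d d'. F (comb_seq n d d') = F d"
    and \<psi>: "integrable D \<psi>" and [measurable]: "\<psi> \<in> borel_measurable borel"
  shows "integrable paths (\<lambda>d. F d * \<psi> (d n))"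
    and "(\<integral>d. F d * \<psi> (d n) \<partial>paths) = (\<integral>d. F d \<partial>paths) * (\<integral>x. \<psi> x \<partial>D)"
proof -
  note * = integral_mult_resample[OF prob_space_paths prob_space_paths comb_seq_measurable distr_comb_seq,
      of F n "\<lambda>d. \<psi> (d n)" "\<lambda>d. \<psi> (d 0)"]
  have "integrable paths (\<lambda>d. \<psi> (d n))"
    using \<psi> by (simp add: integrable_component_iff)
  with assms show "integrable paths (\<lambda>d. F d * \<psi> (d n))"
    "(\<integral>d. F d * \<psi> (d n) \<partial>paths) = (\<integral>d. F d \<partial>paths) * (\<integral>x. \<psi> x \<partial>D)"
    using * by (auto simp: comb_seq_def integral_component)
qed

lemma integrable_cube_bound:
  assumes "f \<in> borel_measurable borel" and "\<And>x. 0 \<le> x \<Longrightarrow> \<bar>f x :: real\<bar> \<le> C * (1 + x^3)"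
  shows "integrable D f"
proof (rule Bochner_Integration.integrable_bound)
  show "integrable D (\<lambda>x. C * (1 + x^3))"
    using integrable_cube by auto
  show "f \<in> borel_measurable D" using assms(1) by simp
  show "AE x in D. norm (f x) \<le> norm (C * (1 + x^3))"
    using nonneg_D by eventually_elim (use assms(2) in force)
qed

lemma integrable_id [simp]: "integrable D (\<lambda>x. x)"
  by (rule integrable_cube_bound[of _ 1], simp, metis abs_le_one_plus_cube abs_of_nonneg mult_1)

lemma integrable_square [simp]: "integrable D (\<lambda>x. x^2)"
  by (rule integrable_cube_bound[of _ 1], simp, metis square_le_one_plus_cube abs_of_nonneg mult_1 abs_power2)

lemma integrable_abs_cube [simp]: "integrable D (\<lambda>x. \<bar>x - \<mu>\<bar>^3)"
proof (rule integrable_cube_bound[of _ "4 * (1 + \<bar>\<mu>\<bar>^3)"])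
  fix x :: real assume x: "0 \<le> x"
  have "\<bar>x - \<mu>\<bar> \<le> x + \<bar>\<mu>\<bar>" using x by auto
  then have "\<bar>x - \<mu>\<bar>^3 \<le> (x + \<bar>\<mu>\<bar>)^3" by (intro power_mono) auto
  also have "\<dots> \<le> 4 * (x^3 + \<bar>\<mu>\<bar>^3)"
  proof -
    have "4 * (x^3 + y^3) - (x + y)^3 = 3 * (x + y) * (x - y)^2" for y :: real
      by (simp add: power2_eq_square power3_eq_cube algebra_simps)
    moreover have "0 \<le> 3 * (x + \<bar>\<mu>\<bar>) * (x - \<bar>\<mu>\<bar>)^2" using x by simp
    ultimately show ?thesis by (metis diff_ge_0_iff_ge)
  qed
  also have "\<dots> \<le> 4 * (1 + \<bar>\<mu>\<bar>^3) * (1 + x^3)"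
    using x by (simp add: algebra_simps)
  finally show "\<bar>\<bar>x - \<mu>\<bar>^3\<bar> \<le> 4 * (1 + \<bar>\<mu>\<bar>^3) * (1 + x^3)" by simp
qed simp

lemma integrable_dev_square [simp]: "integrable D (\<lambda>x. (x - \<mu>)^2)"
proof -
  have "(x - \<mu>)^2 = x^2 - 2 * \<mu> * x + \<mu>^2" for x by (simp add: power2_eq_square algebra_simps)
  then show ?thesis by simp
qed

lemma sigma_square: "\<sigma>^2 = (\<integral>x. (x - \<mu>)^2 \<partial>D)"
  unfolding std_dev_def by simp

lemma second_moment: "(\<integral>x. x^2 \<partial>D) = \<sigma>^2 + \<mu>^2"
proof -
  have "(x - \<mu>)^2 = x^2 - 2 * \<mu> * x + \<mu>^2" for x by (simp add: power2_eq_square algebra_simps)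
  then have "\<sigma>^2 = (\<integral>x. x^2 \<partial>D) - 2 * \<mu> * \<mu> + \<mu>^2"
    unfolding sigma_square by (simp add: mean_def prob_space[simplified])
  then show ?thesis by (simp add: power2_eq_square)
qed

lemma sigma_pos: "0 < \<sigma>"
proof -
  have "\<sigma> \<noteq> 0"
  proof
    assume "\<sigma> = 0"
    then have "(\<integral>x. (x - \<mu>)^2 \<partial>D) = 0" using sigma_square by simp
    then have "AE x in D. (x - \<mu>)^2 = 0"
      by (subst integral_nonneg_eq_0_iff_AE[symmetric]) auto
    then have "AE x in D. x = \<mu>" by simp
    then show False using nondeterministic by blast
  qed
  moreover have "0 \<le> \<sigma>" by (simp add: std_dev_def)
  ultimately show ?thesis by simp
qed

lemma mean_pos: "0 < \<mu>"
proof -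
  have "0 \<le> \<mu>" unfolding mean_def using nonneg_D by (intro integral_nonneg_AE) auto
  moreover have "\<mu> \<noteq> 0"
  proof
    assume "\<mu> = 0"
    then have "AE x in D. x = 0"
      unfolding mean_def using nonneg_D by (subst integral_nonneg_eq_0_iff_AE[symmetric]) auto
    then show False using nondeterministic by blast
  qed
  ultimately show ?thesis by simp
qed

end

text \<open>A Taylor expansion of the cubed modulus around \<open>a\<close>. What matters is that
  the first-order term is exactly linear in \<open>b\<close>: it vanishes in expectation when
  \<open>b\<close> is a centred step independent of \<open>a\<close>.\<close>

lemma abs_add_cube_le:
  fixes a b :: real
  shows "\<bar>a + b\<bar>^3 \<le> \<bar>a\<bar>^3 + 3 * (a * \<bar>a\<bar>) * b + 3 * \<bar>a\<bar> * b^2 + \<bar>b\<bar>^3"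
proof -
  have *: "\<bar>a + b\<bar>^3 \<le> \<bar>a\<bar>^3 + 3 * (a * \<bar>a\<bar>) * b + 3 * \<bar>a\<bar> * b^2 + \<bar>b\<bar>^3" if a: "0 \<le> a" for a b :: real
  proof (cases "0 \<le> a + b")
    case True
    have "\<bar>a + b\<bar>^3 = a^3 + 3 * (a * a) * b + 3 * a * b^2 + b^3"
      using True by (simp add: power2_eq_square power3_eq_cube algebra_simps)
    moreover have "b^3 \<le> \<bar>b\<bar>^3" by (metis abs_ge_self power_abs)
    ultimately show ?thesis using a by simp
  next
    case False
    then have "b < 0" using a by simp
    \<comment> \<open>The bracket is the positive definite form a^2 + 3ab + 3b^2, written so that a
      square can be completed.\<close>
    have "\<bar>a\<bar>^3 + 3 * (a * \<bar>a\<bar>) * b + 3 * \<bar>a\<bar> * b^2 + \<bar>b\<bar>^3 - \<bar>a + b\<bar>^3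
      = 2 * a * (b^2 + b^2 + (a + b)^2 + a * b)"
      using a False \<open>b < 0\<close> by (simp add: power2_eq_square power3_eq_cube algebra_simps)
    moreover have "b^2 + b^2 + (a + b)^2 + a * b = (a + 3/2 * b)^2 + 3/4 * b^2"
      by (simp add: power2_eq_square algebra_simps)
    moreover have "0 \<le> 2 * a * ((a + 3/2 * b)^2 + 3/4 * b^2)" using a by simp
    ultimately show ?thesis by (metis diff_ge_0_iff_ge)
  qed
  show ?thesis
  proof (cases "0 \<le> a")
    case True then show ?thesis by (rule *)
  next
    case False
    then show ?thesis using *[of "- a" "- b"] abs_minus_cancel[of "a + b"] by simp
  qed
qed

section \<open>The random walk of a constant-order policy\<close>

lemma (in prob_space) integrable_cube_dominated:
  fixes f g :: "'a \<Rightarrow> real"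
  assumes "integrable M (\<lambda>x. \<bar>f x\<bar>^3)" and "g \<in> borel_measurable M"
    and "\<And>x. \<bar>g x\<bar> \<le> 1 + \<bar>f x\<bar>^3"
  shows "integrable M g"
proof (rule Bochner_Integration.integrable_bound)
  show "integrable M (\<lambda>x. 1 + \<bar>f x\<bar>^3)" using assms(1) by auto
qed (use assms(2,3) in \<open>auto simp: abs_of_nonneg\<close>)

lemma (in prob_space) integrable_of_cube:
  fixes f :: "'a \<Rightarrow> real"
  assumes "integrable M (\<lambda>x. \<bar>f x\<bar>^3)" and [measurable]: "f \<in> borel_measurable M"
  shows "integrable M f" "integrable M (\<lambda>x. (f x)^2)" "integrable M (\<lambda>x. f x * \<bar>f x\<bar>)"
proof -
  have *: "\<bar>f x * \<bar>f x\<bar>\<bar> = (f x)^2" for x by (simp add: abs_mult power2_eq_square)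
  show "integrable M f" "integrable M (\<lambda>x. (f x)^2)" "integrable M (\<lambda>x. f x * \<bar>f x\<bar>)"
    by (rule integrable_cube_dominated[OF assms(1)];
        simp add: abs_le_one_plus_cube square_le_one_plus_cube * del: abs_mult_self_eq)+
qed

text \<open>Integrate |f| (|f| - l)^2 \<ge> 0. Optimizing over \<open>l\<close> would give (E f^2)^2
  \<le> E|f|^3 E|f|; leaving \<open>l\<close> free avoids roots and bounds E|f| from below, or
  E|f|^3 from below, as required.\<close>

lemma (in prob_space) moment_interpolation:
  fixes f :: "'a \<Rightarrow> real" and l :: real
  assumes "integrable M (\<lambda>x. \<bar>f x\<bar>^3)" and [measurable]: "f \<in> borel_measurable M"
  shows "2 * l * expectation (\<lambda>x. (f x)^2) \<le> expectation (\<lambda>x. \<bar>f x\<bar>^3) + l^2 * expectation (\<lambda>x. \<bar>f x\<bar>)"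
proof -
  note int = integrable_of_cube[OF assms]
  have "0 \<le> expectation (\<lambda>x. \<bar>f x\<bar> * (\<bar>f x\<bar> - l)^2)"
    by (intro Bochner_Integration.integral_nonneg) auto
  also have "(\<lambda>x. \<bar>f x\<bar> * (\<bar>f x\<bar> - l)^2) = (\<lambda>x. \<bar>f x\<bar>^3 - 2 * l * (f x)^2 + l^2 * \<bar>f x\<bar>)"
    by (auto simp: fun_eq_iff power2_eq_square power3_eq_cube algebra_simps)
  also have "expectation \<dots> = expectation (\<lambda>x. \<bar>f x\<bar>^3) - 2 * l * expectation (\<lambda>x. (f x)^2)
      + l^2 * expectation (\<lambda>x. \<bar>f x\<bar>)"
    using int assms(1) by simp
  finally show ?thesis by simp
qed

definition walk :: "real \<Rightarrow> (nat \<Rightarrow> real) \<Rightarrow> nat \<Rightarrow> real" where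
  "walk r d k = real k * r - (\<Sum>i=1..k. d i)"

lemma walk_0 [simp]: "walk r d 0 = 0"
  by (simp add: walk_def)

lemma walk_Suc: "walk r d (Suc k) = walk r d k + (r - d (Suc k))"
  by (simp add: walk_def algebra_simps)

definition max_walk :: "nat \<Rightarrow> real \<Rightarrow> (nat \<Rightarrow> real) \<Rightarrow> real" where
  "max_walk K r d = Max (walk r d ` {..K})"

lemma max_walk_ge: "k \<le> K \<Longrightarrow> walk r d k \<le> max_walk K r d"
  unfolding max_walk_def by (intro Max_ge) auto

lemma max_walk_le: "(\<And>k. k \<le> K \<Longrightarrow> walk r d k \<le> a) \<Longrightarrow> max_walk K r d \<le> a"
  unfolding max_walk_def by (subst Max_le_iff) auto

lemma max_walk_nonneg: "0 \<le> max_walk K r d"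
  using max_walk_ge[of 0 K r d] by simp

lemma max_walk_mono: "K \<le> K' \<Longrightarrow> max_walk K r d \<le> max_walk K' r d"
  by (intro max_walk_le max_walk_ge) auto

lemma max_walk_Suc: "max_walk (Suc K) r d = max (max_walk K r d) (walk r d (Suc K))"
  unfolding max_walk_def by (simp add: atMost_Suc max.commute)

lemma max_walk_0 [simp]: "max_walk 0 r d = 0"
  by (simp add: max_walk_def)

text \<open>Replaces the supremum of the walk by an increasing one, so that monotone convergence
  applies to its mean.\<close>

lemma I_inf_eq_SUP_max_walk: "I_inf r d = (SUP K. ennreal (max_walk K r d))"
  unfolding I_inf_def
proof (rule antisym)
  show "(SUP k. ennreal (real k * r - (\<Sum>i=1..k. d i))) \<le> (SUP K. ennreal (max_walk K r d))"
    using max_walk_ge[of _ _ r d] by (intro SUP_mono) (auto simp: walk_def intro!: ennreal_leI)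
  have "\<exists>k. max_walk K r d = walk r d k" for K
  proof -
    have "max_walk K r d \<in> walk r d ` {..K}" unfolding max_walk_def by (intro Max_in) auto
    then show ?thesis by auto
  qed
  then show "(SUP K. ennreal (max_walk K r d)) \<le> (SUP k. ennreal (real k * r - (\<Sum>i=1..k. d i)))"
    by (intro SUP_mono) (metis UNIV_I order_refl walk_def)
qed

text \<open>Gives continuity of the truncated means in the order size, hence closed sublevel sets of
  the cost and an attained minimum.\<close>

lemma max_walk_lipschitz: "max_walk K v d \<le> max_walk K w d + real K * \<bar>v - w\<bar>"
proof (rule max_walk_le)
  fix k assume k: "k \<le> K"
  have "walk v d k = walk w d k + real k * (v - w)" by (simp add: walk_def algebra_simps)
  also have "real k * (v - w) \<le> real K * \<bar>v - w\<bar>"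
    using k by (intro order_trans[OF mult_left_mono[OF abs_ge_self] mult_right_mono]) auto
  finally show "walk v d k \<le> max_walk K w d + real K * \<bar>v - w\<bar>"
    using max_walk_ge[OF k, of w d] by simp
qed

text \<open>The third-order Lagrange remainder is non-positive because \<open>x\<close> is
  non-negative. Through this bound the sign of the demand enters the tail estimate.\<close>

lemma exp_minus_le_quadratic:
  fixes x :: real
  assumes "0 \<le> x"
  shows "exp (- x) \<le> 1 - x + x^2 / 2"
proof -
  obtain t where "exp (- x) = (\<Sum>m<3. (- x)^m / fact m) + exp t / fact 3 * (- x)^3"
    using Maclaurin_exp_le[of "- x" 3] by blast
  moreover have "exp t / fact 3 * (- x)^3 \<le> 0"
    using assms by (intro mult_nonneg_nonpos) (auto simp: power3_eq_cube mult_nonneg_nonneg)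
  ultimately show ?thesis by (simp add: eval_nat_numeral)
qed

context demand_law
begin

lemma measurable_walk [measurable]: "(\<lambda>d. walk r d k) \<in> borel_measurable paths"
  unfolding walk_def by measurable

lemma measurable_max_walk [measurable]: "(\<lambda>d. max_walk K r d) \<in> borel_measurable paths"
  by (induction K) (simp_all add: max_walk_Suc)

lemma integrable_component [simp]: "integrable paths (\<lambda>d. d i)"
  using integrable_component_iff[of "\<lambda>x. x" i] by simp

lemma expectation_component [simp]: "paths.expectation (\<lambda>d. d i) = \<mu>"
  using integral_component[of "\<lambda>x. x" i] by (simp add: mean_def)

lemma integrable_walk [simp]: "integrable paths (\<lambda>d. walk r d k)"
  unfolding walk_def by simp

lemma expectation_walk: "paths.expectation (\<lambda>d. walk r d k) = real k * (r - \<mu>)"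
  unfolding walk_def by (simp add: paths.prob_space[simplified] algebra_simps)

lemma integrable_max_walk [simp]: "integrable paths (\<lambda>d. max_walk K r d)"
  by (induction K) (simp_all add: max_walk_Suc)

definition mean_max :: "nat \<Rightarrow> real \<Rightarrow> real" where
  "mean_max K r = paths.expectation (max_walk K r)"

lemma mean_max_nonneg: "0 \<le> mean_max K r"
  unfolding mean_max_def by (intro Bochner_Integration.integral_nonneg) (simp add: max_walk_nonneg)

lemma mean_max_mono: "K \<le> K' \<Longrightarrow> mean_max K r \<le> mean_max K' r"
  unfolding mean_max_def by (intro integral_mono integrable_max_walk max_walk_mono)

lemma mean_max_lipschitz: "mean_max K v \<le> mean_max K w + real K * \<bar>v - w\<bar>"
proof -
  have "mean_max K v \<le> paths.expectation (\<lambda>d. max_walk K w d + real K * \<bar>v - w\<bar>)"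
    unfolding mean_max_def by (intro integral_mono) (auto simp: max_walk_lipschitz)
  then show ?thesis by (simp add: mean_max_def paths.prob_space[simplified])
qed

lemma continuous_mean_max: "continuous_on A (mean_max K)"
proof (rule continuous_on_subset[OF lipschitz_on_continuous_on[of "real K"] subset_UNIV], rule lipschitz_onI)
  fix v w
  show "dist (mean_max K v) (mean_max K w) \<le> real K * dist v w"
    using mean_max_lipschitz[of K v w] mean_max_lipschitz[of K w v] 
    by (simp add: dist_real_def abs_minus_commute abs_le_iff)
qed simp

lemma I_inf_mean_eq_SUP: "I_inf_mean D r = (SUP K. ennreal (mean_max K r))"
proof -
  have "I_inf_mean D r = (\<integral>\<^sup>+ d. (SUP K. ennreal (max_walk K r d)) \<partial>paths)"
    by (simp add: I_inf_mean_def I_inf_eq_SUP_max_walk)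
  also have "\<dots> = (SUP K. \<integral>\<^sup>+ d. ennreal (max_walk K r d) \<partial>paths)"
    by (intro nn_integral_monotone_convergence_SUP)
      (auto simp: incseq_def le_fun_def intro!: ennreal_leI max_walk_mono)
  also have "\<dots> = (SUP K. ennreal (mean_max K r))"
    by (simp add: nn_integral_eq_integral max_walk_nonneg mean_max_def)
  finally show ?thesis .
qed

lemma walk_comb_seq: "k < n \<Longrightarrow> walk r (comb_seq n d d') k = walk r d k"
  unfolding walk_def by (simp add: comb_seq_def)

lemma mean_max_superlinear:
  assumes "0 < r\<^sub>0" "r\<^sub>0 \<le> r"
  shows "r * mean_max K r\<^sub>0 \<le> r\<^sub>0 * mean_max K r"
proof -
  have "AE d in paths. r * max_walk K r\<^sub>0 d \<le> r\<^sub>0 * max_walk K r d"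
    using AE_paths_nonneg
  proof eventually_elim
    case (elim d)
    have "max_walk K r\<^sub>0 d \<le> r\<^sub>0 / r * max_walk K r d"
    proof (rule max_walk_le)
      fix k assume k: "k \<le> K"
      have "r\<^sub>0 * (\<Sum>i=1..k. d i) \<le> r * (\<Sum>i=1..k. d i)"
        using assms elim by (intro mult_right_mono sum_nonneg) auto
      then have "r * walk r\<^sub>0 d k \<le> r\<^sub>0 * walk r d k"
        by (simp add: walk_def algebra_simps)
      also have "\<dots> \<le> r\<^sub>0 * max_walk K r d"
        using assms k by (intro mult_left_mono max_walk_ge) auto
      finally show "walk r\<^sub>0 d k \<le> r\<^sub>0 / r * max_walk K r d"
        using assms by (simp add: field_simps)
    qed
    then show ?case using assms by (simp add: field_simps)
  qed
  then have "paths.expectation (\<lambda>d. r * max_walk K r\<^sub>0 d) \<le> paths.expectation (\<lambda>d. r\<^sub>0 * max_walk K r d)"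
    by (intro integral_mono_AE) auto
  then show ?thesis by (simp add: mean_max_def)
qed

section \<open>Moments of the centred walk\<close>

lemma dev_integrals:
  shows "integrable D (\<lambda>x. \<mu> - x)" "(\<integral>x. \<mu> - x \<partial>D) = 0"
    "integrable D (\<lambda>x. (\<mu> - x)^2)" "(\<integral>x. (\<mu> - x)^2 \<partial>D) = \<sigma>^2"
    "integrable D (\<lambda>x. \<bar>\<mu> - x\<bar>^3)" "(\<integral>x. \<bar>\<mu> - x\<bar>^3 \<partial>D) = zeta D * \<sigma>^3"
proof -
  show "integrable D (\<lambda>x. (\<mu> - x)^2)" "(\<integral>x. (\<mu> - x)^2 \<partial>D) = \<sigma>^2"
    using integrable_dev_square sigma_square by (simp_all add: power2_commute[of \<mu>])
  show "integrable D (\<lambda>x. \<bar>\<mu> - x\<bar>^3)" "(\<integral>x. \<bar>\<mu> - x\<bar>^3 \<partial>D) = zeta D * \<sigma>^3"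
    using integrable_abs_cube sigma_pos by (simp_all add: abs_minus_commute[of \<mu>] zeta_def)
qed (simp_all add: mean_def prob_space[simplified])

text \<open>The claims share one induction: the cube step needs integrability and, through E|X|
  \<le> sqrt (E X^2), the variance. Besides the zeta term a step adds at most 3 \<sigma>^3 sqrt n,
  and 2 n sqrt n is the antiderivative of 3 sqrt n.\<close>

lemma walk_moments:
  shows integrable_walk_cube: "integrable paths (\<lambda>d. \<bar>walk \<mu> d n\<bar>^3)"
    and walk_variance: "paths.expectation (\<lambda>d. (walk \<mu> d n)^2) = real n * \<sigma>^2"
    and walk_cube_bound: "paths.expectation (\<lambda>d. \<bar>walk \<mu> d n\<bar>^3)
      \<le> real n * zeta D * \<sigma>^3 + 2 * \<sigma>^3 * (real n * sqrt (real n))"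
proof (induction n)
  case 0
  { case 1 show ?case by simp next case 2 show ?case by simp next case 3 show ?case by simp }
next
  case (Suc n)
  let ?X = "\<lambda>d. walk \<mu> d n" and ?Y = "\<lambda>d. \<mu> - d (Suc n)"
  note cube = Suc.IH(1)
  note int = paths.integrable_of_cube[OF cube measurable_walk]
  note Yint = dev_integrals
  have Y3: "integrable paths (\<lambda>d. \<bar>?Y d\<bar>^3)" "paths.expectation (\<lambda>d. \<bar>?Y d\<bar>^3) = zeta D * \<sigma>^3"
    and Y2: "integrable paths (\<lambda>d. (?Y d)^2)" "paths.expectation (\<lambda>d. (?Y d)^2) = \<sigma>^2"
    using Yint integrable_component_iff[of "\<lambda>x. \<bar>\<mu> - x\<bar>^3" "Suc n"]
      integral_component[of "\<lambda>x. \<bar>\<mu> - x\<bar>^3" "Suc n"]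
      integrable_component_iff[of "\<lambda>x. (\<mu> - x)^2" "Suc n"]
      integral_component[of "\<lambda>x. (\<mu> - x)^2" "Suc n"] by auto
  \<comment> \<open>The walk up to \<open>n\<close> reads only coordinates 1 to \<open>n\<close>, so
    it is independent of the step with coordinate \<open>Suc n\<close>.\<close>
  have prod: "integrable paths (\<lambda>d. f (?X d) * \<psi> (\<mu> - d (Suc n)))"
    "paths.expectation (\<lambda>d. f (?X d) * \<psi> (\<mu> - d (Suc n)))
      = paths.expectation (\<lambda>d. f (?X d)) * (\<integral>x. \<psi> (\<mu> - x) \<partial>D)"
    if "integrable paths (\<lambda>d. f (?X d))" "integrable D (\<lambda>x. \<psi> (\<mu> - x))"
      "\<psi> \<in> borel_measurable borel" for f \<psi> :: "real \<Rightarrow> real"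
    using that integral_mult_component[of "\<lambda>d. f (?X d)" "Suc n" "\<lambda>x. \<psi> (\<mu> - x)"]
    by (auto simp: walk_comb_seq)
  have XY: "integrable paths (\<lambda>d. ?X d * ?Y d)" "paths.expectation (\<lambda>d. ?X d * ?Y d) = 0"
    using prod[of "\<lambda>x. x" "\<lambda>x. x"] Yint by auto
  have XXY: "integrable paths (\<lambda>d. (?X d * \<bar>?X d\<bar>) * ?Y d)"
    "paths.expectation (\<lambda>d. (?X d * \<bar>?X d\<bar>) * ?Y d) = 0"
    using prod[of "\<lambda>x. x * \<bar>x\<bar>" "\<lambda>x. x"] Yint int by auto
  have XY2: "integrable paths (\<lambda>d. \<bar>?X d\<bar> * (?Y d)^2)"
    "paths.expectation (\<lambda>d. \<bar>?X d\<bar> * (?Y d)^2) = paths.expectation (\<lambda>d. \<bar>?X d\<bar>) * \<sigma>^2"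
    using prod[of "\<lambda>x. \<bar>x\<bar>" "\<lambda>x. x^2"] Yint int by auto
  let ?B = "\<lambda>d. \<bar>?X d\<bar>^3 + 3 * ((?X d * \<bar>?X d\<bar>) * ?Y d) + 3 * (\<bar>?X d\<bar> * (?Y d)^2) + \<bar>?Y d\<bar>^3"
  have B: "\<bar>walk \<mu> d (Suc n)\<bar>^3 \<le> ?B d" for d
    using abs_add_cube_le[of "?X d" "?Y d"] by (simp add: walk_Suc mult.assoc)
  have Bint: "integrable paths ?B"
    using cube XXY XY2 Y3 by simp
  have S3: "integrable paths (\<lambda>d. \<bar>walk \<mu> d (Suc n)\<bar>^3)"
    by (rule Bochner_Integration.integrable_bound[OF Bint]) (auto intro!: order_trans[OF B abs_ge_self])
  {
    case 1
    show ?case by (fact S3)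
  next
    case 2
    have "(walk \<mu> d (Suc n))^2 = (?X d)^2 + 2 * (?X d * ?Y d) + (?Y d)^2" for d
      by (simp add: walk_Suc power2_eq_square algebra_simps)
    then have "paths.expectation (\<lambda>d. (walk \<mu> d (Suc n))^2)
        = paths.expectation (\<lambda>d. (?X d)^2) + 2 * paths.expectation (\<lambda>d. ?X d * ?Y d)
          + paths.expectation (\<lambda>d. (?Y d)^2)"
      using int XY(1) Y2(1) by simp
    then show ?case
      using XY(2) Y2(2) Suc.IH(2) by (simp add: algebra_simps)
  next
    case 3
    have absX: "paths.expectation (\<lambda>d. \<bar>?X d\<bar>) \<le> sqrt (real n) * \<sigma>"
    proof -
      have "(paths.expectation (\<lambda>d. \<bar>?X d\<bar>))^2 \<le> paths.expectation (\<lambda>d. \<bar>?X d\<bar>^2)"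
        using paths.variance_eq[of "\<lambda>d. \<bar>?X d\<bar>"] paths.variance_positive[of "\<lambda>d. \<bar>?X d\<bar>"] int by simp
      also have "\<dots> = (sqrt (real n) * \<sigma>)^2"
        using Suc.IH(2) by (simp add: power_mult_distrib)
      finally show ?thesis
        using sigma_pos by (rule_tac power2_le_imp_le) auto
    qed
    have "paths.expectation (\<lambda>d. \<bar>walk \<mu> d (Suc n)\<bar>^3) \<le> paths.expectation ?B"
      using B Bint S3 by (intro integral_mono) auto
    also have "\<dots> = paths.expectation (\<lambda>d. \<bar>?X d\<bar>^3) + 3 * (paths.expectation (\<lambda>d. \<bar>?X d\<bar>) * \<sigma>^2) + zeta D * \<sigma>^3"
      using cube XXY XY2 Y3 by simp
    also have "\<dots> \<le> (real n * zeta D * \<sigma>^3 + 2 * \<sigma>^3 * (real n * sqrt (real n)))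
        + 3 * (sqrt (real n) * \<sigma> * \<sigma>^2) + zeta D * \<sigma>^3"
      using Suc.IH(3) mult_right_mono[OF absX, of "\<sigma>^2"] by simp
    also have "\<dots> = real (Suc n) * zeta D * \<sigma>^3 + 2 * \<sigma>^3 * (real n * sqrt (real n) + 3/2 * sqrt (real n))"
      by (simp add: algebra_simps power2_eq_square power3_eq_cube)
    also have "real n * sqrt (real n) + 3/2 * sqrt (real n) \<le> real (Suc n) * sqrt (real (Suc n))"
    proof (rule power2_le_imp_le)
      have "(real n * sqrt (real n) + 3/2 * sqrt (real n))^2 = (real n + 3/2)^2 * (sqrt (real n))^2"
        by (simp only: power_mult_distrib[symmetric] distrib_right)
      also have "\<dots> = (real n + 3/2)^2 * real n" by simp
      also have "\<dots> \<le> (real n + 1)^3"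
        by (simp add: power2_eq_square power3_eq_cube algebra_simps)
      also have "\<dots> = (real (Suc n) * sqrt (real (Suc n)))^2"
        by (simp add: power_mult_distrib power2_eq_square power3_eq_cube algebra_simps)
      finally show "(real n * sqrt (real n) + 3/2 * sqrt (real n))^2 \<le> (real (Suc n) * sqrt (real (Suc n)))^2" .
    qed simp
    finally show ?case using sigma_pos by (simp add: mult_left_mono)
  }
qed

text \<open>
  Third moments replace the central limit theorem: once \<open>sqrt n\<close> exceeds \<open>zeta\<close>, the third absolute moment of the
  centred walk is at most \<open>3 (\<sigma> sqrt n)\<^sup>3\<close>, so its first absolute moment is of order \<open>\<sigma> sqrt n\<close>.
\<close>

lemma mean_max_lower:
  assumes "zeta D \<le> sqrt (real n)" and "0 \<le> \<eta>"
  shows "\<sigma> * sqrt (real n) / 6 - real n * \<eta> \<le> mean_max n (\<mu> - \<eta>)"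
proof (cases "n = 0")
  case True then show ?thesis by (simp add: mean_max_nonneg)
next
  case False
  let ?X = "\<lambda>d. walk \<mu> d n"
  define s where "s = sqrt (real n)"
  define e where "e = paths.expectation (\<lambda>d. \<bar>?X d\<bar>)"
  have s: "0 < s" "real n = s^2" using False by (auto simp: s_def)
  note int = paths.integrable_of_cube[OF integrable_walk_cube measurable_walk, of n]
  \<comment> \<open>With second moment a = \<sigma>^2 s^2 and third-moment bound b = 3 \<sigma>^3
    s^3, interpolation gives e \<ge> (2la - b)/l^2. This is largest at l = b/a = 3 \<sigma> s, with
    value \<sigma> s/3.\<close>
  have "2 * (3 * \<sigma> * s) * (real n * \<sigma>^2) \<le> paths.expectation (\<lambda>d. \<bar>?X d\<bar>^3) + (3 * \<sigma> * s)^2 * e"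
    using paths.moment_interpolation[OF integrable_walk_cube[of n] measurable_walk, of "3 * \<sigma> * s"]
    unfolding walk_variance e_def by simp
  moreover have "paths.expectation (\<lambda>d. \<bar>?X d\<bar>^3) \<le> 3 * \<sigma>^3 * (real n * s)"
  proof -
    have "real n * zeta D * \<sigma>^3 \<le> real n * s * \<sigma>^3"
      using assms(1) sigma_pos by (intro mult_right_mono mult_left_mono) (auto simp: s_def)
    with walk_cube_bound[of n] show ?thesis unfolding s_def by (simp add: algebra_simps)
  qed
  ultimately have "(3 * \<sigma>^2 * s^2) * (\<sigma> * s) \<le> (3 * \<sigma>^2 * s^2) * (3 * e)"
    unfolding s(2) by (simp add: power2_eq_square power3_eq_cube mult_ac)
  then have *: "\<sigma> * s \<le> 3 * e"
    using sigma_pos s(1) by (subst (asm) mult_le_cancel_left_pos) auto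
  \<comment> \<open>The integrand is the positive part of the centred walk minus the drift loss;
    since the walk is centred, the positive part has mean \<open>e / 2\<close>.\<close>
  have "paths.expectation (\<lambda>d. (\<bar>?X d\<bar> + ?X d) / 2 - real n * \<eta>) \<le> mean_max n (\<mu> - \<eta>)"
    unfolding mean_max_def
  proof (rule integral_mono)
    fix d
    have w: "walk (\<mu> - \<eta>) d n = ?X d - real n * \<eta>" by (simp add: walk_def algebra_simps)
    have "0 \<le> real n * \<eta>" using assms(2) by simp
    then show "(\<bar>?X d\<bar> + ?X d) / 2 - real n * \<eta> \<le> max_walk n (\<mu> - \<eta>) d"
      using w max_walk_ge[OF order_refl[of n], of "\<mu> - \<eta>" d] max_walk_nonneg[of n "\<mu> - \<eta>" d]
      by (cases "0 \<le> ?X d") simp_all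
  qed simp_all
  then have "e / 2 - real n * \<eta> \<le> mean_max n (\<mu> - \<eta>)"
    unfolding e_def using int by (simp add: expectation_walk paths.prob_space[simplified] add_divide_distrib)
  with * show ?thesis unfolding s_def by simp
qed

text \<open>Non-negative demand has mean absolute deviation at most 2 \<mu>. Interpolation then
  gives E|D - \<mu>|^3 \<ge> 2l \<sigma>^2 - 2 \<mu> l^2, whose maximizer is l = \<sigma>^2/(2
  \<mu>). It is used to trade a factor \<sigma> for \<mu>.\<close>

lemma zeta_lower: "\<sigma> \<le> 2 * \<mu> * zeta D"
proof -
  let ?l = "\<sigma>^2 / (2 * \<mu>)" and ?a = "\<integral>x. \<bar>\<mu> - x\<bar> \<partial>D"
  have a: "?a \<le> 2 * \<mu>"
  proof -
    have "?a \<le> (\<integral>x. \<mu> + x \<partial>D)"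
      using nonneg_D mean_pos by (intro integral_mono_AE) (auto intro!: Bochner_Integration.integrable_abs elim!: eventually_mono)
    also have "\<dots> = 2 * \<mu>" by (simp add: mean_def prob_space[simplified])
    finally show ?thesis .
  qed
  have "2 * ?l * \<sigma>^2 \<le> zeta D * \<sigma>^3 + ?l^2 * ?a"
    using moment_interpolation[of "\<lambda>x. \<mu> - x" ?l] dev_integrals by simp
  also have "\<dots> \<le> zeta D * \<sigma>^3 + ?l^2 * (2 * \<mu>)"
    using a by (intro add_left_mono mult_left_mono) auto
  finally have "2 * ?l * \<sigma>^2 - ?l^2 * (2 * \<mu>) \<le> zeta D * \<sigma>^3" by simp
  moreover have "2 * ?l * \<sigma>^2 - ?l^2 * (2 * \<mu>) = \<sigma>^3 * (\<sigma> / (2 * \<mu>))"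
    using mean_pos by (simp add: field_simps power2_eq_square power3_eq_cube)
  ultimately have "\<sigma>^3 * (\<sigma> / (2 * \<mu>)) \<le> \<sigma>^3 * zeta D" by (simp add: mult.commute)
  then have "\<sigma> / (2 * \<mu>) \<le> zeta D"
    using sigma_pos by (simp only: mult_le_cancel_left_pos zero_less_power)
  then show ?thesis using mean_pos by (simp add: field_simps)
qed

end

section \<open>Tail bound for subcritical drift\<close>

text \<open>Both factors of the geometric tail, q^L and q/(1 - q), are bounded through exp x \<ge> 1
  + x; the rate 1/L is all that is needed.\<close>

lemma sum_geometric_tail_le:
  fixes b :: real
  assumes b: "0 < b" and L: "0 < L"
  shows "(\<Sum>k=Suc L..K. exp (- (real k * b))) \<le> 1 / (real L * b^2)"
proof -
  define q where "q = exp (- b)"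
  have q: "0 < q" "q < 1" using b by (auto simp: q_def)
  have pow: "exp (- (real k * b)) = q^k" for k
    unfolding q_def by (simp add: exp_of_nat_mult[symmetric])
  have "(\<Sum>k=Suc L..K. q^k) * (1 - q) \<le> q^Suc L"
  proof (cases "L \<le> K")
    case True
    have "(\<Sum>k=Suc L..K. q^k) * (1 - q) = q^Suc L - q^Suc K"
      using True by (induction K rule: dec_induct) (simp_all add: distrib_right, simp add: right_diff_distrib)
    then show ?thesis using q by simp
  next
    case False then show ?thesis using q by simp
  qed
  then have "(\<Sum>k=Suc L..K. q^k) \<le> q^L * (q / (1 - q))"
    using q by (simp add: field_simps)
  also have "\<dots> \<le> 1 / (real L * b) * (1 / b)"
  proof (intro mult_mono)
    have "real L * b \<le> exp (real L * b)" using exp_ge_add_one_self[of "real L * b"] by linarith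
    then have "1 / exp (real L * b) \<le> 1 / (real L * b)" using b L by (intro divide_left_mono) auto
    then show "q^L \<le> 1 / (real L * b)" using pow[of L] by (simp add: exp_minus inverse_eq_divide)
    have "q * exp b = 1" by (simp add: q_def exp_add[symmetric])
    moreover have "q * (1 + b) \<le> q * exp b" using q by (intro mult_left_mono) auto
    ultimately show "q / (1 - q) \<le> 1 / b" using q b by (simp add: field_simps)
  qed (use q b L in auto)
  finally show ?thesis by (simp add: pow power2_eq_square)
qed

context demand_law
begin

text \<open>For \<theta> \<ge> 0 the exponential is bounded on non-negative demands, so it is
  integrable without any exponential moment of the demand. The bound follows from the quadratic
  estimate and 1 + u \<le> exp u.\<close>

lemma exp_moment:
  assumes "0 \<le> \<theta>"
  shows "integrable D (\<lambda>x. exp (\<theta> * (r - x)))"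
    and "(\<integral>x. exp (\<theta> * (r - x)) \<partial>D) \<le> exp (\<theta> * (r - \<mu>) + \<theta>^2 / 2 * (\<integral>x. x^2 \<partial>D))"
proof -
  have bound: "AE x in D. exp (\<theta> * (r - x)) \<le> exp (\<theta> * r) * (1 - \<theta> * x + (\<theta> * x)^2 / 2)"
    using nonneg_D
  proof eventually_elim
    case (elim x)
    have "exp (\<theta> * (r - x)) = exp (\<theta> * r) * exp (- (\<theta> * x))"
      by (simp add: exp_add[symmetric] algebra_simps)
    then show ?case using exp_minus_le_quadratic[of "\<theta> * x"] assms elim by simp
  qed
  have int: "integrable D (\<lambda>x. exp (\<theta> * r) * (1 - \<theta> * x + (\<theta> * x)^2 / 2))"
    by (simp add: power_mult_distrib)
  show int': "integrable D (\<lambda>x. exp (\<theta> * (r - x)))"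
  proof (rule Bochner_Integration.integrable_bound[OF int])
    show "AE x in D. norm (exp (\<theta> * (r - x))) \<le> norm (exp (\<theta> * r) * (1 - \<theta> * x + (\<theta> * x)^2 / 2))"
      using bound by eventually_elim (auto intro: order_trans[OF _ abs_ge_self])
  qed simp
  have "(\<integral>x. exp (\<theta> * (r - x)) \<partial>D) \<le> (\<integral>x. exp (\<theta> * r) * (1 - \<theta> * x + (\<theta> * x)^2 / 2) \<partial>D)"
    using bound int int' by (intro integral_mono_AE)
  also have "\<dots> = exp (\<theta> * r) * (1 + (\<theta>^2 / 2 * (\<integral>x. x^2 \<partial>D) - \<theta> * \<mu>))"
    by (simp add: power_mult_distrib mean_def prob_space[simplified])
  also have "\<dots> \<le> exp (\<theta> * r) * exp (\<theta>^2 / 2 * (\<integral>x. x^2 \<partial>D) - \<theta> * \<mu>)"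
    using exp_ge_add_one_self by (intro mult_left_mono) auto
  also have "\<dots> = exp (\<theta> * (r - \<mu>) + \<theta>^2 / 2 * (\<integral>x. x^2 \<partial>D))"
    by (simp add: exp_add[symmetric] algebra_simps)
  finally show "(\<integral>x. exp (\<theta> * (r - x)) \<partial>D) \<le> exp (\<theta> * (r - \<mu>) + \<theta>^2 / 2 * (\<integral>x. x^2 \<partial>D))" .
qed

lemma exp_walk_moment:
  assumes "0 \<le> \<theta>"
  shows "integrable paths (\<lambda>d. exp (\<theta> * walk r d k)) \<and>
    paths.expectation (\<lambda>d. exp (\<theta> * walk r d k)) = (\<integral>x. exp (\<theta> * (r - x)) \<partial>D)^k"
proof (induction k)
  case 0
  then show ?case by (simp add: paths.prob_space[simplified])
next
  case (Suc k)
  have "exp (\<theta> * walk r d (Suc k)) = exp (\<theta> * walk r d k) * exp (\<theta> * (r - d (Suc k)))" for d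
    by (simp add: walk_Suc exp_add[symmetric] algebra_simps)
  then show ?case
    using integral_mult_component[of "\<lambda>d. exp (\<theta> * walk r d k)" "Suc k" "\<lambda>x. exp (\<theta> * (r - x))"]
      Suc exp_moment(1)[OF assms] by (simp add: walk_comb_seq)
qed

lemma second_moment_pos: "0 < (\<integral>x. x^2 \<partial>D)"
  using second_moment sigma_pos by (simp add: add_pos_nonneg)

text \<open>
  Demand being non-negative, its Laplace transform is sub-Gaussian with variance proxy \<open>E D\<^sup>2\<close>; this makes
  the truncation error summable without Spitzer's identity.
\<close>

lemma mean_max_tail:
  assumes r: "r < \<mu>" and L: "0 < L"
  shows "mean_max K r \<le> mean_max L r + 4 * (\<integral>x. x^2 \<partial>D)^3 / (real L * (\<mu> - r)^5)"
proof -
  define V where "V = (\<integral>x. x^2 \<partial>D)"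
  define \<eta> where "\<eta> = \<mu> - r"
  \<comment> \<open>This minimizes the exponent - \<theta> \<eta> + \<theta>^2 V/2, and the minimum
    is - b.\<close>
  define \<theta> where "\<theta> = \<eta> / V"
  define b where "b = \<eta>^2 / (2 * V)"
  have pos: "0 < V" "0 < \<eta>" "0 < \<theta>" "0 < b"
    using r second_moment_pos by (auto simp: V_def \<eta>_def \<theta>_def b_def)
  have E: "paths.expectation (\<lambda>d. exp (\<theta> * walk r d k)) \<le> exp (- (real k * b))" for k
  proof -
    have "(\<integral>x. exp (\<theta> * (r - x)) \<partial>D) \<le> exp (\<theta> * (r - \<mu>) + \<theta>^2 / 2 * V)"
      using exp_moment(2)[of \<theta> r] pos by (simp add: V_def)
    also have "\<theta> * (r - \<mu>) + \<theta>^2 / 2 * V = - b"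
      using pos by (simp add: \<theta>_def b_def \<eta>_def power2_eq_square divide_simps) (simp add: algebra_simps)
    finally have "(\<integral>x. exp (\<theta> * (r - x)) \<partial>D)^k \<le> exp (- b)^k"
      by (intro power_mono) auto
    then show ?thesis using exp_walk_moment[of \<theta> r k] pos by (simp add: exp_of_nat_mult[symmetric])
  qed
  have int: "integrable paths (\<lambda>d. exp (\<theta> * walk r d k))" for k
    using exp_walk_moment[of \<theta> r k] pos by simp
  \<comment> \<open>A maximum reached after step \<open>L\<close> is charged to its own term by w
    \<le> exp (\<theta> w)/\<theta>; the other terms are non-negative.\<close>
  have bound: "max_walk K r d \<le> max_walk L r d + (\<Sum>k=Suc L..K. exp (\<theta> * walk r d k) / \<theta>)" for d
  proof (rule max_walk_le)
    fix k assume k: "k \<le> K"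
    have nn: "0 \<le> (\<Sum>k=Suc L..K. exp (\<theta> * walk r d k) / \<theta>)"
      using pos by (intro sum_nonneg) auto
    show "walk r d k \<le> max_walk L r d + (\<Sum>k=Suc L..K. exp (\<theta> * walk r d k) / \<theta>)"
    proof (cases "k \<le> L")
      case True then show ?thesis using max_walk_ge[OF True, of r d] nn by simp
    next
      case False
      have "\<theta> * walk r d k \<le> exp (\<theta> * walk r d k)"
        using exp_ge_add_one_self[of "\<theta> * walk r d k"] by linarith
      then have "walk r d k \<le> exp (\<theta> * walk r d k) / \<theta>" using pos by (simp add: field_simps)
      also have "\<dots> \<le> (\<Sum>k=Suc L..K. exp (\<theta> * walk r d k) / \<theta>)"
        using False k pos by (intro member_le_sum) auto
      finally show ?thesis using max_walk_nonneg[of L r d] by simp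
    qed
  qed
  have "mean_max K r \<le> paths.expectation (\<lambda>d. max_walk L r d + (\<Sum>k=Suc L..K. exp (\<theta> * walk r d k) / \<theta>))"
    unfolding mean_max_def using bound int by (intro integral_mono) auto
  also have "\<dots> = mean_max L r + (\<Sum>k=Suc L..K. paths.expectation (\<lambda>d. exp (\<theta> * walk r d k)) / \<theta>)"
    using int by (simp add: mean_max_def)
  also have "(\<Sum>k=Suc L..K. paths.expectation (\<lambda>d. exp (\<theta> * walk r d k)) / \<theta>)
      \<le> (\<Sum>k=Suc L..K. exp (- (real k * b)) / \<theta>)"
    using E pos by (intro sum_mono divide_right_mono) auto
  also have "\<dots> = (\<Sum>k=Suc L..K. exp (- (real k * b))) / \<theta>"
    by (simp add: sum_divide_distrib)
  also have "\<dots> \<le> 1 / (real L * b^2) / \<theta>"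
    using pos L by (intro divide_right_mono sum_geometric_tail_le) auto
  also have "\<dots> = 4 * V^3 / (real L * \<eta>^5)"
    using pos L by (simp add: b_def \<theta>_def field_simps eval_nat_numeral)
  finally show ?thesis by (simp add: V_def \<eta>_def)
qed

end

section \<open>The stationary inventory\<close>

lemma I_inf_le_iff:
  assumes "0 \<le> a"
  shows "I_inf r d \<le> ennreal a \<longleftrightarrow> (\<forall>k. walk r d k \<le> a)"
  unfolding I_inf_def walk_def using assms by (simp add: SUP_le_iff ennreal_le_iff)

text \<open>\<open>case_nat\<close> prepends at index 0, while the walk reads from index 1; hence
  the shift by one.\<close>

lemma walk_case_nat:
  "walk r (\<lambda>i. case_nat x d (i - 1)) (Suc k) = r - x + walk r (\<lambda>i. d (i - 1)) k"
proof -
  have "(\<Sum>i=1..Suc k. case_nat x d (i - 1)) = x + (\<Sum>i=1..k. d (i - 1))"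
    by (induction k) simp_all
  then show ?thesis by (simp add: walk_def algebra_simps)
qed

text \<open>The supremum over the prolonged path is attained either by the empty walk, giving 0, or
  by taking the new first step and continuing with the old supremum. Finiteness makes
  \<open>enn2real\<close> faithful.\<close>

lemma lindley_equation:
  assumes "I_inf r (\<lambda>i. d (i - 1)) < \<infinity>"
  shows "I_inf r (\<lambda>i. case_nat x d (i - 1)) = ennreal (max 0 (enn2real (I_inf r (\<lambda>i. d (i - 1))) + r - x))"
    (is "?l = ennreal ?b")
proof (rule antisym)
  define m where "m = enn2real (I_inf r (\<lambda>i. d (i - 1)))"
  have m: "I_inf r (\<lambda>i. d (i - 1)) = ennreal m" "0 \<le> m"
    using assms by (auto simp: m_def)
  have wm: "walk r (\<lambda>i. d (i - 1)) k \<le> m" for k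
    using I_inf_le_iff[of m r "\<lambda>i. d (i - 1)"] m by simp
  show le: "?l \<le> ennreal ?b"
  proof (subst I_inf_le_iff, simp, rule allI)
    fix k show "walk r (\<lambda>i. case_nat x d (i - 1)) k \<le> ?b"
    proof (cases k)
      case (Suc j) then show ?thesis using wm[of j] unfolding m_def by (simp add: walk_case_nat[simplified])
    qed simp
  qed
  define a where "a = enn2real ?l"
  have "?l < \<top>" using le by (rule le_less_trans) simp
  then have a: "?l = ennreal a" "0 \<le> a" by (simp_all add: a_def)
  have "\<forall>k. walk r (\<lambda>i. case_nat x d (i - 1)) k \<le> a"
    using I_inf_le_iff[of a r "\<lambda>i. case_nat x d (i - 1)"] a by simp
  then have *: "walk r (\<lambda>i. d (i - 1)) k \<le> a - r + x" for k
    using walk_case_nat[of r x d k] by (metis add.commute diff_add_eq diff_le_eq le_diff_eq add_diff_eq)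
  have "0 \<le> a - r + x" using *[of 0] by simp
  then have "ennreal m \<le> ennreal (a - r + x)"
    using I_inf_le_iff[of "a - r + x" r "\<lambda>i. d (i - 1)"] * m by simp
  then have "m \<le> a - r + x" using \<open>0 \<le> a - r + x\<close> by (simp add: ennreal_le_iff)
  then show "ennreal ?b \<le> ?l" unfolding m_def[symmetric] a(1) using a(2) by (auto intro!: ennreal_leI)
qed

context demand_law
begin

lemma measurable_I_inf [measurable]: "I_inf r \<in> borel_measurable paths"
  unfolding I_inf_eq_SUP_max_walk[abs_def] by measurable

lemma measurable_case_nat_paths [measurable]:
  "(\<lambda>(x, d). case_nat x d) \<in> D \<Otimes>\<^sub>M paths \<rightarrow>\<^sub>M paths"
  unfolding demand_paths_def by measurable

lemma measurable_shift [measurable]: "(\<lambda>d i. d (i - Suc 0)) \<in> paths \<rightarrow>\<^sub>M paths"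
  unfolding demand_paths_def by (rule measurable_PiM_single') (auto simp: space_PiM)

lemma nn_integral_case_nat:
  assumes [measurable]: "f \<in> borel_measurable paths"
  shows "(\<integral>\<^sup>+d. f d \<partial>paths) = (\<integral>\<^sup>+x. \<integral>\<^sup>+d. f (case_nat x d) \<partial>paths \<partial>D)"
proof -
  have "distr (D \<Otimes>\<^sub>M paths) paths (\<lambda>(x, d). case_nat x d) = paths"
    unfolding demand_paths_def by (rule seq.PiM_iter)
  then have "(\<integral>\<^sup>+d. f d \<partial>paths) = (\<integral>\<^sup>+p. f (case p of (x, d) \<Rightarrow> case_nat x d) \<partial>(D \<Otimes>\<^sub>M paths))"
    using nn_integral_distr[of "\<lambda>(x, d). case_nat x d" "D \<Otimes>\<^sub>M paths" paths f] by simp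
  also have "\<dots> = (\<integral>\<^sup>+x. \<integral>\<^sup>+d. f (case_nat x d) \<partial>paths \<partial>D)"
    by (subst paths.nn_integral_fst[symmetric]) auto
  finally show ?thesis .
qed

text \<open>\<open>I_inf\<close> ignores coordinate 0, so prepending an arbitrary demand at index 0
  amounts to the shift.\<close>

lemma nn_integral_shift:
  assumes "f \<in> borel_measurable borel"
  shows "(\<integral>\<^sup>+d. f (I_inf r (\<lambda>i. d (i - Suc 0))) \<partial>paths) = (\<integral>\<^sup>+d. f (I_inf r d) \<partial>paths)"
proof -
  have "I_inf r (case_nat x d) = I_inf r (\<lambda>i. d (i - Suc 0))" for x d
  proof -
    have "walk r (case_nat x d) = walk r (\<lambda>i. d (i - Suc 0))"
      by (auto simp: fun_eq_iff walk_def intro!: sum.cong split: nat.split)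
    then show ?thesis by (simp add: I_inf_def walk_def fun_eq_iff)
  qed
  then show ?thesis
    using assms nn_integral_case_nat[of "\<lambda>d. f (I_inf r d)"] by (simp add: emeasure_space_1[simplified])
qed

lemma sets_I_inf_law [measurable_cong, simp]: "sets (I_inf_law D r) = sets borel"
  by (simp add: I_inf_law_def)

lemma prob_space_I_inf_law: "prob_space (I_inf_law D r)"
  unfolding I_inf_law_def by (intro paths.prob_space_distr) measurable

lemma nn_integral_I_inf_law:
  assumes [measurable]: "f \<in> borel_measurable borel"
  shows "(\<integral>\<^sup>+y. f y \<partial>I_inf_law D r) = (\<integral>\<^sup>+d. f (enn2real (I_inf r d)) \<partial>paths)"
  unfolding I_inf_law_def by (subst nn_integral_distr) auto

lemma AE_I_inf_finite:
  assumes "I_inf_mean D r < \<infinity>"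
  shows "AE d in paths. I_inf r d < \<infinity>"
  using nn_integral_PInf_AE[of "I_inf r" paths] assms unfolding I_inf_mean_def by (auto simp: less_top)

lemma mean_I_inf_law:
  assumes "I_inf_mean D r < \<infinity>"
  shows "(\<integral>\<^sup>+y. ennreal y \<partial>I_inf_law D r) = I_inf_mean D r"
proof -
  have "(\<integral>\<^sup>+d. ennreal (enn2real (I_inf r d)) \<partial>paths) = I_inf_mean D r"
    unfolding I_inf_mean_def using AE_I_inf_finite[OF assms]
    by (intro nn_integral_cong_AE) (auto elim!: eventually_mono)
  then show ?thesis by (simp add: nn_integral_I_inf_law)
qed

text \<open>Prepending one demand preserves the law of the path and, by
  \<open>lindley_equation\<close>, acts on the supremum like one period of the inventory.\<close>

lemma I_inf_law_stationary:
  assumes fin: "I_inf_mean D r < \<infinity>" and [measurable]: "f \<in> borel_measurable borel"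
  shows "(\<integral>\<^sup>+x. \<integral>\<^sup>+y. f (max 0 (y + r - x)) \<partial>I_inf_law D r \<partial>D) = (\<integral>\<^sup>+y. f y \<partial>I_inf_law D r)"
proof -
  let ?I = "\<lambda>d. I_inf r (\<lambda>i. d (i - 1))"
  have AE: "AE d in paths. ?I d < \<infinity>"
  proof -
    have "(\<integral>\<^sup>+d. ?I d \<partial>paths) = I_inf_mean D r"
      using nn_integral_shift[of "\<lambda>x. x" r] by (simp add: I_inf_mean_def)
    then show ?thesis using fin nn_integral_PInf_AE[of ?I paths] by (auto simp: less_top)
  qed
  have "(\<integral>\<^sup>+y. f y \<partial>I_inf_law D r) = (\<integral>\<^sup>+d. f (enn2real (?I d)) \<partial>paths)"
    using nn_integral_shift[of "\<lambda>y. f (enn2real y)" r] by (simp add: nn_integral_I_inf_law)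
  also have "\<dots> = (\<integral>\<^sup>+x. \<integral>\<^sup>+d. f (enn2real (?I (case_nat x d))) \<partial>paths \<partial>D)"
    by (subst nn_integral_case_nat) simp_all
  also have "\<dots> = (\<integral>\<^sup>+x. \<integral>\<^sup>+d. f (max 0 (enn2real (?I d) + r - x)) \<partial>paths \<partial>D)"
  proof (rule nn_integral_cong)
    fix x
    show "(\<integral>\<^sup>+d. f (enn2real (?I (case_nat x d))) \<partial>paths)
        = (\<integral>\<^sup>+d. f (max 0 (enn2real (?I d) + r - x)) \<partial>paths)"
    proof (rule nn_integral_cong_AE)
      show "AE d in paths. f (enn2real (?I (case_nat x d))) = f (max 0 (enn2real (?I d) + r - x))"
        using AE by eventually_elim (simp only: lindley_equation enn2real_ennreal max.cobounded1)
    qed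
  qed
  also have "\<dots> = (\<integral>\<^sup>+x. \<integral>\<^sup>+d. f (max 0 (enn2real (I_inf r d) + r - x)) \<partial>paths \<partial>D)"
    using nn_integral_shift[of "\<lambda>y. f (max 0 (enn2real y + r - _))" r] by simp
  also have "\<dots> = (\<integral>\<^sup>+x. \<integral>\<^sup>+y. f (max 0 (y + r - x)) \<partial>I_inf_law D r \<partial>D)"
    by (simp add: nn_integral_I_inf_law)
  finally show ?thesis ..
qed

end

section \<open>Newsvendor cost and the best constant order\<close>

context demand_law
begin

lemma mean_max_nonpos:
  assumes "r \<le> 0"
  shows "mean_max K r = 0"
proof -
  have "AE d in paths. max_walk K r d = 0"
    using AE_paths_nonneg
  proof eventually_elim
    case (elim d)
    have "walk r d k \<le> 0" for k
    proof -
      have "real k * r \<le> 0" using assms by (simp add: mult_nonneg_nonpos)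
      moreover have "0 \<le> (\<Sum>i=1..k. d i)" using elim by (intro sum_nonneg) auto
      ultimately show ?thesis by (simp add: walk_def)
    qed
    then have "max_walk K r d \<le> 0" by (rule max_walk_le)
    with max_walk_nonneg[of K r d] show ?case by simp
  qed
  then show ?thesis
    unfolding mean_max_def by (subst integral_cong_AE[where g="\<lambda>_. 0"]) auto
qed

lemma mean_max_drift: "real K * (r - \<mu>) \<le> mean_max K r"
proof -
  have "paths.expectation (\<lambda>d. walk r d K) \<le> mean_max K r"
    unfolding mean_max_def by (intro integral_mono) (auto intro: max_walk_ge)
  then show ?thesis by (simp add: expectation_walk)
qed

lemma I_inf_mean_le_iff:
  assumes "0 \<le> F"
  shows "I_inf_mean D r \<le> ennreal F \<longleftrightarrow> (\<forall>K. mean_max K r \<le> F)"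
  unfolding I_inf_mean_eq_SUP using assms by (simp add: SUP_le_iff ennreal_le_iff)

end

locale inventory = demand_law +
  fixes h c :: real
  assumes h_pos: "0 < h" and c_pos: "0 < c"
begin

definition newsvendor :: "real \<Rightarrow> real" where
  "newsvendor s = h * (\<integral>x. max (s - x) 0 \<partial>D) + c * (\<integral>x. max (x - s) 0 \<partial>D)"

abbreviation "Q \<equiv> newsvendor_quantile D h c"
abbreviation "g \<equiv> newsvendor_cost D h c"

lemma g_eq: "g = newsvendor Q"
  by (simp add: newsvendor_cost_def newsvendor_def Let_def)

lemma integrable_max [simp]:
  "integrable D (\<lambda>x. max (s - x) 0)" "integrable D (\<lambda>x. max (x - s) 0)"
  by (intro Bochner_Integration.integrable_max; simp)+

lemma newsvendor_eq: "newsvendor s = (\<integral>x. h * max (s - x) 0 + c * max (x - s) 0 \<partial>D)"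
  unfolding newsvendor_def by simp

lemma integrable_tail [simp]: "integrable D (indicat_real {x. t < x})"
  by (rule integrable_real_indicator) (auto simp: less_top[symmetric])

text \<open>The slope is the right derivative of the convex function \<open>newsvendor\<close> at
  \<open>t\<close>; the inequality already holds for each demand before integration.\<close>

lemma newsvendor_subgradient:
  "newsvendor t + (s - t) * (h - (h + c) * prob {x. t < x}) \<le> newsvendor s"
proof -
  have "newsvendor t + (s - t) * (h - (h + c) * prob {x. t < x})
    = (\<integral>x. (h * max (t - x) 0 + c * max (x - t) 0) + (s - t) * (h - (h + c) * indicat_real {x. t < x} x) \<partial>D)"
    unfolding newsvendor_eq by (simp add: prob_space[simplified])
  also have "\<dots> \<le> newsvendor s"
    unfolding newsvendor_eq
  proof (rule integral_mono)
    fix x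
    have "h * (s - x) \<le> h * max (s - x) 0" "0 \<le> h * max (s - x) 0"
      "c * (x - s) \<le> c * max (x - s) 0" "0 \<le> c * max (x - s) 0"
      using h_pos c_pos by (simp_all add: mult_left_mono)
    then show "(h * max (t - x) 0 + c * max (x - t) 0) + (s - t) * (h - (h + c) * indicat_real {x. t < x} x)
        \<le> h * max (s - x) 0 + c * max (x - s) 0"
      by (cases "t < x") (simp_all add: algebra_simps)
  qed simp_all
  finally show ?thesis .
qed

lemma quantile_set:
  defines "A \<equiv> {s. 0 \<le> s \<and> measure D {x. x > s} \<le> h / (c + h)}"
  shows "A \<noteq> {}" "bdd_below A" "0 \<le> Q"
proof -
  \<comment> \<open>Markov's inequality bounds the tail at \<open>s\<close> by \<mu>/s, which for
    this \<open>s\<close> equals h/(c + h).\<close>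
  define s where "s = \<mu> * (c + h) / h"
  have s: "0 < s" using mean_pos h_pos c_pos by (simp add: s_def)
  have "s * prob {x. s < x} = (\<integral>x. s * indicat_real {x. s < x} x \<partial>D)" by simp
  also have "\<dots> \<le> (\<integral>x. x \<partial>D)"
  proof (rule integral_mono_AE)
    show "AE x in D. s * indicat_real {x. s < x} x \<le> x"
      using nonneg_D by eventually_elim (auto simp: indicator_def)
  qed simp_all
  finally have "prob {x. s < x} \<le> \<mu> / s" using s by (simp add: mean_def field_simps)
  also have "\<mu> / s = h / (c + h)" using mean_pos h_pos c_pos add_pos_pos[OF c_pos h_pos]
    by (simp add: s_def divide_simps)
  finally show ne: "A \<noteq> {}" using s by (auto simp: A_def intro!: exI[of _ s])
  show "bdd_below A" by (auto simp: A_def bdd_below_def)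
  show "0 \<le> Q" unfolding newsvendor_quantile_def A_def[symmetric] using ne
    by (intro cInf_greatest) (auto simp: A_def)
qed

lemma newsvendor_lipschitz: "newsvendor s \<le> newsvendor t + (h + c) * \<bar>s - t\<bar>"
proof -
  have "newsvendor s \<le> (\<integral>x. (h * max (t - x) 0 + c * max (x - t) 0) + (h + c) * \<bar>s - t\<bar> \<partial>D)"
    unfolding newsvendor_eq
  proof (rule integral_mono)
    fix x
    have "h * max (s - x) 0 \<le> h * (max (t - x) 0 + \<bar>s - t\<bar>)" "c * max (x - s) 0 \<le> c * (max (x - t) 0 + \<bar>s - t\<bar>)"
      using h_pos c_pos by (auto intro!: mult_left_mono)
    then show "h * max (s - x) 0 + c * max (x - s) 0
        \<le> (h * max (t - x) 0 + c * max (x - t) 0) + (h + c) * \<bar>s - t\<bar>"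
      by (simp add: algebra_simps)
  qed simp_all
  also have "\<dots> = newsvendor t + (h + c) * \<bar>s - t\<bar>"
    unfolding newsvendor_eq by (simp add: prob_space[simplified])
  finally show ?thesis .
qed

text \<open>\<open>Q\<close> is an infimum, so the quantile inequality is read off at points near
  \<open>Q\<close> instead of at \<open>Q\<close>: there the subgradient has the right sign, and the
  Lipschitz bound carries the result to \<open>Q\<close>.\<close>

lemma g_le_newsvendor:
  assumes s: "0 \<le> s"
  shows "g \<le> newsvendor s"
proof (rule field_le_epsilon)
  fix e :: real assume e: "0 < e"
  let ?A = "{s. 0 \<le> s \<and> measure D {x. x > s} \<le> h / (c + h)}"
  define \<delta> where "\<delta> = e / (h + c)"
  have \<delta>: "0 < \<delta>" using e h_pos c_pos by (simp add: \<delta>_def)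
  have "\<exists>t. \<bar>Q - t\<bar> \<le> \<delta> \<and> newsvendor t \<le> newsvendor s"
  proof (cases s Q rule: linorder_cases)
    case less
    \<comment> \<open>Between \<open>s\<close> and \<open>Q\<close>, within \<delta> of
      \<open>Q\<close>. Lying below the infimum, \<open>t\<close> has a large tail, so the slope is
      non-positive.\<close>
    define t where "t = max ((s + Q) / 2) (Q - \<delta>)"
    have t: "s < t" "t < Q" "\<bar>Q - t\<bar> \<le> \<delta>" using less \<delta> by (auto simp: t_def less_max_iff_disj field_simps)
    have "t \<notin> ?A" using t(2) quantile_set(2) cInf_lower[of t ?A] by (auto simp: newsvendor_quantile_def)
    then have "h / (c + h) < prob {x. t < x}" using t s by auto
    then have "h - (h + c) * prob {x. t < x} \<le> 0" using h_pos c_pos by (simp add: field_simps)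
    then have "0 \<le> (s - t) * (h - (h + c) * prob {x. t < x})"
      using t by (intro mult_nonpos_nonpos) auto
    then show ?thesis using newsvendor_subgradient[of t s] t by (intro exI[of _ t]) auto
  next
    case equal then show ?thesis using \<delta> by (intro exI[of _ s]) auto
  next
    case greater
    obtain t where t: "t \<in> ?A" "t < min s (Q + \<delta>)"
      using cInf_lessD[of ?A "min s (Q + \<delta>)"] quantile_set(1) greater \<delta> by (auto simp: newsvendor_quantile_def)
    have "Q \<le> t" unfolding newsvendor_quantile_def using t quantile_set(2) by (intro cInf_lower) auto
    have "0 \<le> h - (h + c) * prob {x. t < x}" using t h_pos c_pos by (simp add: field_simps)
    then have "0 \<le> (s - t) * (h - (h + c) * prob {x. t < x})" using t by auto
    then show ?thesis using newsvendor_subgradient[of t s] t \<open>Q \<le> t\<close> by (intro exI[of _ t]) auto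
  qed
  then obtain t where t: "\<bar>Q - t\<bar> \<le> \<delta>" "newsvendor t \<le> newsvendor s" by blast
  have "g \<le> newsvendor t + (h + c) * \<bar>Q - t\<bar>" unfolding g_eq by (rule newsvendor_lipschitz)
  also have "(h + c) * \<bar>Q - t\<bar> \<le> (h + c) * \<delta>" using t h_pos c_pos by (intro mult_left_mono) auto
  finally show "g \<le> newsvendor s + e" using t h_pos c_pos by (simp add: \<delta>_def)
qed

lemma newsvendor_0: "newsvendor 0 = c * \<mu>"
proof -
  have "(\<integral>x. max (0 - x) 0 \<partial>D) = (\<integral>x. 0 \<partial>D)" "(\<integral>x. max (x - 0) 0 \<partial>D) = (\<integral>x. x \<partial>D)"
    using nonneg_D by (intro integral_cong_AE; auto elim!: eventually_mono)+
  then show ?thesis by (simp add: newsvendor_def mean_def)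
qed

lemma g_le: "g \<le> c * \<mu>"
  using g_le_newsvendor[of 0] newsvendor_0 by simp

text \<open>Zero cost would force the demand to equal \<open>Q\<close> almost surely.\<close>

lemma g_pos: "0 < g"
proof -
  have nn: "0 \<le> (\<integral>x. max (Q - x) 0 \<partial>D)" "0 \<le> (\<integral>x. max (x - Q) 0 \<partial>D)"
    by (intro Bochner_Integration.integral_nonneg; simp)+
  then have "0 \<le> g" unfolding g_eq newsvendor_def using h_pos c_pos by simp
  moreover have "g \<noteq> 0"
  proof
    assume "g = 0"
    then have "(\<integral>x. max (Q - x) 0 \<partial>D) = 0" "(\<integral>x. max (x - Q) 0 \<partial>D) = 0"
      unfolding g_eq newsvendor_def using nn h_pos c_pos
      by (auto simp: add_nonneg_eq_0_iff)
    then have "AE x in D. max (Q - x) 0 = 0" "AE x in D. max (x - Q) 0 = 0"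
      by (simp_all add: integral_nonneg_eq_0_iff_AE)
    then have "AE x in D. x = Q" by eventually_elim auto
    then show False using nondeterministic by blast
  qed
  ultimately show ?thesis by simp
qed

text \<open>Turns a sublevel set of a possibly infinite cost into countably many inequalities
  between continuous real functions. This stands in for lower semicontinuity.\<close>

lemma cost_le_iff: "constant_order_cost D h c v \<le> ereal a \<longleftrightarrow> (\<forall>K. h * mean_max K v - c * v \<le> a)"
proof -
  have iff: "h * m - c * v \<le> a \<longleftrightarrow> m \<le> (a + c * v) / h" for m
    using h_pos by (simp add: field_simps)
  show ?thesis
  proof (cases "I_inf_mean D v = \<infinity>")
    case True
    have "\<not> (\<forall>K. mean_max K v \<le> (a + c * v) / h)"
    proof
      assume "\<forall>K. mean_max K v \<le> (a + c * v) / h"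
      then have "\<forall>K. mean_max K v \<le> max 0 ((a + c * v) / h)" by (simp add: le_max_iff_disj)
      then show False using I_inf_mean_le_iff[of "max 0 ((a + c * v) / h)" v] True by (simp add: top_unique)
    qed
    then show ?thesis using True h_pos by (simp add: constant_order_cost_def iff)
  next
    case False
    define F where "F = enn2real (I_inf_mean D v)"
    have F: "I_inf_mean D v = ennreal F" "0 \<le> F" using False by (auto simp: F_def less_top)
    have eq: "constant_order_cost D h c v = ereal (h * F - c * v)"
      unfolding constant_order_cost_def F(1) using F(2) by simp
    have "F \<le> b \<longleftrightarrow> (\<forall>K. mean_max K v \<le> b)" for b
    proof (cases "0 \<le> b")
      case True
      then show ?thesis using I_inf_mean_le_iff[of b v] F by (simp add: ennreal_le_iff)
    next
      case False
      then show ?thesis using F(2) mean_max_nonneg[of 0 v] by (meson order_trans)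
    qed
    then show ?thesis by (simp add: eq iff)
  qed
qed

section \<open>Existence of the best constant order\<close>

abbreviation "z \<equiv> best_constant_order D h c"

text \<open>Minimizers exist by coercivity and compactness. They form a closed set bounded below,
  which therefore contains its infimum.\<close>

lemma best_constant_order_minimal:
  "0 \<le> z \<and> (\<forall>w\<ge>0. constant_order_cost D h c z \<le> constant_order_cost D h c w)"
proof -
  let ?G = "constant_order_cost D h c"
  let ?I = "INF w\<in>{0..}. ?G w"
  \<comment> \<open>After \<open>n\<close> steps the drift bound has slope h n \<ge> 2c, so the cost
    at \<open>v\<close> is at least c v - 2 c \<mu>. This bounds the cost below and confines
    near-minimizers to an interval.\<close>
  define n where "n = nat \<lceil>2 * c / h\<rceil>"
  have "2 * c / h \<le> real n" unfolding n_def by (rule real_nat_ceiling_ge)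
  then have n: "2 * c \<le> h * real n" using h_pos by (simp add: field_simps)
  have growth: "2 * c * (v - \<mu>) \<le> h * mean_max n v" for v
  proof (cases "\<mu> \<le> v")
    case True
    then have "2 * c * (v - \<mu>) \<le> h * real n * (v - \<mu>)" using n by (intro mult_right_mono) auto
    also have "\<dots> \<le> h * mean_max n v" using mean_max_drift[of n v] h_pos by (simp add: mult.assoc)
    finally show ?thesis .
  next
    case False
    then have "2 * c * (v - \<mu>) \<le> 0" using c_pos by (simp add: mult_nonneg_nonpos)
    also have "0 \<le> h * mean_max n v" using h_pos mean_max_nonneg by simp
    finally show ?thesis .
  qed
  have G0: "?G 0 \<le> ereal 0" unfolding cost_le_iff by (simp add: mean_max_nonpos)
  have lower: "ereal (- (2 * c * \<mu>)) \<le> ?G v" if "0 \<le> v" for v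
  proof (rule ccontr)
    assume "\<not> ereal (- (2 * c * \<mu>)) \<le> ?G v"
    then have "?G v < ereal (- (2 * c * \<mu>))" by simp
    from ereal_dense2[OF this] obtain a where a': "?G v < ereal a" "ereal a < ereal (- (2 * c * \<mu>))"
      by blast
    then have a: "?G v \<le> ereal a" "a < - (2 * c * \<mu>)" by simp_all
    then have "h * mean_max n v - c * v \<le> a" by (simp add: cost_le_iff)
    moreover have "0 \<le> c * v" using that c_pos by simp
    ultimately show False using growth[of v] a(2) by (simp add: algebra_simps)
  qed
  have "ereal (- (2 * c * \<mu>)) \<le> ?I" by (intro INF_greatest lower) simp
  moreover have "?I \<le> ereal 0"
  proof -
    have "?I \<le> ?G 0" by (rule INF_lower) simp
    also note G0
    finally show ?thesis .
  qed
  ultimately obtain I where I: "?I = ereal I" "I \<le> 0" by (cases ?I) auto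
  \<comment> \<open>The orders within 1/(j + 1) of the infimum: nested non-empty compact sets, whose
    common points are the minimizers.\<close>
  define C where "C j = {0..} \<inter> (\<Inter>K. {v. h * mean_max K v - c * v \<le> I + 1 / real (Suc j)})" for j
  have C_iff: "v \<in> C j \<longleftrightarrow> 0 \<le> v \<and> ?G v \<le> ereal (I + 1 / real (Suc j))" for v j
    by (simp add: C_def cost_le_iff)
  have "\<Inter> (range C) \<noteq> {}"
  proof (rule compact_nest)
    fix j
    have "closed (C j)"
      unfolding C_def
      by (intro closed_Int closed_INT ballI closed_Collect_le continuous_intros continuous_mean_max closed_atLeast)
    moreover have "C j \<subseteq> {0..2 * \<mu> + 1 / c}"
    proof
      fix v assume v: "v \<in> C j"
      then have "h * mean_max n v - c * v \<le> I + 1 / real (Suc j)" by (simp add: C_def)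
      also have "\<dots> \<le> 1"
      proof -
        have "1 / real (Suc j) \<le> 1" by simp
        then show ?thesis using I(2) by linarith
      qed
      finally have "c * (v - 2 * \<mu>) \<le> 1" using growth[of v] by (simp add: algebra_simps)
      then have "v - 2 * \<mu> \<le> 1 / c" using c_pos by (simp add: field_simps)
      then show "v \<in> {0..2 * \<mu> + 1 / c}" using v by (simp add: C_def)
    qed
    ultimately show "compact (C j)"
      by (meson bounded_closed_interval bounded_subset compact_eq_bounded_closed)
    have "?I < ereal (I + 1 / real (Suc j))" using I by simp
    then obtain w where "0 \<le> w" "?G w < ereal (I + 1 / real (Suc j))" by (auto simp: INF_less_iff)
    then show "C j \<noteq> {}" using C_iff by (auto intro!: less_imp_le)
  next
    fix i j :: nat assume "i \<le> j"
    then have "I + 1 / real (Suc j) \<le> I + 1 / real (Suc i)" by (simp add: frac_le)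
    then show "C j \<subseteq> C i" unfolding C_def using order_trans by blast
  qed
  then obtain v where v: "\<And>j. v \<in> C j" by auto
  have vI: "0 \<le> v" "?G v \<le> ereal I"
  proof -
    show "0 \<le> v" using v by (simp add: C_iff)
    have "h * mean_max K v - c * v \<le> I" for K
    proof (rule field_le_epsilon)
      fix e :: real assume "0 < e"
      then obtain j where "1 / real (Suc j) < e" using nat_approx_posE by blast
      then show "h * mean_max K v - c * v \<le> I + e" using v[of j] by (auto simp: C_def intro: order_trans)
    qed
    then show "?G v \<le> ereal I" by (simp add: cost_le_iff)
  qed
  let ?A = "{v. 0 \<le> v \<and> (\<forall>w\<ge>0. ?G v \<le> ?G w)}"
  have A_eq: "?A = {0..} \<inter> (\<Inter>K. {v. h * mean_max K v - c * v \<le> I})"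
  proof -
    have "(\<forall>w\<ge>0. ?G u \<le> ?G w) \<longleftrightarrow> ?G u \<le> ?I" for u by (auto simp: le_INF_iff)
    then show ?thesis unfolding I by (auto simp: cost_le_iff)
  qed
  have "v \<in> ?A" using vI unfolding A_eq by (simp add: cost_le_iff)
  moreover have "closed ?A" unfolding A_eq
    by (intro closed_Int closed_INT ballI closed_Collect_le continuous_intros continuous_mean_max closed_atLeast)
  moreover have "bdd_below ?A" by (auto simp: bdd_below_def)
  ultimately have "Inf ?A \<in> ?A" by (intro closed_contains_Inf) auto
  then show ?thesis by (simp add: best_constant_order_def)
qed

section \<open>Stationary cost of the best constant order and the truncation gap\<close>

definition F_best :: real where "F_best = enn2real (I_inf_mean D z)"

definition A_best :: real where "A_best = h * F_best + c * (\<mu> - z)"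

lemma z_nonneg: "0 \<le> z"
  using best_constant_order_minimal by simp

lemma I_inf_mean_best: "I_inf_mean D z = ennreal F_best" and F_best_nonneg: "0 \<le> F_best"
proof -
  have "constant_order_cost D h c z \<le> constant_order_cost D h c 0"
    using best_constant_order_minimal by simp
  also have "\<dots> \<le> ereal 0" unfolding cost_le_iff by (simp add: mean_max_nonpos)
  finally have "constant_order_cost D h c z \<noteq> \<infinity>" by auto
  then have "I_inf_mean D z \<noteq> \<infinity>" using h_pos by (auto simp: constant_order_cost_def)
  then show "I_inf_mean D z = ennreal F_best" by (auto simp: F_best_def less_top)
qed (simp add: F_best_def)

text \<open>Bounding all truncated means by a real \<open>F\<close> avoids mentioning a possibly
  infinite mean.\<close>

lemma A_best_le:
  assumes "0 \<le> v" "\<And>K. mean_max K v \<le> F"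
  shows "A_best \<le> h * F + c * (\<mu> - v)"
proof -
  have eq: "constant_order_cost D h c z = ereal (h * F_best - c * z)"
    unfolding constant_order_cost_def I_inf_mean_best using F_best_nonneg by simp
  have "constant_order_cost D h c z \<le> constant_order_cost D h c v"
    using best_constant_order_minimal assms by simp
  also have "\<dots> \<le> ereal (h * F - c * v)"
    unfolding cost_le_iff using assms(2) h_pos by simp
  finally show ?thesis unfolding eq by (simp add: A_best_def algebra_simps)
qed

lemma A_best_le_trivial: "A_best \<le> c * \<mu>"
  using A_best_le[of 0 0] by (simp add: mean_max_nonpos)

text \<open>Reduces the lead-time condition to one polynomial inequality, through Q \<ge> 0, 2^(3/2)
  \<ge> 2, \<mu>^2 + V \<ge> V and m \<ge> (26 P)^2 = 676 P^2.\<close>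

lemma lead_time_lower_bound:
  assumes \<epsilon>: "0 < \<epsilon>" "\<epsilon> < 1" and L: "lead_time_bound D h c \<epsilon> \<le> real L"
  defines "P \<equiv> 3 * zeta D + c / (h * \<sigma>) * \<mu> + 1" and "V \<equiv> (\<integral>x. x^2 \<partial>D)"
  shows "2^15 * h * \<mu> * V^3 * (676 * P^2)^3 \<le> real L * (g * \<epsilon> * \<sigma>^6)"
proof -
  define m where "m = real_of_int (m_const D h c)"
  have V: "0 < V" using second_moment_pos by (simp add: V_def)
  have m: "676 * P^2 \<le> m"
  proof -
    have "(26 * P)^2 \<le> m" unfolding m_def m_const_def P_def by (rule le_of_int_ceiling)
    then show ?thesis by (simp add: power_mult_distrib)
  qed
  have Q0: "0 \<le> Q" by (rule quantile_set(3))
  have "2 \<le> (2::real) powr (3/2)" using powr_mono[of 1 "3/2" "2::real"] by simp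
  then have Qm: "2 * \<mu> \<le> Q + 2 powr (3/2) * \<mu>"
    using Q0 mult_right_mono[of 2 "2 powr (3/2)" \<mu>] mean_pos by linarith
  have "2^14 * h * (2 * \<mu>) * V^3 / \<sigma>^6 * (676 * P^2)^3 / g / \<epsilon>
      \<le> 2^14 * h * (Q + 2 powr (3/2) * \<mu>) * (\<mu>^2 + V)^3 / \<sigma>^6 * m^3 / g / \<epsilon>"
    using Qm m V \<epsilon> g_pos h_pos mean_pos sigma_pos Q0
    by (intro divide_right_mono mult_mono power_mono) (auto intro!: mult_nonneg_nonneg add_nonneg_nonneg)
  also have "\<dots> \<le> lead_time_bound D h c \<epsilon>"
    unfolding lead_time_bound_def Let_def m_def V_def by (rule max.cobounded1)
  also have "\<dots> \<le> real L" by (rule L)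
  finally show ?thesis
    using g_pos \<epsilon> sigma_pos by (simp add: divide_le_eq mult_ac)
qed

text \<open>
  Below drift \<open>\<mu> - \<eta>\<close> the tail bound applies. Above it, \<open>n \<le> L\<close> steps of the walk already cost as much in holding
  as losing all demand does, and by superlinearity in \<open>r\<close> this persists for all larger \<open>r\<close>.
\<close>

lemma mean_max_gap:
  assumes \<epsilon>: "0 < \<epsilon>" "\<epsilon> < 1" and L: "lead_time_bound D h c \<epsilon> \<le> real L" and gA: "g \<le> A_best"
  shows "A_best - \<epsilon> * A_best / 6 \<le> h * mean_max L r + c * (\<mu> - r)"
proof -
  define V where "V = (\<integral>x. x^2 \<partial>D)"
  define P where "P = 3 * zeta D + c / (h * \<sigma>) * \<mu> + 1"
  \<comment> \<open>The summands serve two demands on sqrt n \<ge> w: it must exceed zeta, for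
    \<open>mean_max_lower\<close>, and \<sigma> sqrt n/12 must exceed c \<mu>/h.\<close>
  define w where "w = zeta D + 12 * (c / (h * \<sigma>) * \<mu>)"
  define n where "n = nat \<lceil>w^2\<rceil>"
  \<comment> \<open>Chosen so that the drift loss n \<eta> = \<sigma> sqrt n/12 consumes half of the
    gain \<sigma> sqrt n/6.\<close>
  define \<eta> where "\<eta> = \<sigma> / (12 * sqrt (real n))"
  have zeta: "0 < zeta D"
    using zeta_lower sigma_pos mean_pos by (smt (verit) zero_less_mult_iff)
  have cm: "0 < c / (h * \<sigma>) * \<mu>" using c_pos h_pos sigma_pos mean_pos by simp
  have w: "0 < w" "w + 1 \<le> 12 * P" using zeta cm by (simp_all add: w_def P_def)
  have P: "1 \<le> P" using zeta cm by (simp add: P_def)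
  have V: "\<sigma>^2 \<le> V" "0 < V" using second_moment second_moment_pos by (simp_all add: V_def)
  have Lb: "2^15 * h * \<mu> * V^3 * (676 * P^2)^3 \<le> real L * (g * \<epsilon> * \<sigma>^6)"
    unfolding V_def P_def by (rule lead_time_lower_bound[OF \<epsilon> L])
  have n_ge: "w^2 \<le> real n" unfolding n_def by (rule real_nat_ceiling_ge)
  then have n_pos: "0 < real n" using w by (smt (verit) zero_less_power)
  have sqrt_n: "w \<le> sqrt (real n)" using n_ge by (simp add: real_le_rsqrt)
  have n_le: "real n \<le> (12 * P)^2"
  proof -
    have "real n \<le> w^2 + 1" unfolding n_def by (simp add: of_nat_ceiling)
    also have "\<dots> \<le> (w + 1)^2" using w by (simp add: power2_eq_square algebra_simps)
    also have "\<dots> \<le> (12 * P)^2" using w by (intro power_mono) auto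
    finally show ?thesis .
  qed
  have sqrt_n': "sqrt (real n) \<le> 12 * P" using n_le P by (intro real_le_lsqrt) auto
  have \<eta>: "0 < \<eta>" "\<sigma> \<le> 144 * P * \<eta>"
  proof -
    show "0 < \<eta>" using sigma_pos n_pos by (simp add: \<eta>_def)
    have "\<sigma> = 12 * sqrt (real n) * \<eta>" using n_pos by (simp add: \<eta>_def)
    also have "\<dots> \<le> 12 * (12 * P) * \<eta>" using sqrt_n' \<open>0 < \<eta>\<close> by (intro mult_right_mono mult_left_mono) auto
    finally show "\<sigma> \<le> 144 * P * \<eta>" by simp
  qed
  have P\<mu>: "3/2 * \<sigma> \<le> P * \<mu>"
  proof -
    have "3 * zeta D * \<mu> \<le> P * \<mu>" using cm mean_pos by (intro mult_right_mono) (auto simp: P_def)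
    then show ?thesis using zeta_lower by (simp add: algebra_simps)
  qed
  have mm_n: "c * \<mu> \<le> h * mean_max n (\<mu> - \<eta>)"
  proof -
    have "zeta D \<le> sqrt (real n)" using sqrt_n cm by (simp add: w_def)
    then have "\<sigma> * sqrt (real n) / 6 - real n * \<eta> \<le> mean_max n (\<mu> - \<eta>)"
      using \<eta> by (intro mean_max_lower) auto
    moreover have "real n * \<eta> = \<sigma> * sqrt (real n) / 12"
      using n_pos real_sqrt_mult_self[of "real n"] by (simp add: \<eta>_def field_simps)
    ultimately have "\<sigma> * sqrt (real n) / 12 \<le> mean_max n (\<mu> - \<eta>)" by simp
    moreover have "c / h * \<mu> \<le> \<sigma> * sqrt (real n) / 12"
    proof -
      have "\<sigma> * (12 * (c / (h * \<sigma>) * \<mu>)) \<le> \<sigma> * sqrt (real n)"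
        using sqrt_n zeta sigma_pos by (intro mult_left_mono) (auto simp: w_def)
      then show ?thesis using sigma_pos h_pos by (simp add: field_simps)
    qed
    ultimately have "c / h * \<mu> \<le> mean_max n (\<mu> - \<eta>)" by linarith
    then show ?thesis using h_pos by (simp add: field_simps)
  qed
  \<comment> \<open>With g \<epsilon> \<le> c \<mu>, \<sigma>^6 \<le> V^3 and c/h \<le> P^2, the
    lead-time inequality leaves L of order P^4, whereas n \<le> 144 P^2.\<close>
  have n_L: "n \<le> L"
  proof -
    have ch: "c / h \<le> P^2"
    proof -
      have "c / h * \<sigma> = (c / (h * \<sigma>) * \<mu>) * (\<sigma> * \<sigma> / \<mu>)"
        using sigma_pos mean_pos h_pos by (simp add: field_simps)
      also have "\<dots> \<le> P * (P * \<sigma>)"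
      proof (intro mult_mono)
        have "\<sigma> / \<mu> \<le> P" using P\<mu> sigma_pos mean_pos by (simp add: field_simps)
        then show "\<sigma> * \<sigma> / \<mu> \<le> P * \<sigma>" using sigma_pos mult_right_mono[of "\<sigma> / \<mu>" P \<sigma>] by simp
      qed (use zeta cm sigma_pos mean_pos P in \<open>auto simp: P_def\<close>)
      finally have "c / h * \<sigma> \<le> P^2 * \<sigma>" by (simp only: power2_eq_square mult.assoc)
      then show ?thesis using sigma_pos by (subst (asm) mult_le_cancel_right_pos) auto
    qed
    have "g * \<epsilon> \<le> c * \<mu> * 1" using g_le g_pos \<epsilon> by (intro mult_mono) auto
    then have "real L * (g * \<epsilon> * \<sigma>^6) \<le> real L * (c * \<mu> * V^3)"
    proof (intro mult_left_mono)
      have "\<sigma>^6 \<le> V^3" using power_mono[OF V(1), of 3] by simp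
      then show "g * \<epsilon> * \<sigma>^6 \<le> c * \<mu> * V^3"
        using \<open>g * \<epsilon> \<le> c * \<mu> * 1\<close> g_pos \<epsilon> c_pos mean_pos
          mult_mono[of "g * \<epsilon>" "c * \<mu>" "\<sigma>^6" "V^3"] by simp
    qed simp
    also have "\<dots> \<le> real L * (h * P^2 * \<mu> * V^3)"
      using ch V h_pos mean_pos by (intro mult_left_mono mult_right_mono) (auto simp: field_simps)
    finally have "(h * \<mu> * V^3 * P^2) * (2^15 * 676^3 * P^4) \<le> (h * \<mu> * V^3 * P^2) * real L"
      using Lb by (simp add: eval_nat_numeral mult_ac)
    then have "2^15 * 676^3 * P^4 \<le> real L"
      using h_pos mean_pos V P by (subst (asm) mult_le_cancel_left_pos) auto
    moreover have "P^2 \<le> P^4" using P by (intro power_increasing) auto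
    then have "(12 * P)^2 \<le> 2^15 * 676^3 * P^4"
    proof -
      assume "P^2 \<le> P^4"
      moreover have "(12 * P)^2 = 144 * P^2" by (simp add: power_mult_distrib)
      moreover have "144 * P^4 \<le> 2^15 * 676^3 * P^4" by (intro mult_right_mono) simp_all
      ultimately show ?thesis by linarith
    qed
    ultimately show ?thesis using n_le by linarith
  qed
  have L_pos: "0 < L" using n_L n_pos by simp
  have A: "0 < A_best" using gA g_pos by simp
  \<comment> \<open>The claim amounts to 24 h V^3 \<le> L A_best \<epsilon> \<eta>^5. Inserting
    \<eta> \<ge> \<sigma>/(144 P) produces P^5 and \<sigma>^5; one further factor \<sigma> is
    exchanged for P \<mu>, which gives the powers P^6 and \<sigma>^6 of the lead-time
    inequality.\<close>
  have tail: "h * (4 * V^3 / (real L * \<eta>^5)) \<le> \<epsilon> * A_best / 6"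
  proof -
    have "\<sigma>^5 \<le> (144 * P * \<eta>)^5" using \<eta> sigma_pos by (intro power_mono) auto
    have "24 * 144^5 * (\<sigma> * (h * V^3 * P^5)) \<le> 2^15 * 676^3 * (P * \<mu> * (h * V^3 * P^5))"
    proof -
      have "24 * 144^5 * \<sigma> \<le> 2^15 * 676^3 * (P * \<mu>)" using P\<mu> sigma_pos by simp
      then have "24 * 144^5 * \<sigma> * (h * V^3 * P^5) \<le> 2^15 * 676^3 * (P * \<mu>) * (h * V^3 * P^5)"
        using h_pos V P by (intro mult_right_mono) auto
      then show ?thesis by (simp add: mult_ac)
    qed
    also have "\<dots> = 2^15 * h * \<mu> * V^3 * (676 * P^2)^3"
      by (simp add: eval_nat_numeral mult_ac)
    also have "\<dots> \<le> real L * (g * \<epsilon> * \<sigma>^6)" by (rule Lb)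
    also have "\<dots> = \<sigma> * (real L * (g * \<epsilon>) * \<sigma>^5)" by (simp add: eval_nat_numeral mult_ac)
    finally have "24 * 144^5 * (h * V^3 * P^5) \<le> real L * (g * \<epsilon>) * \<sigma>^5"
      using sigma_pos by (simp add: mult.left_commute[of _ \<sigma>])
    also have "\<dots> \<le> real L * (g * \<epsilon>) * (144 * P * \<eta>)^5"
      using \<open>\<sigma>^5 \<le> _\<close> g_pos \<epsilon> by (intro mult_left_mono) auto
    also have "\<dots> = 144^5 * P^5 * (real L * (g * \<epsilon>) * \<eta>^5)" by (simp add: power_mult_distrib)
    finally have "P^5 * (24 * h * V^3) \<le> P^5 * (real L * (g * \<epsilon>) * \<eta>^5)" by (simp add: mult_ac)
    then have "24 * h * V^3 \<le> real L * (g * \<epsilon>) * \<eta>^5"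
      using P by (subst (asm) mult_le_cancel_left_pos) auto
    also have "\<dots> \<le> real L * (A_best * \<epsilon>) * \<eta>^5"
      using gA \<epsilon> \<eta> by (intro mult_right_mono mult_left_mono) auto
    finally show ?thesis using L_pos \<eta> by (simp add: field_simps)
  qed
  have nn: "0 \<le> \<epsilon> * A_best / 6" using A \<epsilon> by simp
  consider "r \<le> 0" | "0 < r" "r \<le> \<mu> - \<eta>" | "0 < r" "\<mu> - \<eta> < r" by linarith
  then show ?thesis
  proof cases
    case 1
    have "c * r \<le> 0" using 1 c_pos by (simp add: mult_nonneg_nonpos)
    then have "A_best \<le> h * mean_max L r + c * (\<mu> - r)"
      using A_best_le_trivial mean_max_nonneg[of L r] h_pos by (simp add: right_diff_distrib add_increasing)
    then show ?thesis using nn by simp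
  next
    case 2
    have "4 * V^3 / (real L * (\<mu> - r)^5) \<le> 4 * V^3 / (real L * \<eta>^5)"
      using 2 \<eta> V L_pos by (intro divide_left_mono mult_left_mono power_mono) auto
    then have "mean_max K r \<le> mean_max L r + 4 * V^3 / (real L * \<eta>^5)" for K
      using mean_max_tail[of r L K] 2 \<eta> L_pos unfolding V_def by simp
    then have "A_best \<le> h * (mean_max L r + 4 * V^3 / (real L * \<eta>^5)) + c * (\<mu> - r)"
      using 2 by (intro A_best_le) auto
    then show ?thesis using tail by (simp add: distrib_left)
  next
    case 3
    have mmL: "c * \<mu> \<le> h * mean_max L (\<mu> - \<eta>)"
      using mm_n mean_max_mono[OF n_L, of "\<mu> - \<eta>"] h_pos by (meson less_imp_le mult_left_mono order_trans)
    \<comment> \<open>Superlinearity needs a positive base point; a non-positive one would make the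
      mean maximum 0, against \<open>mmL\<close>.\<close>
    have r0: "0 < \<mu> - \<eta>"
    proof (rule ccontr)
      assume "\<not> 0 < \<mu> - \<eta>"
      then have "mean_max L (\<mu> - \<eta>) = 0" by (intro mean_max_nonpos) simp
      then show False using mmL c_pos mean_pos by (simp add: mult_le_0_iff)
    qed
    have "r * (c * \<mu>) \<le> r * (h * mean_max L (\<mu> - \<eta>))"
      using mmL 3 by (intro mult_left_mono) auto
    also have "\<dots> \<le> (\<mu> - \<eta>) * (h * mean_max L r)"
      using mean_max_superlinear[OF r0, of r L] 3 h_pos
      by (simp add: mult.left_commute[of _ h])
    also have "\<dots> \<le> \<mu> * (h * mean_max L r)"
      using \<eta> h_pos mean_max_nonneg[of L r] by (intro mult_right_mono) auto
    finally have "c * r \<le> h * mean_max L r" using mean_pos by (simp add: mult_ac)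
    then have "A_best \<le> h * mean_max L r + c * (\<mu> - r)"
      using A_best_le_trivial by (simp add: right_diff_distrib)
    then show ?thesis using nn by simp
  qed
qed

end

section \<open>Sample paths of a policy\<close>

text \<open>Time reversal: on the reflected path the walk reads the demands of periods n, n - 1, and
  so on. The other coordinates are fixed, so this is a permutation of indices and preserves the
  i.i.d. law.\<close>

definition reflect :: "nat \<Rightarrow> (nat \<Rightarrow> real) \<Rightarrow> nat \<Rightarrow> real" where
  "reflect n d = (\<lambda>j. d (if j \<in> {1..n} then n + 1 - j else j))"

text \<open>Taking the least maximizer gives a measurable choice that depends only on the first
  \<open>K\<close> demands.\<close>

definition first_argmax :: "nat \<Rightarrow> real \<Rightarrow> (nat \<Rightarrow> real) \<Rightarrow> nat" where
  "first_argmax K r d = (LEAST k. k \<le> K \<and> walk r d k = max_walk K r d)"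

lemma first_argmax: "first_argmax K r d \<le> K" "walk r d (first_argmax K r d) = max_walk K r d"
proof -
  have "max_walk K r d \<in> walk r d ` {..K}" unfolding max_walk_def by (intro Max_in) auto
  then have "\<exists>k. k \<le> K \<and> walk r d k = max_walk K r d" by auto
  then have "first_argmax K r d \<le> K \<and> walk r d (first_argmax K r d) = max_walk K r d"
    unfolding first_argmax_def by (rule LeastI_ex)
  then show "first_argmax K r d \<le> K" "walk r d (first_argmax K r d) = max_walk K r d" by auto
qed

lemma first_argmax_cong:
  assumes "\<And>j. 1 \<le> j \<Longrightarrow> j \<le> K \<Longrightarrow> d j = d' j"
  shows "first_argmax K r d = first_argmax K r d'"
proof -
  have *: "walk r d k = walk r d' k" if "k \<le> K" for k
    using that assms by (auto simp: walk_def intro!: sum.cong)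
  then have "max_walk K r d = max_walk K r d'"
    unfolding max_walk_def by (intro arg_cong[where f=Max] image_cong) auto
  then show ?thesis unfolding first_argmax_def using * by metis
qed

context demand_law
begin

lemma measurable_first_argmax [measurable]: "first_argmax K r \<in> paths \<rightarrow>\<^sub>M count_space UNIV"
  unfolding first_argmax_def[abs_def]
proof (rule measurable_Least)
  fix k
  have "Measurable.pred paths (\<lambda>d. walk r d k = max_walk K r d)"
    unfolding pred_def by (intro borel_measurable_eq measurable_walk measurable_max_walk)
  then show "Measurable.pred paths (\<lambda>d. k \<le> K \<and> walk r d k = max_walk K r d)"
    by (cases "k \<le> K") simp_all
qed

lemma measurable_reflect [measurable]: "reflect n \<in> paths \<rightarrow>\<^sub>M paths"
  unfolding reflect_def[abs_def] demand_paths_def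
  by (intro measurable_PiM_single' measurable_component_singleton) (auto simp: space_PiM)

lemma distr_reflect: "distr paths paths (reflect n) = paths"
proof -
  let ?f = "\<lambda>j. if j \<in> {1..n} then n + 1 - j else j"
  have "inj ?f" by (auto simp: inj_on_def split: if_splits)
  then have "distr (Pi\<^sub>M UNIV (\<lambda>_. D)) (Pi\<^sub>M UNIV (\<lambda>_. D)) (\<lambda>\<omega>. \<lambda>j\<in>UNIV. \<omega> (?f j)) = Pi\<^sub>M UNIV (\<lambda>_. D)"
    using distr_PiM_reindex[of UNIV "\<lambda>_. D" ?f UNIV] prob_D by simp
  then show ?thesis by (simp add: demand_paths_def reflect_def[abs_def] restrict_def)
qed

lemma integral_reflect:
  fixes f :: "(nat \<Rightarrow> real) \<Rightarrow> real"
  assumes "f \<in> borel_measurable paths"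
  shows "paths.expectation (\<lambda>d. f (reflect n d)) = paths.expectation f"
    and "integrable paths (\<lambda>d. f (reflect n d)) \<longleftrightarrow> integrable paths f"
  using integral_distr[OF measurable_reflect assms, of n] integrable_distr_eq[OF measurable_reflect assms, of n]
  by (simp_all add: distr_reflect)

end



declare state.simps(2) [simp del]

locale policy_run = inventory +
  fixes L T :: nat and \<pi> :: policy
  assumes L_pos: "0 < L"
    and prob_space_seed: "prob_space (seed_law \<pi> t)"
    and sets_seed [measurable_cong]: "sets (seed_law \<pi> t) = sets borel"
    and measurable_order: "(\<lambda>(s, u). order_fun \<pi> t s u) \<in> borel_measurable (state_space L \<Otimes>\<^sub>M borel)"
begin

abbreviation "\<Omega> \<equiv> sample_space D \<pi>"
abbreviation "seeds \<equiv> Pi\<^sub>M UNIV (seed_law \<pi>)"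

lemma prob_space_seeds: "prob_space seeds"
  by (intro prob_space_PiM prob_space_seed)

sublocale seeds: prob_space seeds by (rule prob_space_seeds)
sublocale P: pair_prob_space paths seeds ..

lemma sample_space_eq: "\<Omega> = paths \<Otimes>\<^sub>M seeds"
  by (simp add: sample_space_def)

sublocale \<Omega>: prob_space \<Omega>
  unfolding sample_space_eq by (rule P.P.prob_space_axioms)

lemma space_seed: "space (seed_law \<pi> t) = UNIV"
  using sets_eq_imp_space_eq[OF sets_seed] by simp

lemma space_Omega [simp]: "space \<Omega> = UNIV"
  by (auto simp: sample_space_eq space_pair_measure space_PiM space_seed)

lemma measurable_fst_Omega [measurable]: "fst \<in> \<Omega> \<rightarrow>\<^sub>M paths"
  by (simp add: sample_space_eq)

lemma measurable_snd_Omega [measurable]: "snd \<in> \<Omega> \<rightarrow>\<^sub>M seeds"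
  by (simp add: sample_space_eq)

lemma measurable_seed [measurable]: "(\<lambda>\<omega>. snd \<omega> t) \<in> borel_measurable \<Omega>"
proof -
  have "(\<lambda>u. u t) \<in> seeds \<rightarrow>\<^sub>M seed_law \<pi> t" by (rule measurable_component_singleton) simp
  then have "(\<lambda>\<omega>. snd \<omega> t) \<in> \<Omega> \<rightarrow>\<^sub>M seed_law \<pi> t"
    by (rule measurable_compose[OF measurable_snd_Omega])
  then show ?thesis by (subst (asm) measurable_cong_sets[OF refl sets_seed])
qed

lemma measurable_demand [measurable]: "(\<lambda>\<omega>. fst \<omega> t) \<in> borel_measurable \<Omega>"
  using measurable_compose[OF measurable_fst_Omega measurable_paths_component[of t]]
  by (subst (asm) measurable_cong_sets[OF refl sets_D])

lemma measurable_next_state: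
  assumes [measurable]: "s \<in> N \<rightarrow>\<^sub>M state_space L" "q \<in> borel_measurable N" "d \<in> borel_measurable N"
  shows "(\<lambda>\<omega>. next_state L (s \<omega>) (q \<omega>) (d \<omega>)) \<in> N \<rightarrow>\<^sub>M state_space L"
proof -
  have f [measurable]: "(\<lambda>\<omega>. fst (s \<omega>)) \<in> borel_measurable N"
    using assms(1) unfolding state_space_def by (rule measurable_compose) simp
  have sn: "(\<lambda>\<omega>. snd (s \<omega>)) \<in> N \<rightarrow>\<^sub>M Pi\<^sub>M {1..L} (\<lambda>_. borel)"
    using assms(1) unfolding state_space_def by (rule measurable_compose) simp
  have comp: "(\<lambda>\<omega>. snd (s \<omega>) i) \<in> borel_measurable N" if "i \<in> {1..L}" for i
    by (rule measurable_compose[OF sn measurable_component_singleton]) fact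
  have [measurable]: "(\<lambda>\<omega>. snd (s \<omega>) 1) \<in> borel_measurable N" using comp L_pos by auto
  show ?thesis
    unfolding state_space_def next_state_def
  proof (rule measurable_Pair)
    show "(\<lambda>\<omega>. \<lambda>i\<in>{1..L}. if i = L then q \<omega> else snd (s \<omega>) (i + 1)) \<in> N \<rightarrow>\<^sub>M Pi\<^sub>M {1..L} (\<lambda>_. borel)"
    proof (rule measurable_restrict)
      fix i assume "i \<in> {1..L}"
      then show "(\<lambda>\<omega>. if i = L then q \<omega> else snd (s \<omega>) (i + 1)) \<in> borel_measurable N"
        by (cases "i = L") (auto intro: comp)
    qed
  qed measurable
qed

lemma measurable_order_fun_state:
  assumes "(\<lambda>\<omega>. state L T \<pi> \<omega> t) \<in> \<Omega> \<rightarrow>\<^sub>M state_space L"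
  shows "(\<lambda>\<omega>. order_fun \<pi> t (state L T \<pi> \<omega> t) (snd \<omega> t)) \<in> borel_measurable \<Omega>"
  using measurable_compose[OF measurable_Pair[OF assms measurable_seed] measurable_order[of t]] by simp

lemma measurable_state: "(\<lambda>\<omega>. state L T \<pi> \<omega> t) \<in> \<Omega> \<rightarrow>\<^sub>M state_space L"
proof (induction t)
  case 0
  show ?case by (auto simp: empty_state_def state_space_def space_pair_measure space_PiM)
next
  case (Suc t)
  have "empty_state L \<in> space (state_space L)"
    by (auto simp: empty_state_def state_space_def space_pair_measure space_PiM)
  then show ?case
    using measurable_order_fun_state[OF Suc] Suc
    by (cases "t = 0"; cases "t \<le> T") (auto simp: Let_def state.simps(2) intro!: measurable_next_state)
qed

definition order_at :: "nat \<Rightarrow> (nat \<Rightarrow> real) \<times> (nat \<Rightarrow> real) \<Rightarrow> real" where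
  "order_at t \<omega> = (if t \<le> T then order_fun \<pi> t (state L T \<pi> \<omega> t) (snd \<omega> t) else 0)"

text \<open>
  Stock is indexed by the order that has just arrived: \<open>stock s\<close> is the on-hand inventory at the start of
  period \<open>s + L + 1\<close>, when the order of period \<open>s\<close> has met the demand of period \<open>s + L\<close>.
\<close>

definition stock :: "nat \<Rightarrow> (nat \<Rightarrow> real) \<times> (nat \<Rightarrow> real) \<Rightarrow> real" where
  "stock s \<omega> = fst (state L T \<pi> \<omega> (s + L + 1))"

definition lost :: "nat \<Rightarrow> (nat \<Rightarrow> real) \<times> (nat \<Rightarrow> real) \<Rightarrow> real" where
  "lost s \<omega> = max (- (stock (s - 1) \<omega> + order_at s \<omega> - fst \<omega> (s + L))) 0"

lemma measurable_order_at [measurable]: "order_at t \<in> borel_measurable \<Omega>"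
  unfolding order_at_def[abs_def] using measurable_order_fun_state[OF measurable_state] by (cases "t \<le> T") auto

lemma measurable_stock [measurable]: "stock s \<in> borel_measurable \<Omega>"
  unfolding stock_def[abs_def]
  by (rule measurable_compose[OF measurable_state[unfolded state_space_def] measurable_fst])

lemma measurable_lost [measurable]: "lost s \<in> borel_measurable \<Omega>"
  unfolding lost_def[abs_def]
  by (intro borel_measurable_max borel_measurable_uminus borel_measurable_diff borel_measurable_add
      measurable_stock measurable_order_at measurable_demand borel_measurable_const)

lemma state_Suc: "0 < t \<Longrightarrow>
  state L T \<pi> \<omega> (Suc t) = next_state L (state L T \<pi> \<omega> t) (order_at t \<omega>) (fst \<omega> t)"
  by (simp add: order_at_def Let_def state.simps(2))

text \<open>At the start of period p, slot i holds the order of period p + i - L - 1; in particular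
  slot 1 in period s + L delivers order s. The strict inequality says that this order has index at
  least 1.\<close>

lemma pipeline:
  "i \<in> {1..L} \<Longrightarrow> snd (state L T \<pi> \<omega> (Suc t)) i
    = (if L + 1 < Suc t + i then order_at (Suc t + i - (L + 1)) \<omega> else 0)"
proof (induction t arbitrary: i)
  case 0 then show ?case by (auto simp: empty_state_def state.simps(2))
next
  case (Suc t)
  show ?case
  proof (cases "i = L")
    case True
    then show ?thesis using Suc.prems by (subst state_Suc) (auto simp: next_state_def)
  next
    case False
    then have "i + 1 \<in> {1..L}" using Suc.prems by auto
    with Suc.IH[of "i + 1"] False Suc.prems show ?thesis
      by (subst state_Suc) (auto simp: next_state_def)
  qed
qed

text \<open>In this indexing the system is a one-dimensional Lindley recursion; the lead time
  survives only in the demand index.\<close>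

lemma stock_Suc: "stock (Suc s) \<omega> = max (stock s \<omega> + order_at (Suc s) \<omega> - fst \<omega> (Suc s + L)) 0"
proof -
  have "snd (state L T \<pi> \<omega> (Suc (s + L))) 1 = order_at (Suc s) \<omega>"
    using pipeline[of 1 \<omega> "s + L"] L_pos by auto
  then show ?thesis
    unfolding stock_def using state_Suc[of "Suc (s + L)" \<omega>] by (simp add: next_state_def add.commute)
qed

lemma stock_0: "\<forall>i. 0 \<le> fst \<omega> i \<Longrightarrow> stock 0 \<omega> = 0"
proof -
  assume d: "\<forall>i. 0 \<le> fst \<omega> i"
  have "t \<le> L \<Longrightarrow> fst (state L T \<pi> \<omega> (Suc t)) = 0" for t
  proof (induction t)
    case 0 then show ?case by (simp add: empty_state_def state.simps(2))
  next
    case (Suc t)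
    have "snd (state L T \<pi> \<omega> (Suc t)) 1 = 0" using pipeline[of 1 \<omega> t] L_pos Suc.prems by auto
    then show ?case using Suc d by (subst state_Suc) (auto simp: next_state_def)
  qed
  from this[of L] show ?thesis by (simp add: stock_def)
qed

lemma stock_nonneg: "0 \<le> stock (Suc s) \<omega>"
  by (simp add: stock_Suc)

text \<open>Flow balance, from a^+ - a^- = a. It makes lost demand linear in stock, orders and
  demand.\<close>

lemma stock_minus_lost: "stock (Suc s) \<omega> - lost (Suc s) \<omega> = stock s \<omega> + order_at (Suc s) \<omega> - fst \<omega> (Suc s + L)"
  unfolding lost_def stock_Suc by simp

lemma lost_nonneg: "0 \<le> lost s \<omega>"
  by (simp add: lost_def)

lemma period_cost_eq:
  assumes "1 \<le> s"
  shows "period_cost h c L T \<pi> \<omega> (s + L) = h * stock s \<omega> + c * lost s \<omega>"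
proof -
  obtain s' where s': "s = Suc s'" using assms by (cases s) auto
  have "snd (state L T \<pi> \<omega> (Suc (s' + L))) 1 = order_at s \<omega>"
    using pipeline[of 1 \<omega> "s' + L"] L_pos s' by auto
  then show ?thesis
    unfolding period_cost_def lost_def stock_def s' by (simp add: case_prod_beta Let_def add.commute)
qed

text \<open>Truncation at 0 can only raise the stock, so unrolling the recursion from any earlier
  period bounds it by the net inflow since then.\<close>

lemma stock_ge_window:
  assumes "m \<le> b" "0 \<le> stock 0 \<omega>"
  shows "(\<Sum>i=Suc m..b. order_at i \<omega> - fst \<omega> (i + L)) \<le> stock b \<omega>"
  using assms(1)
proof (induction b rule: dec_induct)
  case base
  then show ?case using assms(2) stock_nonneg by (cases m) auto
next
  case (step n)
  then show ?case using stock_Suc[of n \<omega>] by simp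
qed

text \<open>Non-anticipation: the state at the start of period \<open>t\<close> has seen only
  demands before \<open>t\<close>, while \<open>comb_seq n\<close> alters those from
  \<open>n\<close> on.\<close>

lemma state_comb_seq:
  "t \<le> n \<Longrightarrow> state L T \<pi> (comb_seq n d d', u) t = state L T \<pi> (d, u) t"
proof (induction t)
  case (Suc t)
  then have "comb_seq n d d' t = d t" by (simp add: comb_seq_def)
  then show ?case using Suc by (simp add: state.simps(2) Let_def)
qed simp

lemma order_comb_seq: "i \<le> n \<Longrightarrow> order_at i (comb_seq n d d', u) = order_at i (d, u)"
  unfolding order_at_def by (simp add: state_comb_seq)

lemma stock_comb_seq: "s + L < n \<Longrightarrow> stock s (comb_seq n d d', u) = stock s (d, u)"
  unfolding stock_def by (simp add: state_comb_seq)

text \<open>Redraws the demands from period \<open>n\<close> on and keeps all seeds. It preserves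
  the law of the sample space and is the map fed to \<open>integral_mult_resample\<close>.\<close>

definition resample :: "nat \<Rightarrow> ((nat \<Rightarrow> real) \<times> (nat \<Rightarrow> real)) \<times> (nat \<Rightarrow> real) \<Rightarrow> (nat \<Rightarrow> real) \<times> (nat \<Rightarrow> real)"
  where "resample n = (\<lambda>(\<omega>, d'). (comb_seq n (fst \<omega>) d', snd \<omega>))"

lemma measurable_comb_seq_comp [measurable (raw)]:
  assumes "f \<in> N \<rightarrow>\<^sub>M paths" "f' \<in> N \<rightarrow>\<^sub>M paths"
  shows "(\<lambda>x. comb_seq n (f x) (f' x)) \<in> N \<rightarrow>\<^sub>M paths"
  using measurable_compose[OF measurable_Pair[OF assms] comb_seq_measurable] by simp

lemma measurable_resample [measurable]: "resample n \<in> \<Omega> \<Otimes>\<^sub>M paths \<rightarrow>\<^sub>M \<Omega>"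
  unfolding resample_def sample_space_eq by measurable

lemma nn_integral_comb_seq:
  assumes [measurable]: "f \<in> borel_measurable paths"
  shows "(\<integral>\<^sup>+d. \<integral>\<^sup>+d'. f (comb_seq n d d') \<partial>paths \<partial>paths) = (\<integral>\<^sup>+d. f d \<partial>paths)"
proof -
  have "(\<integral>\<^sup>+d. f d \<partial>paths) = (\<integral>\<^sup>+p. f (case p of (d, d') \<Rightarrow> comb_seq n d d') \<partial>(paths \<Otimes>\<^sub>M paths))"
    using nn_integral_distr[OF comb_seq_measurable[of n], of f] by (simp add: distr_comb_seq)
  also have "\<dots> = (\<integral>\<^sup>+d. \<integral>\<^sup>+d'. f (comb_seq n d d') \<partial>paths \<partial>paths)"
    by (subst paths.nn_integral_fst[symmetric]) auto
  finally show ?thesis ..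
qed

lemma nn_integral_resample:
  assumes f: "f \<in> borel_measurable \<Omega>"
  shows "(\<integral>\<^sup>+\<omega>. \<integral>\<^sup>+d'. f (comb_seq n (fst \<omega>) d', snd \<omega>) \<partial>paths \<partial>\<Omega>) = (\<integral>\<^sup>+\<omega>. f \<omega> \<partial>\<Omega>)"
proof -
  have f' [measurable]: "f \<in> borel_measurable (paths \<Otimes>\<^sub>M seeds)" using f by (simp add: sample_space_eq)
  have "(\<integral>\<^sup>+\<omega>. \<integral>\<^sup>+d'. f (comb_seq n (fst \<omega>) d', snd \<omega>) \<partial>paths \<partial>\<Omega>)
      = (\<integral>\<^sup>+u. \<integral>\<^sup>+d. \<integral>\<^sup>+d'. f (comb_seq n d d', u) \<partial>paths \<partial>paths \<partial>seeds)"
    unfolding sample_space_eq by (subst P.nn_integral_snd[symmetric]) auto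
  also have "\<dots> = (\<integral>\<^sup>+u. \<integral>\<^sup>+d. f (d, u) \<partial>paths \<partial>seeds)"
    by (intro nn_integral_cong nn_integral_comb_seq[of "\<lambda>d. f (d, _)"]) auto
  also have "\<dots> = (\<integral>\<^sup>+\<omega>. f \<omega> \<partial>\<Omega>)"
    unfolding sample_space_eq by (rule P.nn_integral_snd) measurable
  finally show ?thesis .
qed

lemma distr_resample: "distr (\<Omega> \<Otimes>\<^sub>M paths) \<Omega> (resample n) = \<Omega>"
proof (rule measure_eqI)
  fix A assume "A \<in> sets (distr (\<Omega> \<Otimes>\<^sub>M paths) \<Omega> (resample n))"
  then have [measurable]: "A \<in> sets \<Omega>" by simp
  have "emeasure (distr (\<Omega> \<Otimes>\<^sub>M paths) \<Omega> (resample n)) A = (\<integral>\<^sup>+\<omega>. indicator A \<omega> \<partial>distr (\<Omega> \<Otimes>\<^sub>M paths) \<Omega> (resample n))"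
    by simp
  also have "\<dots> = (\<integral>\<^sup>+p. indicator A (resample n p) \<partial>(\<Omega> \<Otimes>\<^sub>M paths))"
    by (rule nn_integral_distr) auto
  also have "\<dots> = (\<integral>\<^sup>+\<omega>. \<integral>\<^sup>+d'. indicator A (comb_seq n (fst \<omega>) d', snd \<omega>) \<partial>paths \<partial>\<Omega>)"
    by (subst paths.nn_integral_fst[symmetric], measurable, simp add: resample_def)
  also have "\<dots> = (\<integral>\<^sup>+\<omega>. indicator A \<omega> \<partial>\<Omega>)"
    by (rule nn_integral_resample) auto
  also have "\<dots> = emeasure \<Omega> A" by simp
  finally show "emeasure (distr (\<Omega> \<Otimes>\<^sub>M paths) \<Omega> (resample n)) A = emeasure \<Omega> A" .
qed simp

lemma distr_fst_Omega: "distr \<Omega> paths fst = paths"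
  unfolding sample_space_eq by (rule seeds.distr_pair_fst)

lemma integral_fst_Omega:
  fixes f :: "(nat \<Rightarrow> real) \<Rightarrow> real"
  assumes "f \<in> borel_measurable paths"
  shows "\<Omega>.expectation (\<lambda>\<omega>. f (fst \<omega>)) = paths.expectation f"
    and "integrable \<Omega> (\<lambda>\<omega>. f (fst \<omega>)) \<longleftrightarrow> integrable paths f"
  using integral_distr[OF measurable_fst_Omega assms] integrable_distr_eq[OF measurable_fst_Omega assms]
  by (simp_all add: distr_fst_Omega)

lemma AE_demand_nonneg: "AE \<omega> in \<Omega>. \<forall>i. 0 \<le> fst \<omega> i"
  by (rule AE_distrD[OF measurable_fst_Omega]) (unfold distr_fst_Omega, rule AE_paths_nonneg)

lemma AE_stock_0: "AE \<omega> in \<Omega>. stock 0 \<omega> = 0"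
  using AE_demand_nonneg by eventually_elim (rule stock_0)

end

section \<open>Lower bound on the cost of a policy\<close>

context demand_law
begin

text \<open>Indicator weights that split the maximum of the walk by its position, so that each piece
  is linear in the steps.\<close>

definition sel :: "nat \<Rightarrow> real \<Rightarrow> nat \<Rightarrow> (nat \<Rightarrow> real) \<Rightarrow> real" where
  "sel K r k d = of_bool (first_argmax K r d = k)"

lemma measurable_sel [measurable]: "sel K r k \<in> borel_measurable paths"
  unfolding sel_def[abs_def] by (rule measurable_compose[OF measurable_first_argmax]) simp

lemma sum_sel: "(\<Sum>k\<le>K. sel K r k d * X k) = X (first_argmax K r d)"
proof -
  have "(\<Sum>k\<le>K. sel K r k d * X k) = (\<Sum>k\<le>K. if k = first_argmax K r d then X k else 0)"
    by (intro sum.cong) (auto simp: sel_def)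
  then show ?thesis using first_argmax(1)[of K r d] by simp
qed

lemma integrable_mult_sel:
  assumes "integrable paths f"
  shows "integrable paths (\<lambda>d. f d * sel K r k d)"
proof (rule Bochner_Integration.integrable_bound[OF assms])
  show "(\<lambda>d. f d * sel K r k d) \<in> borel_measurable paths" using assms by (intro borel_measurable_times) auto
  show "AE d in paths. norm (f d * sel K r k d) \<le> norm (f d)" by (auto simp: sel_def)
qed

lemma integrable_sel: "integrable paths (sel K r k)"
  using integrable_mult_sel[of "\<lambda>_. 1"] by simp

text \<open>Once the weights are fixed, \<open>r\<close> enters linearly; this is the form in which
  mean orders can take the place of \<open>r\<close>.\<close>

lemma mean_max_sel:
  "mean_max K r = (\<Sum>k\<le>K. \<Sum>j=1..k. r * paths.expectation (sel K r k) - paths.expectation (\<lambda>d. d j * sel K r k d))"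
proof -
  have "max_walk K r d = (\<Sum>k\<le>K. sel K r k d * walk r d k)" for d
    using sum_sel[of K r d "walk r d"] first_argmax(2)[where K=K and r=r and d=d] by simp
  moreover have "sel K r k d * walk r d k = (\<Sum>j=1..k. r * sel K r k d - d j * sel K r k d)" for k d
    by (simp add: walk_def sum_subtractf sum_distrib_left sum_distrib_right right_diff_distrib mult_ac)
  ultimately have eq: "max_walk K r d = (\<Sum>k\<le>K. \<Sum>j=1..k. r * sel K r k d - d j * sel K r k d)" for d
    by simp
  have int: "integrable paths (\<lambda>d. d j * sel K r k d)" for j k
    by (rule integrable_mult_sel) simp
  show ?thesis
    unfolding mean_max_def eq[abs_def] by (simp add: int integrable_sel)
qed

end

context policy_run
begin

abbreviation "mean_order i \<equiv> \<Omega>.expectation (order_at i)"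
abbreviation "mean_stock s \<equiv> \<Omega>.expectation (stock s)"
abbreviation "mean_lost s \<equiv> \<Omega>.expectation (lost s)"

lemma mean_stock_0: "integrable \<Omega> (stock 0)" "mean_stock 0 = 0"
proof -
  have "integrable \<Omega> (stock 0) \<longleftrightarrow> integrable \<Omega> (\<lambda>_. 0 :: real)"
    using AE_stock_0 by (intro integrable_cong_AE) auto
  then show "integrable \<Omega> (stock 0)" by simp
  have "mean_stock 0 = \<Omega>.expectation (\<lambda>_. 0)"
    using AE_stock_0 by (intro integral_cong_AE) auto
  then show "mean_stock 0 = 0" by simp
qed

lemma integrable_demand [simp]: "integrable \<Omega> (\<lambda>\<omega>. fst \<omega> i)"
  using integral_fst_Omega(2)[of "\<lambda>d. d i"] by simp

lemma mean_demand [simp]: "\<Omega>.expectation (\<lambda>\<omega>. fst \<omega> i) = \<mu>"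
  using integral_fst_Omega(1)[of "\<lambda>d. d i"] by simp

text \<open>
  The window of orders is cut at the first maximum of the constant-order walk driven by the last
  \<open>K \<le> L\<close> demands read backwards. These demands are realized only after the orders in the
  window are placed, so the cut is independent of the orders and only their means matter.
\<close>

lemma order_sel:
  assumes q: "integrable \<Omega> (order_at i)" and i: "i \<le> s" and K: "K \<le> L"
  shows "integrable \<Omega> (\<lambda>\<omega>. order_at i \<omega> * sel K r k (reflect (s + L) (fst \<omega>)))"
    and "\<Omega>.expectation (\<lambda>\<omega>. order_at i \<omega> * sel K r k (reflect (s + L) (fst \<omega>)))
      = mean_order i * paths.expectation (sel K r k)"
proof -
  let ?G = "\<lambda>d. sel K r k (reflect (s + L) d)"
  have G [measurable]: "?G \<in> borel_measurable paths"
    by (rule measurable_compose[OF measurable_reflect measurable_sel])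
  have Gi: "integrable paths ?G" "paths.expectation ?G = paths.expectation (sel K r k)"
    using integral_reflect[OF measurable_sel, where n="s + L"] integrable_sel by auto
  have c0: "(\<lambda>d'. comb_seq s (\<lambda>_. 0) d') \<in> paths \<rightarrow>\<^sub>M paths"
    by (rule measurable_comb_seq_comp) auto
  \<comment> \<open>For j \<le> K \<le> L the reflected path reads period s + L + 1 - j > s, so the
    selection sees only redrawn demands.\<close>
  have Gc: "?G (comb_seq s d d') = ?G (comb_seq s (\<lambda>_. 0) d')" for d d'
  proof -
    have "first_argmax K r (reflect (s + L) (comb_seq s d d'))
        = first_argmax K r (reflect (s + L) (comb_seq s (\<lambda>_. 0) d'))"
      using K by (intro first_argmax_cong) (auto simp: reflect_def comb_seq_def)
    then show ?thesis by (simp add: sel_def)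
  qed
  have 1: "order_at i (resample s (\<omega>, d')) = order_at i \<omega>" for \<omega> d'
    using order_comb_seq[OF i, of "fst \<omega>" d' "snd \<omega>"] by (simp add: resample_def)
  have 2: "?G (fst (resample s (\<omega>, d'))) = ?G (comb_seq s (\<lambda>_. 0) d')" for \<omega> d'
    using Gc by (simp add: resample_def)
  have 3: "integrable \<Omega> (\<lambda>\<omega>. ?G (fst \<omega>))" using Gi integral_fst_Omega(2)[OF G] by simp
  have 4: "(\<lambda>d'. ?G (comb_seq s (\<lambda>_. 0) d')) \<in> borel_measurable paths"
    by (rule measurable_compose[OF c0 G])
  note integral_mult_resample[OF \<Omega>.prob_space_axioms prob_space_paths measurable_resample distr_resample 1 2 q 3 4]
  then show "integrable \<Omega> (\<lambda>\<omega>. order_at i \<omega> * ?G (fst \<omega>))"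
    "\<Omega>.expectation (\<lambda>\<omega>. order_at i \<omega> * ?G (fst \<omega>)) = mean_order i * paths.expectation (sel K r k)"
    using integral_fst_Omega(1)[OF G] Gi by auto
qed

text \<open>Order s + 1 - j meets the demand of period s + L + 1 - j, which is coordinate
  \<open>j\<close> of the reflected path. Demand and selection are thus functions of one reflected
  path, whose law is unchanged.\<close>

lemma demand_sel:
  assumes j: "1 \<le> j" "j \<le> s"
  shows "integrable \<Omega> (\<lambda>\<omega>. fst \<omega> (s + 1 - j + L) * sel K r k (reflect (s + L) (fst \<omega>)))"
    and "\<Omega>.expectation (\<lambda>\<omega>. fst \<omega> (s + 1 - j + L) * sel K r k (reflect (s + L) (fst \<omega>)))
      = paths.expectation (\<lambda>d. d j * sel K r k d)"
proof -
  let ?f = "\<lambda>d. d j * sel K r k d"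
  have f: "?f \<in> borel_measurable paths" "integrable paths ?f"
    using integrable_mult_sel[of "\<lambda>d. d j"] by auto
  have pt: "fst \<omega> (s + 1 - j + L) = reflect (s + L) (fst \<omega>) j" for \<omega> :: "(nat \<Rightarrow> real) \<times> (nat \<Rightarrow> real)"
    using j by (simp add: reflect_def)
  have eq: "(\<lambda>\<omega> :: (nat \<Rightarrow> real) \<times> (nat \<Rightarrow> real). fst \<omega> (s + 1 - j + L) * sel K r k (reflect (s + L) (fst \<omega>)))
      = (\<lambda>\<omega>. ?f (reflect (s + L) (fst \<omega>)))" by (intro ext) (simp only: pt)
  have m: "(\<lambda>d. ?f (reflect (s + L) d)) \<in> borel_measurable paths"
    by (rule measurable_compose[OF measurable_reflect f(1)])
  show "integrable \<Omega> (\<lambda>\<omega>. fst \<omega> (s + 1 - j + L) * sel K r k (reflect (s + L) (fst \<omega>)))"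
    unfolding eq integral_fst_Omega(2)[OF m] integral_reflect(2)[OF f(1)] by (rule f(2))
  show "\<Omega>.expectation (\<lambda>\<omega>. fst \<omega> (s + 1 - j + L) * sel K r k (reflect (s + L) (fst \<omega>)))
      = paths.expectation ?f"
    unfolding eq integral_fst_Omega(1)[OF m] integral_reflect(1)[OF f(1)] ..
qed

text \<open>For each sample point the sum picks out one window length, and
  \<open>stock_ge_window\<close> applies to it. Terms whose order index falls outside 1 to
  \<open>b\<close> are dropped, which leaves a window ending at \<open>min s b\<close>.\<close>

lemma stock_ge_selected:
  assumes "0 \<le> stock 0 \<omega>" and s: "1 \<le> s"
  shows "(\<Sum>k\<le>K. \<Sum>j=1..k. if j \<le> s \<and> s + 1 - j \<le> b
      then sel K r k (reflect (s + L) (fst \<omega>)) * (order_at (s + 1 - j) \<omega> - fst \<omega> (s + 1 - j + L)) else 0)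
    \<le> stock (min s b) \<omega>"
proof -
  let ?d = "reflect (s + L) (fst \<omega>)"
  let ?x = "\<lambda>i. order_at i \<omega> - fst \<omega> (i + L)"
  let ?X = "\<lambda>k. \<Sum>j=1..k. if j \<le> s \<and> s + 1 - j \<le> b then ?x (s + 1 - j) else 0"
  have "(\<Sum>k\<le>K. \<Sum>j=1..k. if j \<le> s \<and> s + 1 - j \<le> b then sel K r k ?d * ?x (s + 1 - j) else 0)
      = (\<Sum>k\<le>K. sel K r k ?d * ?X k)"
    unfolding sum_distrib_left by (intro sum.cong refl) simp
  also have "\<dots> = ?X (first_argmax K r ?d)" by (rule sum_sel)
  also have "?X k \<le> stock (min s b) \<omega>" for k
  proof -
    \<comment> \<open>The period just before the window; \<open>s - k\<close> stops at 0 when the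
      window would start too early, and the outer \<open>min\<close> covers windows lying wholly
      after \<open>b\<close>.\<close>
    define m where "m = min (s - k) (min s b)"
    have "?X k = (\<Sum>j\<in>{j\<in>{1..k}. j \<le> s \<and> s + 1 - j \<le> b}. ?x (s + 1 - j))"
      by (rule sum.inter_filter[symmetric]) simp
    also have "\<dots> = (\<Sum>i=Suc m..min s b. ?x i)"
      by (rule sum.reindex_bij_witness[where i="\<lambda>i. s + 1 - i" and j="\<lambda>j. s + 1 - j"])
        (auto simp: m_def)
    also have "\<dots> \<le> stock (min s b) \<omega>"
      by (rule stock_ge_window) (use assms m_def in auto)
    finally show ?thesis .
  qed
  finally show ?thesis .
qed

context
  fixes b :: nat
  assumes int_order: "\<And>i. 1 \<le> i \<Longrightarrow> i \<le> b \<Longrightarrow> integrable \<Omega> (order_at i)"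
    and int_stock: "\<And>i. i \<le> b \<Longrightarrow> integrable \<Omega> (stock i)"
begin

lemma mean_stock_ge_selected:
  assumes s: "1 \<le> s" and K: "K \<le> L"
  shows "(\<Sum>k\<le>K. \<Sum>j=1..k. if j \<le> s \<and> s + 1 - j \<le> b
      then mean_order (s + 1 - j) * paths.expectation (sel K r k) - paths.expectation (\<lambda>d. d j * sel K r k d) else 0)
    \<le> mean_stock (min s b)"
proof -
  let ?c = "\<lambda>k \<omega>. sel K r k (reflect (s + L) (fst \<omega>))"
  have summand: "integrable \<Omega> (\<lambda>\<omega>. ?c k \<omega> * (order_at (s + 1 - j) \<omega> - fst \<omega> (s + 1 - j + L)))"
    "\<Omega>.expectation (\<lambda>\<omega>. ?c k \<omega> * (order_at (s + 1 - j) \<omega> - fst \<omega> (s + 1 - j + L)))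
      = mean_order (s + 1 - j) * paths.expectation (sel K r k) - paths.expectation (\<lambda>d. d j * sel K r k d)"
    if "1 \<le> j" "j \<le> s" "s + 1 - j \<le> b" for j k
  proof -
    have q: "integrable \<Omega> (order_at (s + 1 - j))" using that by (intro int_order) auto
    have le: "s + 1 - j \<le> s" using that by simp
    have eq: "(\<lambda>\<omega>. ?c k \<omega> * (order_at (s + 1 - j) \<omega> - fst \<omega> (s + 1 - j + L)))
      = (\<lambda>\<omega>. order_at (s + 1 - j) \<omega> * ?c k \<omega> - fst \<omega> (s + 1 - j + L) * ?c k \<omega>)"
      by (intro ext) (rule trans[OF right_diff_distrib arg_cong2[where f=minus, OF mult.commute mult.commute]])
    note I = order_sel[OF q le K, of r k] demand_sel[OF that(1,2), of K r k]
    show "integrable \<Omega> (\<lambda>\<omega>. ?c k \<omega> * (order_at (s + 1 - j) \<omega> - fst \<omega> (s + 1 - j + L)))"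
      unfolding eq using I(1,3) by (rule Bochner_Integration.integrable_diff)
    show "\<Omega>.expectation (\<lambda>\<omega>. ?c k \<omega> * (order_at (s + 1 - j) \<omega> - fst \<omega> (s + 1 - j + L)))
      = mean_order (s + 1 - j) * paths.expectation (sel K r k) - paths.expectation (\<lambda>d. d j * sel K r k d)"
      unfolding eq Bochner_Integration.integral_diff[OF I(1,3)] I(2,4) ..
  qed
  let ?S = "\<lambda>k j \<omega>. if j \<le> s \<and> s + 1 - j \<le> b
      then ?c k \<omega> * (order_at (s + 1 - j) \<omega> - fst \<omega> (s + 1 - j + L)) else 0"
  have S: "integrable \<Omega> (?S k j)"
    "\<Omega>.expectation (?S k j) = (if j \<le> s \<and> s + 1 - j \<le> b
      then mean_order (s + 1 - j) * paths.expectation (sel K r k) - paths.expectation (\<lambda>d. d j * sel K r k d) else 0)"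
    if "j \<in> {1..k}" for j k
  proof -
    have "integrable \<Omega> (?S k j) \<and> \<Omega>.expectation (?S k j) = (if j \<le> s \<and> s + 1 - j \<le> b
      then mean_order (s + 1 - j) * paths.expectation (sel K r k) - paths.expectation (\<lambda>d. d j * sel K r k d) else 0)"
    proof (cases "j \<le> s \<and> s + 1 - j \<le> b")
      case True
      then show ?thesis using summand[of j k] that by (simp only: if_True atLeastAtMost_iff simp_thms)
    next
      case False
      then show ?thesis by (simp only: if_False) simp
    qed
    then show "integrable \<Omega> (?S k j)"
      "\<Omega>.expectation (?S k j) = (if j \<le> s \<and> s + 1 - j \<le> b
        then mean_order (s + 1 - j) * paths.expectation (sel K r k) - paths.expectation (\<lambda>d. d j * sel K r k d) else 0)"
      by (rule conjunct1, rule conjunct2)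
  qed
  have "\<Omega>.expectation (\<lambda>\<omega>. \<Sum>k\<le>K. \<Sum>j=1..k. ?S k j \<omega>) = (\<Sum>k\<le>K. \<Omega>.expectation (\<lambda>\<omega>. \<Sum>j=1..k. ?S k j \<omega>))"
    by (intro Bochner_Integration.integral_sum Bochner_Integration.integrable_sum S(1))
  also have "\<dots> = (\<Sum>k\<le>K. \<Sum>j=1..k. \<Omega>.expectation (?S k j))"
    by (intro sum.cong refl Bochner_Integration.integral_sum S(1))
  finally have "(\<Sum>k\<le>K. \<Sum>j=1..k. \<Omega>.expectation (?S k j)) = \<Omega>.expectation (\<lambda>\<omega>. \<Sum>k\<le>K. \<Sum>j=1..k. ?S k j \<omega>)" ..
  also have "\<dots> \<le> mean_stock (min s b)"
  proof (rule integral_mono_AE)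
    show "integrable \<Omega> (\<lambda>\<omega>. \<Sum>k\<le>K. \<Sum>j=1..k. ?S k j \<omega>)"
      by (intro Bochner_Integration.integrable_sum S(1))
    show "integrable \<Omega> (stock (min s b))" by (rule int_stock) simp
    show "AE \<omega> in \<Omega>. (\<Sum>k\<le>K. \<Sum>j=1..k. ?S k j \<omega>) \<le> stock (min s b) \<omega>"
      using AE_stock_0 by eventually_elim (rule stock_ge_selected, simp, rule s)
  qed
  also have "(\<Sum>k\<le>K. \<Sum>j=1..k. \<Omega>.expectation (?S k j)) = (\<Sum>k\<le>K. \<Sum>j=1..k. if j \<le> s \<and> s + 1 - j \<le> b
      then mean_order (s + 1 - j) * paths.expectation (sel K r k) - paths.expectation (\<lambda>d. d j * sel K r k d) else 0)"
    by (intro sum.cong refl S(2))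
  finally show ?thesis .
qed

text \<open>
  Windows ending in one of the \<open>K\<close> periods after \<open>b\<close> are charged to the stock at \<open>b\<close>. Then every order
  up to \<open>b\<close> lies in exactly \<open>k\<close> windows of length \<open>k\<close>, and the average order \<open>r\<close> appears.
\<close>

lemma sum_mean_stock_ge:
  assumes K: "K \<le> L" and b: "0 < b"
  defines "r \<equiv> (\<Sum>i=1..b. mean_order i) / real b"
  shows "real b * mean_max K r \<le> (\<Sum>s=1..b. mean_stock s) + real K * mean_stock b"
proof -
  define p where "p k = paths.expectation (sel K r k)" for k
  define w where "w k j = paths.expectation (\<lambda>d. d j * sel K r k d)" for k j
  let ?t = "\<lambda>s k j. if j \<le> s \<and> s + 1 - j \<le> b then mean_order (s + 1 - j) * p k - w k j else 0"
  \<comment> \<open>Since j \<le> K, the index s + 1 - j takes each value from 1 to \<open>b\<close>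
    exactly once while \<open>s\<close> runs from 1 to b + K.\<close>
  have inner: "(\<Sum>s=1..b+K. ?t s k j) = real b * (r * p k - w k j)" if "1 \<le> j" "j \<le> k" "k \<le> K" for k j
  proof -
    have "(\<Sum>s=1..b+K. ?t s k j) = (\<Sum>s\<in>{s\<in>{1..b+K}. j \<le> s \<and> s + 1 - j \<le> b}. mean_order (s + 1 - j) * p k - w k j)"
      by (rule sum.inter_filter[symmetric]) simp
    also have "\<dots> = (\<Sum>i=1..b. mean_order i * p k - w k j)"
      by (rule sum.reindex_bij_witness[where i="\<lambda>i. i + j - 1" and j="\<lambda>s. s + 1 - j"]) (use that in auto)
    also have "\<dots> = (\<Sum>i=1..b. mean_order i) * p k - real b * w k j"
      by (simp add: sum_subtractf sum_distrib_right)
    also have "(\<Sum>i=1..b. mean_order i) = real b * r" using b by (simp add: r_def)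
    finally show ?thesis by (simp add: algebra_simps)
  qed
  have "real b * mean_max K r = (\<Sum>k\<le>K. \<Sum>j=1..k. \<Sum>s=1..b+K. ?t s k j)"
    unfolding mean_max_sel p_def[symmetric] w_def[symmetric] sum_distrib_left
    by (intro sum.cong refl inner[symmetric]) auto
  also have "\<dots> = (\<Sum>k\<le>K. \<Sum>s=1..b+K. \<Sum>j=1..k. ?t s k j)"
    by (intro sum.cong refl sum.swap)
  also have "\<dots> = (\<Sum>s=1..b+K. \<Sum>k\<le>K. \<Sum>j=1..k. ?t s k j)"
    by (rule sum.swap)
  also have "\<dots> \<le> (\<Sum>s=1..b+K. mean_stock (min s b))"
    unfolding p_def w_def by (intro sum_mono mean_stock_ge_selected[OF _ K]) simp
  also have "\<dots> = (\<Sum>s=1..b. mean_stock (min s b)) + (\<Sum>s=Suc b..b+K. mean_stock (min s b))"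
    using sum.ub_add_nat[of 1 b "\<lambda>s. mean_stock (min s b)" K] by simp
  also have "\<dots> = (\<Sum>s=1..b. mean_stock s) + real K * mean_stock b"
    by simp
  finally show ?thesis .
qed

text \<open>The flow balance telescopes, starting from zero mean stock.\<close>

lemma sum_mean_lost:
  "(\<Sum>s=1..b. mean_lost s) = mean_stock b - (\<Sum>i=1..b. mean_order i) + real b * \<mu>"
proof -
  have "n \<le> b \<Longrightarrow> (\<Sum>s=1..n. mean_lost s) = mean_stock n - (\<Sum>i=1..n. mean_order i) + real n * \<mu>" for n
  proof (induction n)
    case 0 then show ?case by (simp add: mean_stock_0)
  next
    case (Suc n)
    have int: "integrable \<Omega> (stock (Suc n))" "integrable \<Omega> (stock n)" "integrable \<Omega> (order_at (Suc n))"
      using Suc.prems int_stock int_order by auto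
    have "lost (Suc n) = (\<lambda>\<omega>. stock (Suc n) \<omega> - stock n \<omega> - order_at (Suc n) \<omega> + fst \<omega> (Suc n + L))"
      using stock_minus_lost[of n] by (auto simp: fun_eq_iff algebra_simps)
    then have "mean_lost (Suc n) = mean_stock (Suc n) - mean_stock n - mean_order (Suc n) + \<mu>"
      using int by simp
    then show ?case using Suc by (simp add: algebra_simps)
  qed
  then show ?thesis by simp
qed

end

end

context policy_run
begin

lemma total_cost_eq_sum:
  fixes f :: "nat \<Rightarrow> 'a :: comm_monoid_add"
  shows "(\<Sum>t=L+1..T+L. f t) = (\<Sum>s=1..T. f (s + L))"
  using sum.shift_bounds_cl_nat_ivl[of f 1 L T] by (simp only: add.commute)

text \<open>
  Split at the last period \<open>b\<close> whose expected holding cost is at most \<open>A\<close>: each later period costs at least \<open>A\<close>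
  by itself, and up to \<open>b\<close> the boundary term of the averaging is at most \<open>A L\<close>.
\<close>

lemma expected_cost_lower_bound:
  assumes fin: "(\<Sum>t=L+1..T+L. \<integral>\<^sup>+\<omega>. ennreal (period_cost h c L T \<pi> \<omega> t) \<partial>\<Omega>) < \<infinity>"
    and A: "0 < A" and \<delta>: "0 \<le> \<delta>" and gap: "\<And>r. A - \<delta> \<le> h * mean_max L r + c * (\<mu> - r)"
  shows "ennreal (A * real T - \<delta> * real T - A * real L)
    \<le> (\<Sum>t=L+1..T+L. \<integral>\<^sup>+\<omega>. ennreal (period_cost h c L T \<pi> \<omega> t) \<partial>\<Omega>)"
proof -
  define cost where "cost s \<omega> = h * stock s \<omega> + c * lost s \<omega>" for s \<omega>
  have m [measurable]: "cost s \<in> borel_measurable \<Omega>" for s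
    unfolding cost_def by (intro borel_measurable_add borel_measurable_times) auto
  have sum_eq: "(\<Sum>t=L+1..T+L. \<integral>\<^sup>+\<omega>. ennreal (period_cost h c L T \<pi> \<omega> t) \<partial>\<Omega>)
      = (\<Sum>s=1..T. \<integral>\<^sup>+\<omega>. ennreal (cost s \<omega>) \<partial>\<Omega>)"
    unfolding total_cost_eq_sum cost_def by (intro sum.cong refl) (simp add: period_cost_eq)
  have bounds: "0 \<le> stock s \<omega>" "h * stock s \<omega> \<le> cost s \<omega>" "c * lost s \<omega> \<le> cost s \<omega>" "0 \<le> cost s \<omega>"
    if "1 \<le> s" for s \<omega>
  proof -
    show i: "0 \<le> stock s \<omega>" using stock_nonneg[of "s - 1" \<omega>] that by simp
    have "0 \<le> h * stock s \<omega>" "0 \<le> c * lost s \<omega>" using i lost_nonneg[of s \<omega>] h_pos c_pos by auto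
    then show "h * stock s \<omega> \<le> cost s \<omega>" "c * lost s \<omega> \<le> cost s \<omega>" "0 \<le> cost s \<omega>"
      unfolding cost_def by linarith+
  qed
  have int: "integrable \<Omega> (cost s)" "integrable \<Omega> (stock s)" "integrable \<Omega> (lost s)" if s: "1 \<le> s" "s \<le> T" for s
  proof -
    have "(\<integral>\<^sup>+\<omega>. ennreal (cost s \<omega>) \<partial>\<Omega>) \<le> (\<Sum>s=1..T. \<integral>\<^sup>+\<omega>. ennreal (cost s \<omega>) \<partial>\<Omega>)"
      using s by (intro member_le_sum) auto
    also have "\<dots> < \<infinity>" using fin unfolding sum_eq .
    finally have "(\<integral>\<^sup>+\<omega>. ennreal (cost s \<omega>) \<partial>\<Omega>) < \<infinity>" .
    then show c: "integrable \<Omega> (cost s)"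
      using bounds(4)[OF s(1)] by (intro integrableI_nonneg) auto
    show "integrable \<Omega> (stock s)"
    proof (rule Bochner_Integration.integrable_bound[of _ "\<lambda>\<omega>. cost s \<omega> / h"])
      show "AE \<omega> in \<Omega>. norm (stock s \<omega>) \<le> norm (cost s \<omega> / h)"
        using bounds[OF s(1)] h_pos by (intro AE_I2) (simp add: field_simps)
    qed (use c in auto)
    show "integrable \<Omega> (lost s)"
    proof (rule Bochner_Integration.integrable_bound[of _ "\<lambda>\<omega>. cost s \<omega> / c"])
      show "AE \<omega> in \<Omega>. norm (lost s \<omega>) \<le> norm (cost s \<omega> / c)"
        using bounds[OF s(1)] lost_nonneg[of s] c_pos by (intro AE_I2) (simp add: field_simps)
    qed (use c in auto)
  qed
  have int_stock: "integrable \<Omega> (stock s)" if "s \<le> T" for s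
    using that int(2)[of s] mean_stock_0(1) by (cases "s = 0") auto
  \<comment> \<open>Integrability of the orders is not assumed; finite cost and the flow balance
    yield it.\<close>
  have int_order: "integrable \<Omega> (order_at s)" if s: "1 \<le> s" "s \<le> T" for s
  proof -
    have "order_at s \<omega> = stock s \<omega> - lost s \<omega> - stock (s - 1) \<omega> + fst \<omega> (s + L)" for \<omega>
      using stock_minus_lost[of "s - 1" \<omega>] s by simp
    then have "order_at s = (\<lambda>\<omega>. stock s \<omega> - lost s \<omega> - stock (s - 1) \<omega> + fst \<omega> (s + L))" ..
    then show ?thesis using int[OF s] int_stock[of "s - 1"] s by simp
  qed
  define mcost where "mcost s = h * mean_stock s + c * mean_lost s" for s
  have mcost: "(\<integral>\<^sup>+\<omega>. ennreal (cost s \<omega>) \<partial>\<Omega>) = ennreal (mcost s)" "h * mean_stock s \<le> mcost s" "0 \<le> mcost s"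
    if s: "1 \<le> s" "s \<le> T" for s
  proof -
    have "\<Omega>.expectation (cost s) = mcost s"
      unfolding cost_def mcost_def using int[OF s] by simp
    then show "(\<integral>\<^sup>+\<omega>. ennreal (cost s \<omega>) \<partial>\<Omega>) = ennreal (mcost s)"
      using nn_integral_eq_integral[OF int(1)[OF s]] bounds(4)[OF s(1)] by simp
    have "0 \<le> mean_lost s" by (intro Bochner_Integration.integral_nonneg lost_nonneg)
    then show "h * mean_stock s \<le> mcost s" unfolding mcost_def using c_pos by simp
    have "0 \<le> mean_stock s" using bounds(1)[OF s(1)] by (intro Bochner_Integration.integral_nonneg)
    then show "0 \<le> mcost s" using \<open>0 \<le> mean_lost s\<close> h_pos c_pos unfolding mcost_def by simp
  qed
  \<comment> \<open>Index 0 lies in \<open>S\<close> because the initial mean stock is 0 and A > 0;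
    \<open>b = 0\<close> means that every period is expensive by itself.\<close>
  define S where "S = {s. s \<le> T \<and> h * mean_stock s \<le> A}"
  define b where "b = Max S"
  have S: "finite S" "0 \<in> S" using A by (simp_all add: S_def mean_stock_0)
  then have "b \<in> S" unfolding b_def by (intro Max_in) auto
  then have b: "b \<le> T" "h * mean_stock b \<le> A" by (simp_all add: S_def)
  have later: "A < h * mean_stock s" if "b < s" "s \<le> T" for s
  proof (rule ccontr)
    assume "\<not> A < h * mean_stock s"
    then have "s \<in> S" using that by (simp add: S_def)
    then have "s \<le> b" unfolding b_def using S by (intro Max_ge)
    then show False using that by simp
  qed
  have late: "A * (real T - real b) \<le> (\<Sum>s=Suc b..T. mcost s)"
  proof -
    have "(\<Sum>s=Suc b..T. A) \<le> (\<Sum>s=Suc b..T. mcost s)"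
    proof (rule sum_mono)
      fix s assume "s \<in> {Suc b..T}"
      then show "A \<le> mcost s" using later[of s] mcost(2)[of s] by simp
    qed
    then show ?thesis using b(1) by (simp add: of_nat_diff mult.commute)
  qed
  have early: "(A - \<delta>) * real b - A * real L \<le> (\<Sum>s=1..b. mcost s)"
  proof (cases "b = 0")
    case True then show ?thesis using A by simp
  next
    case False
    define r where "r = (\<Sum>i=1..b. mean_order i) / real b"
    have io: "integrable \<Omega> (order_at i)" if "1 \<le> i" "i \<le> b" for i using int_order[of i] that b(1) by simp
    have ii: "integrable \<Omega> (stock i)" if "i \<le> b" for i using int_stock[of i] that b(1) by simp
    have stock_sum: "real b * mean_max L r \<le> (\<Sum>s=1..b. mean_stock s) + real L * mean_stock b"
      unfolding r_def by (rule sum_mean_stock_ge[OF io ii]) (use False in simp_all)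
    \<comment> \<open>The term \<open>mean_stock b\<close> only increases the cost and is dropped
      below.\<close>
    have lost_sum: "(\<Sum>s=1..b. mean_lost s) = mean_stock b - real b * r + real b * \<mu>"
      using sum_mean_lost[OF io ii] False by (simp add: r_def)
    have "0 \<le> mean_stock b" using bounds(1)[of b] False by (intro Bochner_Integration.integral_nonneg) auto
    have "(A - \<delta>) * real b \<le> (h * mean_max L r + c * (\<mu> - r)) * real b"
      using gap[of r] by (intro mult_right_mono) auto
    also have "\<dots> = h * (real b * mean_max L r) + c * (real b * \<mu> - real b * r)"
      by (simp add: algebra_simps)
    also have "\<dots> \<le> h * ((\<Sum>s=1..b. mean_stock s) + real L * mean_stock b) + c * (\<Sum>s=1..b. mean_lost s)"
      using stock_sum lost_sum \<open>0 \<le> mean_stock b\<close> h_pos c_pos by (intro add_mono mult_left_mono) auto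
    also have "\<dots> = (\<Sum>s=1..b. mcost s) + real L * (h * mean_stock b)"
      by (simp add: mcost_def sum.distrib sum_distrib_left algebra_simps)
    also have "\<dots> \<le> (\<Sum>s=1..b. mcost s) + real L * A"
      using b(2) by (intro add_left_mono mult_left_mono) auto
    finally show ?thesis by (simp add: mult.commute)
  qed
  have "A * real T - \<delta> * real T - A * real L \<le> (A - \<delta>) * real b - A * real L + A * (real T - real b)"
    using mult_left_mono[of "real b" "real T" \<delta>] b(1) \<delta> by (simp add: algebra_simps)
  also have "\<dots> \<le> (\<Sum>s=1..b. mcost s) + (\<Sum>s=Suc b..T. mcost s)"
    using early late by (rule add_mono)
  also have "\<dots> = (\<Sum>s=1..T. mcost s)"
    using sum.ub_add_nat[of 1 b mcost "T - b"] b(1) by simp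
  finally have "ennreal (A * real T - \<delta> * real T - A * real L) \<le> ennreal (\<Sum>s=1..T. mcost s)"
    by (rule ennreal_leI)
  also have "\<dots> = (\<Sum>s=1..T. ennreal (mcost s))"
    using mcost(3) by (subst sum_ennreal) auto
  also have "\<dots> = (\<Sum>s=1..T. \<integral>\<^sup>+\<omega>. ennreal (cost s \<omega>) \<partial>\<Omega>)"
    using mcost(1) by (intro sum.cong) auto
  finally show ?thesis unfolding sum_eq .
qed

end

section \<open>The cost of the best constant-order policy\<close>

context policy_run
begin

lemma nn_integral_seed:
  assumes [measurable]: "f \<in> borel_measurable borel"
  shows "(\<integral>\<^sup>+\<omega>. f (snd \<omega> t) \<partial>\<Omega>) = (\<integral>\<^sup>+u. f u \<partial>seed_law \<pi> t)"
proof -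
  have f: "f \<in> borel_measurable (seed_law \<pi> t)" by measurable
  have comp: "(\<lambda>u. u t) \<in> seeds \<rightarrow>\<^sub>M seed_law \<pi> t" by (rule measurable_component_singleton) simp
  have "distr \<Omega> seeds snd = seeds"
    unfolding sample_space_eq by (rule distr_pair_snd[OF prob_space_paths prob_space_seeds])
  then have "(\<integral>\<^sup>+\<omega>. f (snd \<omega> t) \<partial>\<Omega>) = (\<integral>\<^sup>+u. f (u t) \<partial>seeds)"
    using nn_integral_distr[OF measurable_snd_Omega, of "\<lambda>u. f (u t)"] measurable_compose[OF comp f] by simp
  also have "\<dots> = (\<integral>\<^sup>+u. f u \<partial>distr seeds (seed_law \<pi> t) (\<lambda>u. u t))"
    using nn_integral_distr[OF comp, of f] f by simp
  also have "distr seeds (seed_law \<pi> t) (\<lambda>u. u t) = seed_law \<pi> t"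
    by (intro distr_PiM_component prob_space_seed) simp
  finally show ?thesis .
qed

text \<open>\<open>X\<close> depends only on demands before \<open>n\<close>, so the demand of
  period \<open>n\<close> can be redrawn independently; stationarity of the law then carries it to
  the next period.\<close>

lemma lindley_step:
  assumes fin: "I_inf_mean D r < \<infinity>"
    and X [measurable]: "X \<in> borel_measurable \<Omega>"
    and X_past: "\<And>d d' u. X (comb_seq n d d', u) = X (d, u)"
    and law: "\<And>f. f \<in> borel_measurable borel \<Longrightarrow> (\<integral>\<^sup>+\<omega>. f (X \<omega>) \<partial>\<Omega>) = (\<integral>\<^sup>+y. f y \<partial>I_inf_law D r)"
    and f [measurable]: "f \<in> borel_measurable borel"
  shows "(\<integral>\<^sup>+\<omega>. f (max 0 (X \<omega> + r - fst \<omega> n)) \<partial>\<Omega>) = (\<integral>\<^sup>+y. f y \<partial>I_inf_law D r)"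
proof -
  interpret \<nu>: prob_space "I_inf_law D r" by (rule prob_space_I_inf_law)
  interpret D\<nu>: pair_sigma_finite D "I_inf_law D r" ..
  define G where "G \<omega> = f (max 0 (X \<omega> + r - fst \<omega> n))" for \<omega>
  have G: "G \<in> borel_measurable \<Omega>"
    unfolding G_def
    by (intro measurable_compose[OF _ f] borel_measurable_max borel_measurable_diff borel_measurable_add
        X measurable_demand borel_measurable_const)
  have "(\<integral>\<^sup>+\<omega>. G \<omega> \<partial>\<Omega>) = (\<integral>\<^sup>+\<omega>. \<integral>\<^sup>+d'. G (comb_seq n (fst \<omega>) d', snd \<omega>) \<partial>paths \<partial>\<Omega>)"
    by (rule nn_integral_resample[OF G, symmetric])
  also have "\<dots> = (\<integral>\<^sup>+\<omega>. \<integral>\<^sup>+d'. f (max 0 (X \<omega> + r - d' 0)) \<partial>paths \<partial>\<Omega>)"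
    unfolding G_def using X_past by (simp add: comb_seq_def)
  also have "\<dots> = (\<integral>\<^sup>+\<omega>. \<integral>\<^sup>+x. f (max 0 (X \<omega> + r - x)) \<partial>D \<partial>\<Omega>)"
  proof (rule nn_integral_cong)
    fix \<omega>
    have "(\<lambda>x. f (max 0 (X \<omega> + r - x))) \<in> borel_measurable D" by measurable
    then show "(\<integral>\<^sup>+d'. f (max 0 (X \<omega> + r - d' 0)) \<partial>paths) = (\<integral>\<^sup>+x. f (max 0 (X \<omega> + r - x)) \<partial>D)"
      using nn_integral_distr[OF measurable_paths_component[of 0], of "\<lambda>x. f (max 0 (X \<omega> + r - x))"]
      by (simp add: distr_paths_component)
  qed
  also have "\<dots> = (\<integral>\<^sup>+y. \<integral>\<^sup>+x. f (max 0 (y + r - x)) \<partial>D \<partial>I_inf_law D r)"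
    by (rule law) measurable
  also have "\<dots> = (\<integral>\<^sup>+x. \<integral>\<^sup>+y. f (max 0 (y + r - x)) \<partial>I_inf_law D r \<partial>D)"
    by (rule D\<nu>.Fubini[of "\<lambda>(x, y). f (max 0 (y + r - x))", simplified]) measurable
  also have "\<dots> = (\<integral>\<^sup>+y. f y \<partial>I_inf_law D r)"
    by (rule I_inf_law_stationary[OF fin f])
  finally show ?thesis by (simp add: G_def)
qed

end

context inventory
begin

lemma I_inf_law_best_mean: "(\<integral>\<^sup>+y. ennreal y \<partial>I_inf_law D z) = ennreal F_best"
  using mean_I_inf_law[of z] by (simp add: I_inf_mean_best)

lemma AE_I_inf_law_nonneg: "AE y in I_inf_law D r. 0 \<le> y"
  unfolding I_inf_law_def by (subst AE_distr_iff) auto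

text \<open>
  In stationarity the best constant-order policy pays in each period the newsvendor cost
  at a random inventory level.
\<close>

lemma g_le_A_best: "g \<le> A_best"
proof -
  let ?\<nu> = "I_inf_law D z"
  interpret \<nu>: prob_space ?\<nu> by (rule prob_space_I_inf_law)
  interpret D\<nu>: pair_sigma_finite D ?\<nu> ..
  define f where "f x y = h * max (y + z - x) 0 + c * max (x - (y + z)) 0" for x y :: real
  have f_nonneg: "0 \<le> f x y" for x y using h_pos c_pos by (simp add: f_def)
  have fm [measurable]: "(\<lambda>(x, y). ennreal (f x y)) \<in> borel_measurable (D \<Otimes>\<^sub>M ?\<nu>)"
    unfolding f_def by measurable
  have "ennreal g = (\<integral>\<^sup>+y. ennreal g \<partial>?\<nu>)" by (simp add: \<nu>.emeasure_space_1)
  also have "\<dots> \<le> (\<integral>\<^sup>+y. \<integral>\<^sup>+x. ennreal (f x y) \<partial>D \<partial>?\<nu>)"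
  proof (rule nn_integral_mono_AE)
    show "AE y in ?\<nu>. ennreal g \<le> (\<integral>\<^sup>+x. ennreal (f x y) \<partial>D)"
      using AE_I_inf_law_nonneg
    proof eventually_elim
      case (elim y)
      have "(\<integral>\<^sup>+x. ennreal (f x y) \<partial>D) = ennreal (\<integral>x. f x y \<partial>D)"
        using f_nonneg by (intro nn_integral_eq_integral) (simp_all add: f_def)
      also have "(\<integral>x. f x y \<partial>D) = newsvendor (y + z)" by (simp add: newsvendor_eq f_def)
      finally show ?case using g_le_newsvendor[of "y + z"] elim z_nonneg by (simp add: ennreal_leI)
    qed
  qed
  also have "\<dots> = (\<integral>\<^sup>+x. \<integral>\<^sup>+y. ennreal (f x y) \<partial>?\<nu> \<partial>D)"
    using D\<nu>.Fubini[OF fm] by simp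
  finally have g1: "ennreal g \<le> (\<integral>\<^sup>+x. \<integral>\<^sup>+y. ennreal (f x y) \<partial>?\<nu> \<partial>D)" .
  have "(\<integral>\<^sup>+x. \<integral>\<^sup>+y. ennreal (f x y) \<partial>?\<nu> \<partial>D) + ennreal (c * (F_best + z))
      = (\<integral>\<^sup>+x. (\<integral>\<^sup>+y. ennreal (f x y) \<partial>?\<nu>) + (\<integral>\<^sup>+y. ennreal (c * (y + z)) \<partial>?\<nu>) \<partial>D)"
  proof -
    have "(\<integral>\<^sup>+y. ennreal (c * (y + z)) \<partial>?\<nu>) = (\<integral>\<^sup>+y. ennreal c * ennreal y + ennreal (c * z) \<partial>?\<nu>)"
    proof (rule nn_integral_cong_AE)
      show "AE y in ?\<nu>. ennreal (c * (y + z)) = ennreal c * ennreal y + ennreal (c * z)"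
        using AE_I_inf_law_nonneg
        by eventually_elim (use z_nonneg c_pos in \<open>simp add: distrib_left ennreal_mult\<close>)
    qed
    also have "\<dots> = ennreal c * ennreal F_best + ennreal (c * z)"
      using I_inf_law_best_mean by (simp add: nn_integral_add nn_integral_cmult \<nu>.emeasure_space_1)
    also have "\<dots> = ennreal (c * (F_best + z))"
      using F_best_nonneg z_nonneg c_pos by (simp add: distrib_left ennreal_plus ennreal_mult)
    finally show ?thesis
      by (subst nn_integral_add) (auto simp: emeasure_space_1[simplified])
  qed
  also have "\<dots> = (\<integral>\<^sup>+x. \<integral>\<^sup>+y. ennreal (h + c) * ennreal (max 0 (y + z - x)) + ennreal (c * x) \<partial>?\<nu> \<partial>D)"
  proof (rule nn_integral_cong_AE)
    show "AE x in D. (\<integral>\<^sup>+y. ennreal (f x y) \<partial>?\<nu>) + (\<integral>\<^sup>+y. ennreal (c * (y + z)) \<partial>?\<nu>)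
        = (\<integral>\<^sup>+y. ennreal (h + c) * ennreal (max 0 (y + z - x)) + ennreal (c * x) \<partial>?\<nu>)"
      using nonneg_D
    proof eventually_elim
      case (elim x)
      have "(\<integral>\<^sup>+y. ennreal (f x y) \<partial>?\<nu>) + (\<integral>\<^sup>+y. ennreal (c * (y + z)) \<partial>?\<nu>)
          = (\<integral>\<^sup>+y. ennreal (f x y) + ennreal (c * (y + z)) \<partial>?\<nu>)"
        by (rule nn_integral_add[symmetric]) (simp_all add: f_def)
      also have "\<dots> = (\<integral>\<^sup>+y. ennreal (h + c) * ennreal (max 0 (y + z - x)) + ennreal (c * x) \<partial>?\<nu>)"
      proof (rule nn_integral_cong_AE)
        show "AE y in ?\<nu>. ennreal (f x y) + ennreal (c * (y + z))
            = ennreal (h + c) * ennreal (max 0 (y + z - x)) + ennreal (c * x)"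
          using AE_I_inf_law_nonneg
        proof eventually_elim
          case (elim y)
          \<comment> \<open>Adding c (y + z) on both sides removes the lost-demand term without
            subtraction in \<open>ennreal\<close>; stationarity evaluates the mean of the remaining
            maximum as \<open>F_best\<close>.\<close>
          have "f x y + c * (y + z) = (h + c) * max 0 (y + z - x) + c * x"
            by (cases "y + z \<le> x") (simp_all add: f_def algebra_simps)
          moreover have "0 \<le> c * (y + z)" "0 \<le> (h + c) * max 0 (y + z - x)" "0 \<le> c * x" "0 \<le> h + c"
            using elim z_nonneg h_pos c_pos \<open>0 \<le> x\<close> by auto
          ultimately show ?case
            using f_nonneg[of x y] by (simp only: ennreal_plus[symmetric] ennreal_mult[symmetric] max.cobounded1)
        qed
      qed
      finally show ?case .
    qed
  qed
  also have "\<dots> = ennreal (h + c) * (\<integral>\<^sup>+x. \<integral>\<^sup>+y. ennreal (max 0 (y + z - x)) \<partial>?\<nu> \<partial>D) + (\<integral>\<^sup>+x. ennreal (c * x) \<partial>D)"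
  proof -
    have inner: "(\<integral>\<^sup>+y. ennreal (h + c) * ennreal (max 0 (y + z - x)) + ennreal (c * x) \<partial>?\<nu>)
        = ennreal (h + c) * (\<integral>\<^sup>+y. ennreal (max 0 (y + z - x)) \<partial>?\<nu>) + ennreal (c * x)" for x
      by (subst nn_integral_add) (simp_all add: nn_integral_cmult \<nu>.emeasure_space_1)
    have "(\<lambda>x. \<integral>\<^sup>+y. ennreal (max 0 (y + z - x)) \<partial>?\<nu>) \<in> borel_measurable D" by measurable
    then show ?thesis unfolding inner
      by (subst nn_integral_add) (simp_all add: nn_integral_cmult)
  qed
  also have "(\<integral>\<^sup>+x. \<integral>\<^sup>+y. ennreal (max 0 (y + z - x)) \<partial>?\<nu> \<partial>D) = ennreal F_best"
    using I_inf_law_stationary[of z ennreal] I_inf_mean_best I_inf_law_best_mean by simp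
  also have "(\<integral>\<^sup>+x. ennreal (c * x) \<partial>D) = ennreal (c * \<mu>)"
    using nonneg_D c_pos by (subst nn_integral_eq_integral) (auto simp: mean_def elim!: eventually_mono)
  also have "ennreal (h + c) * ennreal F_best + ennreal (c * \<mu>) = ennreal ((h + c) * F_best + c * \<mu>)"
    using h_pos c_pos F_best_nonneg mean_pos by (simp add: ennreal_plus ennreal_mult)
  finally have "ennreal g + ennreal (c * (F_best + z)) \<le> ennreal ((h + c) * F_best + c * \<mu>)"
    using g1 by (metis add_right_mono)
  then have "ennreal (g + c * (F_best + z)) \<le> ennreal ((h + c) * F_best + c * \<mu>)"
    using g_pos c_pos F_best_nonneg z_nonneg by (simp add: ennreal_plus)
  then have "g + c * (F_best + z) \<le> (h + c) * F_best + c * \<mu>"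
    using h_pos c_pos F_best_nonneg mean_pos by (subst (asm) ennreal_le_iff) auto
  then show ?thesis by (simp add: A_best_def algebra_simps)
qed

text \<open>The random first order acts as a stationary initial stock plus the usual
  \<open>z\<close>, so from its arrival on every stock has the stationary law and the cost is exact
  for each finite horizon.\<close>

lemma expected_cost_constant_order_policy:
  assumes "0 < L" "L < T"
  shows "expected_total_cost D h c L T (constant_order_policy D z) = ennreal (real T * A_best)"
proof -
  let ?\<pi> = "constant_order_policy D z"
  interpret policy_run D h c L T ?\<pi>
  proof (intro policy_run.intro inventory_axioms policy_run_axioms.intro)
    show "0 < L" by fact
    fix t
    show "prob_space (seed_law ?\<pi> t)"
      by (auto simp: constant_order_policy_def prob_space_I_inf_law intro!: prob_space_return)
    show "sets (seed_law ?\<pi> t) = sets borel"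
      by (simp add: constant_order_policy_def)
    show "(\<lambda>(s, u). order_fun ?\<pi> t s u) \<in> borel_measurable (state_space L \<Otimes>\<^sub>M borel)"
      by (cases "t = 1") (simp_all add: constant_order_policy_def)
  qed
  have order_1: "order_at 1 \<omega> = snd \<omega> 1 + z" for \<omega>
    unfolding order_at_def using assms by (simp add: constant_order_policy_def)
  have order_later: "order_at s \<omega> = z" if "2 \<le> s" "s \<le> T" for s \<omega>
    unfolding order_at_def using that by (simp add: constant_order_policy_def)
  have fin: "I_inf_mean D z < \<infinity>" by (simp add: I_inf_mean_best)
  have law1: "(\<integral>\<^sup>+\<omega>. f (snd \<omega> 1) \<partial>\<Omega>) = (\<integral>\<^sup>+y. f y \<partial>I_inf_law D z)" if "f \<in> borel_measurable borel" for f
    using nn_integral_seed[OF that, of 1] by (simp add: constant_order_policy_def)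
  have law: "(\<integral>\<^sup>+\<omega>. f (stock s \<omega>) \<partial>\<Omega>) = (\<integral>\<^sup>+y. f y \<partial>I_inf_law D z)"
    if "1 \<le> s" "s \<le> T" "f \<in> borel_measurable borel" for f s
    using that
  proof (induction s arbitrary: f rule: dec_induct)
    case base
    have "(\<integral>\<^sup>+\<omega>. f (stock 1 \<omega>) \<partial>\<Omega>) = (\<integral>\<^sup>+\<omega>. f (max 0 (snd \<omega> 1 + z - fst \<omega> (1 + L))) \<partial>\<Omega>)"
    proof (rule nn_integral_cong_AE)
      show "AE \<omega> in \<Omega>. f (stock 1 \<omega>) = f (max 0 (snd \<omega> 1 + z - fst \<omega> (1 + L)))"
        using AE_stock_0
      proof eventually_elim
        case (elim \<omega>)
        have "stock 1 \<omega> = max 0 (snd \<omega> 1 + z - fst \<omega> (1 + L))"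
          using stock_Suc[of 0 \<omega>] order_1[of \<omega>] elim by (simp add: max.commute)
        then show ?case by simp
      qed
    qed
    also have "\<dots> = (\<integral>\<^sup>+y. f y \<partial>I_inf_law D z)"
      by (rule lindley_step[OF fin measurable_seed]) (use law1 base in auto)
    finally show ?case .
  next
    case (step s)
    have "stock (Suc s) \<omega> = max 0 (stock s \<omega> + z - fst \<omega> (Suc s + L))" for \<omega>
      using stock_Suc[of s \<omega>] order_later[of "Suc s" \<omega>] step by (simp add: max.commute)
    then have "(\<integral>\<^sup>+\<omega>. f (stock (Suc s) \<omega>) \<partial>\<Omega>) = (\<integral>\<^sup>+\<omega>. f (max 0 (stock s \<omega> + z - fst \<omega> (Suc s + L))) \<partial>\<Omega>)"
      by simp
    also have "\<dots> = (\<integral>\<^sup>+y. f y \<partial>I_inf_law D z)"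
      by (rule lindley_step[OF fin measurable_stock]) (use step stock_comb_seq[of s "Suc s + L"] in auto)
    finally show ?case .
  qed
  have stock_int: "integrable \<Omega> (stock s)" "mean_stock s = F_best" if "1 \<le> s" "s \<le> T" for s
  proof -
    have nn: "AE \<omega> in \<Omega>. 0 \<le> stock s \<omega>" using stock_nonneg[of "s - 1"] that by simp
    have "(\<integral>\<^sup>+\<omega>. ennreal (stock s \<omega>) \<partial>\<Omega>) = ennreal F_best"
      using law[OF that, of ennreal] I_inf_law_best_mean by simp
    then show "integrable \<Omega> (stock s)" "mean_stock s = F_best"
      using nn F_best_nonneg by (auto intro: integrableI_nn_integral_finite simp: integral_eq_nn_integral)
  qed
  have seed_int: "integrable \<Omega> (\<lambda>\<omega>. snd \<omega> 1)" "\<Omega>.expectation (\<lambda>\<omega>. snd \<omega> 1) = F_best"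
  proof -
    have "(\<integral>\<^sup>+\<omega>. ennreal (snd \<omega> 1) \<partial>\<Omega>) = ennreal F_best"
      using law1[of ennreal] I_inf_law_best_mean by simp
    moreover have "AE \<omega> in \<Omega>. 0 \<le> snd \<omega> 1"
    proof -
      have "(\<integral>\<^sup>+\<omega>. indicator {..<0} (snd \<omega> 1) \<partial>\<Omega>) = (\<integral>\<^sup>+y. indicator {..<0::real} y \<partial>I_inf_law D z)"
        by (rule law1) simp
      also have "\<dots> = (\<integral>\<^sup>+y. 0 \<partial>I_inf_law D z)"
      proof (rule nn_integral_cong_AE)
        show "AE y in I_inf_law D z. indicator {..<0::real} y = (0::ennreal)"
          using AE_I_inf_law_nonneg by eventually_elim simp
      qed
      finally have 0: "(\<integral>\<^sup>+\<omega>. indicator {..<0} (snd \<omega> 1) \<partial>\<Omega>) = 0" by simp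
      have "(\<lambda>\<omega>. indicator {..<0} (snd \<omega> 1) :: ennreal) \<in> borel_measurable \<Omega>"
        by (rule measurable_compose[OF measurable_seed]) simp
      with 0 have "AE \<omega> in \<Omega>. indicator {..<0} (snd \<omega> 1) = (0::ennreal)"
        by (simp only: nn_integral_0_iff_AE)
      then show ?thesis by eventually_elim (auto simp: indicator_def split: if_splits)
    qed
    ultimately show "integrable \<Omega> (\<lambda>\<omega>. snd \<omega> 1)" "\<Omega>.expectation (\<lambda>\<omega>. snd \<omega> 1) = F_best"
      using F_best_nonneg by (auto intro: integrableI_nn_integral_finite simp: integral_eq_nn_integral)
  qed
  have order_int: "integrable \<Omega> (order_at s)" "mean_order s = (if s = 1 then F_best + z else z)"
    if "1 \<le> s" "s \<le> T" for s
  proof -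
    have "order_at s = (if s = 1 then (\<lambda>\<omega>. snd \<omega> 1 + z) else (\<lambda>_. z))"
      using that order_1 order_later[of s] by (auto simp: fun_eq_iff)
    then show "integrable \<Omega> (order_at s)" "mean_order s = (if s = 1 then F_best + z else z)"
      using seed_int \<Omega>.prob_space by auto
  qed
  have int_stock': "integrable \<Omega> (stock s)" if "s \<le> T" for s
    using that stock_int(1)[of s] mean_stock_0(1) by (cases "s = 0") auto
  \<comment> \<open>The surplus \<open>F_best\<close> in the first mean order cancels against the
    mean stock left at the end.\<close>
  have lost_sum: "(\<Sum>s=1..T. mean_lost s) = real T * (\<mu> - z)"
  proof -
    have "(\<Sum>s=1..T. mean_order s) = (\<Sum>s=1..T. z + (if s = 1 then F_best else 0))"
      using order_int(2) by (intro sum.cong) auto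
    also have "\<dots> = real T * z + F_best" using assms by (simp add: sum.distrib)
    finally show ?thesis
      using sum_mean_lost[of T] order_int(1) int_stock' stock_int(2)[of T] assms by (simp add: algebra_simps)
  qed
  have lost_int: "integrable \<Omega> (lost s)" if s: "1 \<le> s" "s \<le> T" for s
  proof -
    have "lost s \<omega> = stock s \<omega> - stock (s - 1) \<omega> - order_at s \<omega> + fst \<omega> (s + L)" for \<omega>
      using stock_minus_lost[of "s - 1" \<omega>] s by simp
    then have "lost s = (\<lambda>\<omega>. stock s \<omega> - stock (s - 1) \<omega> - order_at s \<omega> + fst \<omega> (s + L))" ..
    then show ?thesis using int_stock'[of s] int_stock'[of "s - 1"] order_int(1)[OF s] s by simp
  qed
  have "expected_total_cost D h c L T ?\<pi> = (\<integral>\<^sup>+\<omega>. ennreal (\<Sum>s=1..T. h * stock s \<omega> + c * lost s \<omega>) \<partial>\<Omega>)"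
    unfolding expected_total_cost_def total_cost_eq_sum
    by (intro nn_integral_cong arg_cong[where f=ennreal] sum.cong refl) (simp add: period_cost_eq)
  also have "\<dots> = ennreal (\<Omega>.expectation (\<lambda>\<omega>. \<Sum>s=1..T. h * stock s \<omega> + c * lost s \<omega>))"
  proof (rule nn_integral_eq_integral)
    show "integrable \<Omega> (\<lambda>\<omega>. \<Sum>s=1..T. h * stock s \<omega> + c * lost s \<omega>)"
      using stock_int(1) lost_int by (intro Bochner_Integration.integrable_sum) auto
    show "AE \<omega> in \<Omega>. 0 \<le> (\<Sum>s=1..T. h * stock s \<omega> + c * lost s \<omega>)"
    proof (intro AE_I2 sum_nonneg)
      fix \<omega> s assume "s \<in> {1..T}"
      then show "0 \<le> h * stock s \<omega> + c * lost s \<omega>"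
        using stock_nonneg[of "s - 1" \<omega>] lost_nonneg[of s \<omega>] h_pos c_pos by simp
    qed
  qed
  also have "\<Omega>.expectation (\<lambda>\<omega>. \<Sum>s=1..T. h * stock s \<omega> + c * lost s \<omega>) = (\<Sum>s=1..T. h * mean_stock s + c * mean_lost s)"
    using stock_int(1) lost_int by (subst Bochner_Integration.integral_sum) auto
  also have "\<dots> = real T * (h * F_best) + c * (\<Sum>s=1..T. mean_lost s)"
    using stock_int(2) by (simp add: sum.distrib sum_distrib_left)
  also have "\<dots> = real T * A_best"
    unfolding lost_sum A_best_def by (simp add: algebra_simps)
  finally show ?thesis .
qed

end

section \<open>Asymptotic optimality\<close>

context inventory
begin

text \<open>Policies of infinite cost are trivial; for the others the truncation and boundary losses
  together are at most the fraction \<epsilon>/2 of T A_best.\<close>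

lemma OPT_lower_bound:
  assumes L: "0 < L" and \<epsilon>: "0 < \<epsilon>" "\<epsilon> < 1" and bound: "lead_time_bound D h c \<epsilon> \<le> real L"
    and T: "(1 + 3 / \<epsilon>) * real L \<le> real T"
  shows "ennreal (real T * A_best / (1 + \<epsilon>)) \<le> OPT D h c L T"
  unfolding OPT_def
proof (rule INF_greatest)
  have A: "0 < A_best" using g_pos g_le_A_best by simp
  fix \<pi> assume "\<pi> \<in> {\<pi>. admissible L \<pi>}"
  then have "\<And>t. prob_space (seed_law \<pi> t)" "\<And>t. sets (seed_law \<pi> t) = sets borel"
    "\<And>t. (\<lambda>(s, u). order_fun \<pi> t s u) \<in> borel_measurable (state_space L \<Otimes>\<^sub>M borel)"
    unfolding admissible_def by blast+
  then interpret policy_run D h c L T \<pi>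
    using L by (intro policy_run.intro inventory_axioms policy_run_axioms.intro)
  let ?C = "\<Sum>t=L+1..T+L. \<integral>\<^sup>+\<omega>. ennreal (period_cost h c L T \<pi> \<omega> t) \<partial>\<Omega>"
  show "ennreal (real T * A_best / (1 + \<epsilon>)) \<le> ?C"
  proof (cases "?C < \<infinity>")
    case True
    have "3 * real L \<le> \<epsilon> * real T"
    proof -
      have "\<epsilon> * real L + 3 * real L \<le> \<epsilon> * real T" using T \<epsilon> by (simp add: field_simps)
      moreover have "0 \<le> \<epsilon> * real L" using \<epsilon> by simp
      ultimately show ?thesis by linarith
    qed
    then have LT: "A_best * real L \<le> A_best * (\<epsilon> * real T / 3)"
      using A by (intro mult_left_mono) auto
    have "1 \<le> (1 - \<epsilon> / 2) * (1 + \<epsilon>)"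
      using \<epsilon> mult_left_mono[of \<epsilon> 1 \<epsilon>] by (simp add: algebra_simps)
    then have "1 / (1 + \<epsilon>) \<le> 1 - \<epsilon> / 2" using \<epsilon> by (simp add: divide_le_eq)
    then have "real T * A_best * (1 / (1 + \<epsilon>)) \<le> real T * A_best * (1 - \<epsilon> / 2)"
      using A by (intro mult_left_mono) auto
    also have "\<dots> = A_best * real T - \<epsilon> * A_best / 6 * real T - A_best * (\<epsilon> * real T / 3)"
      by (simp add: algebra_simps)
    also have "\<dots> \<le> A_best * real T - \<epsilon> * A_best / 6 * real T - A_best * real L"
      by (intro diff_left_mono LT)
    finally have "ennreal (real T * A_best / (1 + \<epsilon>))
        \<le> ennreal (A_best * real T - \<epsilon> * A_best / 6 * real T - A_best * real L)"
      by (intro ennreal_leI) simp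
    also have "\<dots> \<le> ?C"
      using mean_max_gap[OF \<epsilon> bound g_le_A_best] A \<epsilon> by (intro expected_cost_lower_bound[OF True]) auto
    finally show ?thesis .
  next
    case False
    then have "?C = \<top>" by (metis infinity_ennreal_def less_top)
    then show ?thesis by (simp only: top_greatest)
  qed
qed

end

theorem theorem1:
  fixes D :: "real measure" and h c \<epsilon> :: real and L T :: nat
  assumes "prob_space D" and "sets D = sets borel"
    and "AE x in D. 0 \<le> x"
    and "integrable D (\<lambda>x. x^3)"
    and "\<not> (\<exists>a. AE x in D. x = a)"
    and "h > 0" and "c > 0"
    and "0 < L" and "L < T"
    and "0 < \<epsilon>" and "\<epsilon> < 1"
    and "real L \<ge> lead_time_bound D h c \<epsilon>"
    and "real T \<ge> (1 + 3 / \<epsilon>) * real L"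
  shows "expected_total_cost D h c L T (constant_order_policy D (best_constant_order D h c))
           / OPT D h c L T \<le> ennreal (1 + \<epsilon>)"
proof -
  interpret D: prob_space D by fact
  interpret inventory D h c
    using assms by unfold_locales auto
  have A: "0 < A_best" using g_pos g_le_A_best by simp
  have low: "ennreal (real T * A_best / (1 + \<epsilon>)) \<le> OPT D h c L T"
    using assms by (intro OPT_lower_bound) auto
  have "0 < ennreal (real T * A_best / (1 + \<epsilon>))" using A assms by simp
  then have pos: "0 < OPT D h c L T" using low by (rule less_le_trans)
  have "ennreal (real T * A_best) = ennreal (1 + \<epsilon>) * ennreal (real T * A_best / (1 + \<epsilon>))"
    using A assms by (subst ennreal_mult[symmetric]) auto
  also have "\<dots> \<le> ennreal (1 + \<epsilon>) * OPT D h c L T" using low by (rule mult_left_mono) simp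
  finally have "ennreal (real T * A_best) \<le> OPT D h c L T * ennreal (1 + \<epsilon>)" by (simp add: mult.commute)
  then show ?thesis
    unfolding expected_cost_constant_order_policy[OF assms(8,9)]
    using pos by (intro divide_le_posI_ennreal)
qed

end
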